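(* Let $K$ be a kernel on $\mathbb R^d$ with an almost star-scale invariant part, with martingale approximation $(X_t)$ and $\bar X_t:=X_t-X_0$. For any $R>0$ we have almost surely $$\sup_{t\ge e}\ \sup_{|x|\le R}\left(\bar X_t(x)-\sqrt{2d}\,t+\frac{\log t}{2\sqrt{2d}}-\frac{4\log\log t}{\sqrt{2d}}\right)<\infty.$$ In particular $\lim_{q\to\infty}\mathbb P[\mathcal A^{(q)}_R]=1$. As a consequence, given $R>0$, almost surely there exists a (random) $q_0\in\mathbb N$ such that for every $q\ge q_0$, $\alpha\in(0,\sqrt{2d}]$, $t\ge0$, $\varepsilon\in(0,1]$ and Borel $E\subset B(0,R)$, $$M^{\alpha,(q)}_t(E)=M^\alpha_t(E)\qquad\text{and}\qquad M^{(q)}_\varepsilon(E)=M_\varepsilon(E).$$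
   Context: Fix $d\ge 1$. $B(x,r)$ is the closed Euclidean ball. A symmetric kernel $K:\mathbb R^d\times\mathbb R^d\to(-\infty,\infty]$ is positive definite if $\int_{\mathbb R^{2d}} K(x,y)\rho(x)\rho(y)\,dx\,dy\ge 0$ for every $\rho\in C_c(\mathbb R^d)$. A kernel $\bar K$ is almost star-scale invariant if $\bar K(x,y)=\int_0^\infty(1-\eta_1e^{-\eta_2 t})\kappa(e^t(x-y))\,dt$, where $\eta_1\in[0,1]$, $\eta_2>0$ and $\kappa$ satisfies: (i) $\kappa\in C_c^\infty(\mathbb R^d)$ and $\kappa(x)=\tilde\kappa(|x|)$ for some $\tilde\kappa:[0,\infty)\to[0,\infty)$; (ii) $\tilde\kappa(0)=1$ and $\tilde\kappa(r)=0$ for $r\ge1$; (iii) $(x,y)\mapsto\kappa(x-y)$ is positive definite. $K$ has an almost star-scale invariant part if $K=K_0+\bar K$ with $\bar K$ almost star-scale invariant and $K_0$ Hölder continuous on $\mathbb R^{2d}$ and positive definite. For $t\ge0$ let $t'\ge 0$ be the unique nonnegative solution of $t'-\frac{\eta_1}{\eta_2}(1-e^{-\eta_2t'})=t$, and set $\bar K_t(x,y):=\int_0^{t'}(1-\eta_1e^{-\eta_2s})\kappa(e^s(x-y))\,ds$, $K_t:=K_0+\bar K_t$, $K_t(x):=K_t(x,x)$ (so $\bar K_t(x,x)=t$). Let $(X_t(x))_{x\in\mathbb R^d,t\ge0}$ be a (continuous) centered Gaussian field with $\mathbb E[X_t(x)X_s(y)]=K_{s\wedge t}(x,y)$, and $\bar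 X_t(x):=X_t(x)-X_0(x)$. The field $X$ is given by $\langle X,\rho\rangle=\lim_{t\to\infty}\int X_t(x)\rho(x)\,dx$, $\rho\in C_c(\mathbb R^d)$. Fix a nonnegative $\theta\in C_c^\infty(\mathbb R^d)$ with support in $B(0,1)$ and $\int\theta=1$, set $\theta_\varepsilon:=\varepsilon^{-d}\theta(\varepsilon^{-1}\cdot)$, $X_\varepsilon(x):=\langle X,\theta_\varepsilon(x-\cdot)\rangle$ (continuous modification), $K_\varepsilon(x):=\mathbb E[X_\varepsilon(x)^2]$, $t_\varepsilon:=\log(1/\varepsilon)$. (Subscript $\varepsilon$ always refers to the mollified field, subscripts $s,t$ to the martingale approximation.) Events: $A^{(q)}_t(x):=\{\forall s\in[0,t],\ \bar X_s(x)<\sqrt{2d}\,s+q\}$ and $\mathcal A^{(q)}_R:=\{\sup_{t>0}\sup_{|x|\le R}(\bar X_t(x)-\sqrt{2d}\,t)<q\}$. Measures, for bounded Borel $E$: $M^\alpha_t(E):=\int_Ee^{\alpha X_t(x)-\frac{\alpha^2}2K_t(x)}dx$, $M^{\alpha,(q)}_t(E):=\int_Ee^{\alpha X_t(x)-\frac{\alpha^2}2K_t(x)}\mathbf 1_{A^{(q)}_t(x)}dx$, $M_\varepsilon(E):=\int_Ee^{\sqrt{2d}X_\varepsilon(x)-dK_\varepsilon(x)}dx$, $M^{(q)}_\varepsilon(E):=\int_Ee^{\sqrt{2d}X_\varepsilon(x)-dK_\varepsilon(x)}\mathbf 1_{A^{(q)}_{t_\varepsilon}(x)}dx$. *)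

theory Defs
  imports "HOL-Probability.Probability"
begin

text \<open>The space \<open>\<real>\<^sup>d\<close> is a type of class \<open>euclidean_space\<close> with \<open>d = DIM('a)\<close>, hence \<open>d \<ge> 1\<close>.\<close>

text \<open>\<open>C\<^sup>k\<close> for a natural number \<open>k\<close>, by recursion on \<open>k\<close> through the partial derivatives.\<close>

primrec C_k :: "nat \<Rightarrow> ('a::euclidean_space \<Rightarrow> real) \<Rightarrow> bool" where
  "C_k 0 f \<longleftrightarrow> continuous_on UNIV f"
| "C_k (Suc k) f \<longleftrightarrow> (\<forall>x. f differentiable at x) \<and>
     (\<forall>b\<in>Basis. C_k k (\<lambda>x. frechet_derivative f (at x) b))"

definition smooth :: "('a::euclidean_space \<Rightarrow> real) \<Rightarrow> bool" where
  "smooth f \<longleftrightarrow> (\<forall>k. C_k k f)"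

definition fun_supp :: "('a::euclidean_space \<Rightarrow> real) \<Rightarrow> 'a set" where
  "fun_supp f = closure {x. f x \<noteq> 0}"

definition Cc :: "('a::euclidean_space \<Rightarrow> real) set" where
  "Cc = {f. continuous_on UNIV f \<and> compact (fun_supp f)}"

definition Cc_smooth :: "('a::euclidean_space \<Rightarrow> real) set" where
  "Cc_smooth = {f. smooth f \<and> compact (fun_supp f)}"

text \<open>Positive definiteness is only needed for the finite continuous kernels \<open>K\<^sub>0\<close> and
  \<open>(x, y) \<mapsto> \<kappa> (x - y)\<close>, for which the integrand below is integrable.\<close>

definition positive_definite_kernel :: "('a::euclidean_space \<Rightarrow> 'a \<Rightarrow> real) \<Rightarrow> bool" where
  "positive_definite_kernel K \<longleftrightarrow> (\<forall>x y. K x y = K y x) \<and>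
     (\<forall>\<rho>\<in>Cc. (LINT z|(lborel :: ('a \<times> 'a) measure).
        K (fst z) (snd z) * \<rho> (fst z) * \<rho> (snd z)) \<ge> 0)"

definition hoelder_kernel :: "('a::euclidean_space \<Rightarrow> 'a \<Rightarrow> real) \<Rightarrow> bool" where
  "hoelder_kernel K \<longleftrightarrow> (\<exists>C \<gamma>. 0 < \<gamma> \<and> \<gamma> \<le> 1 \<and>
     (\<forall>x y x' y'. \<bar>K x y - K x' y'\<bar> \<le> C * dist (x, y) (x', y') powr \<gamma>))"

definition seed_covariance :: "('a::euclidean_space \<Rightarrow> real) \<Rightarrow> bool" where
  "seed_covariance \<kappa> \<longleftrightarrow> \<kappa> \<in> Cc_smooth \<and>
     (\<exists>\<kappa>' :: real \<Rightarrow> real. (\<forall>r\<ge>0. \<kappa>' r \<ge> 0) \<and> (\<forall>x. \<kappa> x = \<kappa>' (norm x)) \<and>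
        \<kappa>' 0 = 1 \<and> (\<forall>r\<ge>1. \<kappa>' r = 0)) \<and>
     positive_definite_kernel (\<lambda>x y. \<kappa> (x - y))"

text \<open>The integrand is nonnegative and the integral is infinite on the diagonal.\<close>

definition star_scale_kernel ::
    "real \<Rightarrow> real \<Rightarrow> ('a::euclidean_space \<Rightarrow> real) \<Rightarrow> 'a \<Rightarrow> 'a \<Rightarrow> ereal" where
  "star_scale_kernel \<eta>1 \<eta>2 \<kappa> x y = enn2ereal
     (\<integral>\<^sup>+ t\<in>{0..}. ennreal ((1 - \<eta>1 * exp (- \<eta>2 * t)) * \<kappa> (exp t *\<^sub>R (x - y))) \<partial>lborel)"

text \<open>The data \<open>K\<^sub>0, \<eta>\<^sub>1, \<eta>\<^sub>2, \<kappa>\<close> witness that \<open>K\<close> has an almost star-scale invariant part. They are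
  kept explicit because the truncated kernels depend on them and not on \<open>K\<close> alone.\<close>

definition almost_star_scale_part ::
    "('a::euclidean_space \<Rightarrow> 'a \<Rightarrow> ereal) \<Rightarrow> ('a \<Rightarrow> 'a \<Rightarrow> real) \<Rightarrow> real \<Rightarrow> real \<Rightarrow> ('a \<Rightarrow> real) \<Rightarrow> bool"
  where
  "almost_star_scale_part K K0 \<eta>1 \<eta>2 \<kappa> \<longleftrightarrow>
     0 \<le> \<eta>1 \<and> \<eta>1 \<le> 1 \<and> 0 < \<eta>2 \<and> seed_covariance \<kappa> \<and>
     hoelder_kernel K0 \<and> positive_definite_kernel K0 \<and>
     (\<forall>x y. K x y = ereal (K0 x y) + star_scale_kernel \<eta>1 \<eta>2 \<kappa> x y)"

definition time_change :: "real \<Rightarrow> real \<Rightarrow> real \<Rightarrow> real" where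
  "time_change \<eta>1 \<eta>2 t = (THE u. 0 \<le> u \<and> u - \<eta>1 / \<eta>2 * (1 - exp (- \<eta>2 * u)) = t)"

definition star_scale_trunc ::
    "real \<Rightarrow> real \<Rightarrow> ('a::euclidean_space \<Rightarrow> real) \<Rightarrow> real \<Rightarrow> 'a \<Rightarrow> 'a \<Rightarrow> real" where
  "star_scale_trunc \<eta>1 \<eta>2 \<kappa> t x y =
     (LINT s:{0..time_change \<eta>1 \<eta>2 t}|lborel. (1 - \<eta>1 * exp (- \<eta>2 * s)) * \<kappa> (exp s *\<^sub>R (x - y)))"

definition trunc_kernel ::
    "('a::euclidean_space \<Rightarrow> 'a \<Rightarrow> real) \<Rightarrow> real \<Rightarrow> real \<Rightarrow> ('a \<Rightarrow> real) \<Rightarrow> real \<Rightarrow> 'a \<Rightarrow> 'a \<Rightarrow> real" where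
  "trunc_kernel K0 \<eta>1 \<eta>2 \<kappa> t x y = K0 x y + star_scale_trunc \<eta>1 \<eta>2 \<kappa> t x y"

text \<open>Degenerate (almost surely zero) variables count as Gaussian.\<close>

definition centered_gaussian_rv :: "'w measure \<Rightarrow> ('w \<Rightarrow> real) \<Rightarrow> bool" where
  "centered_gaussian_rv M Y \<longleftrightarrow> Y \<in> borel_measurable M \<and>
     ((\<exists>\<sigma>>0. distributed M lborel Y (\<lambda>y. ennreal (normal_density 0 \<sigma> y))) \<or> (AE \<omega> in M. Y \<omega> = 0))"

definition centered_gaussian_process :: "'w measure \<Rightarrow> 'i set \<Rightarrow> ('i \<Rightarrow> 'w \<Rightarrow> real) \<Rightarrow> bool" where
  "centered_gaussian_process M I Y \<longleftrightarrow>
     (\<forall>F c. finite F \<and> F \<subseteq> I \<longrightarrow> centered_gaussian_rv M (\<lambda>\<omega>. \<Sum>i\<in>F. c i * Y i \<omega>))"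

definition martingale_approximation ::
    "'w measure \<Rightarrow> (real \<Rightarrow> 'a::euclidean_space \<Rightarrow> 'a \<Rightarrow> real) \<Rightarrow> (real \<Rightarrow> 'a \<Rightarrow> 'w \<Rightarrow> real) \<Rightarrow> bool" where
  "martingale_approximation M Kt X \<longleftrightarrow>
     centered_gaussian_process M ({0..} \<times> UNIV) (\<lambda>(t, x). X t x) \<and>
     (\<forall>t\<ge>0. \<forall>s\<ge>0. \<forall>x y. (LINT \<omega>|M. X t x \<omega> * X s y \<omega>) = Kt (min s t) x y) \<and>
     (\<forall>\<omega>\<in>space M. continuous_on ({0..} \<times> UNIV) (\<lambda>(t, x). X t x \<omega>))"

definition Xbar :: "(real \<Rightarrow> 'a \<Rightarrow> 'w \<Rightarrow> real) \<Rightarrow> real \<Rightarrow> 'a \<Rightarrow> 'w \<Rightarrow> real" where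
  "Xbar X t x \<omega> = X t x \<omega> - X 0 x \<omega>"

text \<open>For each \<open>\<rho> \<in> C\<^sub>c\<close> the limit exists almost surely, by martingale convergence.\<close>

definition field_pairing ::
    "(real \<Rightarrow> 'a::euclidean_space \<Rightarrow> 'w \<Rightarrow> real) \<Rightarrow> ('a \<Rightarrow> real) \<Rightarrow> 'w \<Rightarrow> real" where
  "field_pairing X \<rho> \<omega> = Lim at_top (\<lambda>t. LINT x|lborel. X t x \<omega> * \<rho> x)"

definition mollifier :: "('a::euclidean_space \<Rightarrow> real) \<Rightarrow> bool" where
  "mollifier \<theta> \<longleftrightarrow> \<theta> \<in> Cc_smooth \<and> (\<forall>x. \<theta> x \<ge> 0) \<and> fun_supp \<theta> \<subseteq> cball 0 1 \<and>
     (LINT x|lborel. \<theta> x) = 1"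

definition rescaled :: "('a::euclidean_space \<Rightarrow> real) \<Rightarrow> real \<Rightarrow> 'a \<Rightarrow> real" where
  "rescaled \<theta> \<epsilon> x = \<theta> ((1 / \<epsilon>) *\<^sub>R x) / \<epsilon> ^ DIM('a)"

definition mollified_field ::
    "'w measure \<Rightarrow> (real \<Rightarrow> 'a::euclidean_space \<Rightarrow> 'w \<Rightarrow> real) \<Rightarrow> ('a \<Rightarrow> real) \<Rightarrow>
     (real \<Rightarrow> 'a \<Rightarrow> 'w \<Rightarrow> real) \<Rightarrow> bool" where
  "mollified_field M X \<theta> Xe \<longleftrightarrow> (\<forall>\<epsilon>\<in>{0<..1}.
     (\<forall>x. Xe \<epsilon> x \<in> borel_measurable M \<and>
        (AE \<omega> in M. Xe \<epsilon> x \<omega> = field_pairing X (\<lambda>y. rescaled \<theta> \<epsilon> (x - y)) \<omega>)) \<and>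
     (\<forall>\<omega>\<in>space M. continuous_on UNIV (\<lambda>x. Xe \<epsilon> x \<omega>)))"

definition barrier_event ::
    "'w measure \<Rightarrow> (real \<Rightarrow> 'a::euclidean_space \<Rightarrow> 'w \<Rightarrow> real) \<Rightarrow> real \<Rightarrow> real \<Rightarrow> 'a \<Rightarrow> 'w set" where
  "barrier_event M X q t x =
     {\<omega> \<in> space M. \<forall>s\<in>{0..t}. Xbar X s x \<omega> < sqrt (2 * DIM('a)) * s + q}"

definition global_barrier_event ::
    "'w measure \<Rightarrow> (real \<Rightarrow> 'a::euclidean_space \<Rightarrow> 'w \<Rightarrow> real) \<Rightarrow> real \<Rightarrow> real \<Rightarrow> 'w set" where
  "global_barrier_event M X q R =
     {\<omega> \<in> space M.
        (SUP t\<in>{0<..}. SUP x\<in>cball 0 R. ereal (Xbar X t x \<omega> - sqrt (2 * DIM('a)) * t)) < ereal q}"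

definition chaos_t ::
    "(real \<Rightarrow> 'a::euclidean_space \<Rightarrow> 'a \<Rightarrow> real) \<Rightarrow> (real \<Rightarrow> 'a \<Rightarrow> 'w \<Rightarrow> real) \<Rightarrow>
     real \<Rightarrow> real \<Rightarrow> 'w \<Rightarrow> 'a set \<Rightarrow> ennreal" where
  "chaos_t Kt X \<alpha> t \<omega> E =
     (\<integral>\<^sup>+ x\<in>E. ennreal (exp (\<alpha> * X t x \<omega> - \<alpha>\<^sup>2 / 2 * Kt t x x)) \<partial>lborel)"

definition chaos_t_barrier ::
    "'w measure \<Rightarrow> (real \<Rightarrow> 'a::euclidean_space \<Rightarrow> 'a \<Rightarrow> real) \<Rightarrow> (real \<Rightarrow> 'a \<Rightarrow> 'w \<Rightarrow> real) \<Rightarrow>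
     real \<Rightarrow> real \<Rightarrow> real \<Rightarrow> 'w \<Rightarrow> 'a set \<Rightarrow> ennreal" where
  "chaos_t_barrier M Kt X \<alpha> q t \<omega> E =
     (\<integral>\<^sup>+ x\<in>E. ennreal (exp (\<alpha> * X t x \<omega> - \<alpha>\<^sup>2 / 2 * Kt t x x) *
        indicator (barrier_event M X q t x) \<omega>) \<partial>lborel)"

definition mollified_variance ::
    "'w measure \<Rightarrow> (real \<Rightarrow> 'a \<Rightarrow> 'w \<Rightarrow> real) \<Rightarrow> real \<Rightarrow> 'a \<Rightarrow> real" where
  "mollified_variance M Xe \<epsilon> x = (LINT \<omega>|M. (Xe \<epsilon> x \<omega>)\<^sup>2)"

definition chaos_eps ::
    "'w measure \<Rightarrow> (real \<Rightarrow> 'a::euclidean_space \<Rightarrow> 'w \<Rightarrow> real) \<Rightarrow> real \<Rightarrow> 'w \<Rightarrow> 'a set \<Rightarrow> ennreal" where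
  "chaos_eps M Xe \<epsilon> \<omega> E =
     (\<integral>\<^sup>+ x\<in>E. ennreal (exp (sqrt (2 * DIM('a)) * Xe \<epsilon> x \<omega>
        - DIM('a) * mollified_variance M Xe \<epsilon> x)) \<partial>lborel)"

definition chaos_eps_barrier ::
    "'w measure \<Rightarrow> (real \<Rightarrow> 'a::euclidean_space \<Rightarrow> 'w \<Rightarrow> real) \<Rightarrow> (real \<Rightarrow> 'a \<Rightarrow> 'w \<Rightarrow> real) \<Rightarrow>
     real \<Rightarrow> real \<Rightarrow> 'w \<Rightarrow> 'a set \<Rightarrow> ennreal" where
  "chaos_eps_barrier M X Xe q \<epsilon> \<omega> E =
     (\<integral>\<^sup>+ x\<in>E. ennreal (exp (sqrt (2 * DIM('a)) * Xe \<epsilon> x \<omega>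
        - DIM('a) * mollified_variance M Xe \<epsilon> x) *
        indicator (barrier_event M X q (ln (1 / \<epsilon>)) x) \<omega>) \<partial>lborel)"

end

theory Submission
  imports Defs "HOL-Real_Asymp.Real_Asymp"
begin

text \<open>
  Write \<open>\<gamma> = sqrt (2 * d)\<close>. For fixed \<open>x\<close> the process \<open>t \<mapsto> Xbar X t x\<close> is a Brownian motion, and at time
  \<open>n\<close> the field is essentially constant on balls of radius \<open>exp (- n)\<close>, of which there are about
  \<open>exp (d * n)\<close>. A union bound with Gaussian tails alone yields \<open>Xbar X t x \<le> \<gamma> * t + O(ln t)\<close>. Given such a
  barrier up to time \<open>n\<close>, the Cameron--Martin shift by \<open>\<gamma>\<close> turns the first moment into a ballot problem
  for a centred Gaussian walk, whose probability is of order \<open>n powr (- 3 / 2)\<close> up to powers of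
  \<open>ln n\<close>. Being allowed to exceed \<open>\<gamma> * n - (ln n / 2 - c * ln (ln n)) / \<gamma>\<close> costs a factor
  \<open>sqrt n / ln n powr c\<close>. With the logarithmic barrier and \<open>c = 6\<close> the sum over \<open>n\<close> converges and the
  barrier improves to \<open>\<gamma> * t + O(1)\<close>; with the constant barrier \<open>c = 4\<close> suffices.

  The oscillation inside a ball is controlled by chaining. A single chaining increment and the walk at
  the centre are jointly Gaussian, so both are tilted at once: the increment contributes its
  Gaussian tail, and only shifts the barrier by a bounded amount because it is almost uncorrelated with
  the past of the walk.
\<close>

section \<open>The killed Gaussian random walk\<close>

text \<open>Why two rounds are needed: the ballot bound carries the factor
  \<open>(1 + b + u) * (1 + b + z + u)^2\<close>, where \<open>b\<close> is the height of the
  barrier, \<open>z\<close> the depth of the endpoint, of order \<open>ln n\<close>, and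
  \<open>u = sqrt (ln n)\<close> an allowance for the overshoots of a walk that is watched at
  integer times only. Under a barrier of order \<open>ln n\<close> this factor is of order
  \<open>ln n ^ 3\<close>, so a level with constant \<open>c\<close> leaves terms of order
  \<open>1 / (n * ln n powr (c - 3))\<close>; for \<open>c = 4\<close> that is the divergent series
  of \<open>1 / (n * ln n)\<close>. Under a constant barrier the factor drops to
  \<open>ln n powr (5 / 2)\<close>, and \<open>c = 4\<close> leaves the convergent
  \<open>1 / (n * ln n powr (3 / 2))\<close>.

  Integer times keep every estimate finite dimensional: the killed walk becomes the iteration of one
  integral operator. Values in \<open>ennreal\<close> let Tonelli's theorem apply without
  integrability conditions. The height of the barrier is random, but it can be taken in the
  naturals, so each estimate is made for a fixed height and a countable union of null sets is
  discarded.\<close>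

definition gstep :: "(real \<Rightarrow> ennreal) \<Rightarrow> real \<Rightarrow> ennreal" where
  "gstep f y = (\<integral>\<^sup>+x. f (y + x) * ennreal (std_normal_density x) \<partial>lborel)"

text \<open>The test is made on arrival: \<open>(kstep b ^^ n) f y\<close> requires the positions at
  times 1 to \<open>n\<close> to be at most \<open>b\<close>, while the starting point
  \<open>y\<close> is unconstrained. The index shift in \<open>integral_kstep_pow\<close> comes from
  this.\<close>

definition kstep :: "real \<Rightarrow> (real \<Rightarrow> ennreal) \<Rightarrow> real \<Rightarrow> ennreal" where
  "kstep b f = gstep (\<lambda>x. indicator {..b} x * f x)"

lemma nn_integral_reflect:
  fixes f :: "real \<Rightarrow> ennreal"
  assumes [measurable]: "f \<in> borel_measurable borel"
  shows "(\<integral>\<^sup>+x. f (- x) \<partial>lborel) = (\<integral>\<^sup>+x. f x \<partial>lborel)"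
  using nn_integral_real_affine[of f "-1" 0] by simp

lemma nn_integral_shift:
  fixes f :: "real \<Rightarrow> ennreal"
  assumes [measurable]: "f \<in> borel_measurable borel"
  shows "(\<integral>\<^sup>+x. f (c + x) \<partial>lborel) = (\<integral>\<^sup>+x. f x \<partial>lborel)"
  using nn_integral_real_affine[of f 1 c] by simp

lemma nn_integral_normal_density:
  "0 < \<sigma> \<Longrightarrow> (\<integral>\<^sup>+x. ennreal (normal_density \<mu> \<sigma> x) \<partial>lborel) = 1"
  using prob_space.emeasure_space_1[OF prob_space_normal_density[of \<sigma> \<mu>]]
  by (simp add: emeasure_density)

lemma gstep_alt:
  assumes [measurable]: "f \<in> borel_measurable borel"
  shows "gstep f y = (\<integral>\<^sup>+x. f x * ennreal (std_normal_density (x - y)) \<partial>lborel)"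
  using nn_integral_shift[of "\<lambda>x. f x * ennreal (std_normal_density (x - y))" y]
  unfolding gstep_def by simp

lemma measurable_gstep[measurable]:
  assumes [measurable]: "f \<in> borel_measurable borel"
  shows "gstep f \<in> borel_measurable borel"
  unfolding gstep_def[abs_def] by measurable

lemma measurable_kstep[measurable]:
  assumes [measurable]: "f \<in> borel_measurable borel"
  shows "kstep b f \<in> borel_measurable borel"
  unfolding kstep_def by measurable

lemma measurable_gstep_pow[measurable]:
  "f \<in> borel_measurable borel \<Longrightarrow> (gstep ^^ n) f \<in> borel_measurable borel"
  by (induction n) auto

lemma measurable_kstep_pow[measurable]:
  "f \<in> borel_measurable borel \<Longrightarrow> (kstep b ^^ n) f \<in> borel_measurable borel"
  by (induction n) auto

lemma gstep_mono: "(\<And>x. f x \<le> g x) \<Longrightarrow> gstep f y \<le> gstep g y"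
  unfolding gstep_def by (intro nn_integral_mono mult_right_mono) auto

lemma gstep_const: "gstep (\<lambda>_. c) y = c"
  unfolding gstep_def by (simp add: nn_integral_cmult nn_integral_normal_density)

lemma gstep_cmult:
  assumes [measurable]: "f \<in> borel_measurable borel"
  shows "gstep (\<lambda>x. c * f x) y = c * gstep f y"
  unfolding gstep_def by (simp add: nn_integral_cmult mult.assoc)

lemma gstep_reflect:
  assumes [measurable]: "f \<in> borel_measurable borel"
  shows "gstep f y = (\<integral>\<^sup>+x. f (y - x) * ennreal (std_normal_density x) \<partial>lborel)"
  unfolding gstep_def
  using nn_integral_reflect[of "\<lambda>x. f (y + x) * ennreal (std_normal_density x)"]
  by (simp add: std_normal_density_def)

text \<open>The Gaussian transition density is symmetric. In probabilistic terms this is time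
  reversal of the walk, used to turn the last stretch of a ballot path into a survival
  probability.\<close>

lemma gstep_selfadjoint:
  assumes [measurable]: "f \<in> borel_measurable borel" "g \<in> borel_measurable borel"
  shows "(\<integral>\<^sup>+y. f y * gstep g y \<partial>lborel) = (\<integral>\<^sup>+y. gstep f y * g y \<partial>lborel)"
proof -
  have "(\<integral>\<^sup>+y. f y * gstep g y \<partial>lborel)
      = (\<integral>\<^sup>+y. (\<integral>\<^sup>+x. f y * (g x * ennreal (std_normal_density (x - y))) \<partial>lborel) \<partial>lborel)"
    by (simp add: gstep_alt nn_integral_cmult)
  also have "\<dots> = (\<integral>\<^sup>+x. (\<integral>\<^sup>+y. f y * (g x * ennreal (std_normal_density (x - y))) \<partial>lborel) \<partial>lborel)"
    by (rule lborel_pair.Fubini') measurable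
  also have "\<dots> = (\<integral>\<^sup>+x. (\<integral>\<^sup>+y. g x * (f y * ennreal (std_normal_density (y - x))) \<partial>lborel) \<partial>lborel)"
    by (simp add: std_normal_density_def power2_commute mult_ac)
  also have "\<dots> = (\<integral>\<^sup>+y. gstep f y * g y \<partial>lborel)"
    by (simp add: gstep_alt nn_integral_cmult mult.commute)
  finally show ?thesis .
qed

lemma gstep_pow:
  assumes [measurable]: "f \<in> borel_measurable borel" and "n \<ge> 1"
  shows "(gstep ^^ n) f y = (\<integral>\<^sup>+x. f x * ennreal (normal_density 0 (sqrt n) (x - y)) \<partial>lborel)"
  using \<open>n \<ge> 1\<close>
proof (induction n arbitrary: y rule: dec_induct)
  case base
  then show ?case by (simp add: gstep_alt)
next
  case (step n)
  have n0: "0 < sqrt (real n)" using step by simp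
  have conv: "(\<integral>\<^sup>+u. ennreal (normal_density 0 (sqrt n) (x - u) * std_normal_density (u - y)) \<partial>lborel)
      = ennreal (normal_density 0 (sqrt (Suc n)) (x - y))" for x
  proof -
    have "(\<integral>\<^sup>+u. ennreal (normal_density 0 (sqrt n) (x - u) * std_normal_density (u - y)) \<partial>lborel)
       = (\<integral>\<^sup>+u. ennreal (normal_density 0 (sqrt n) ((x - y) - u) * std_normal_density u) \<partial>lborel)"
      using nn_integral_shift[of "\<lambda>u. ennreal (normal_density 0 (sqrt n) (x - u) * std_normal_density (u - y))" y]
      by (simp add: algebra_simps)
    also have "\<dots> = ennreal (normal_density 0 (sqrt (Suc n)) (x - y))"
      using fun_cong[OF conv_normal_density_zero_mean[OF n0 zero_less_one], of "x - y"]
      by (simp add: add.commute)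
    finally show ?thesis .
  qed
  have "(gstep ^^ Suc n) f y = (\<integral>\<^sup>+u. (gstep ^^ n) f u * ennreal (std_normal_density (u - y)) \<partial>lborel)"
    by (simp add: gstep_alt)
  also have "\<dots> = (\<integral>\<^sup>+u. (\<integral>\<^sup>+x. f x * ennreal (normal_density 0 (sqrt n) (x - u)) * ennreal (std_normal_density (u - y)) \<partial>lborel) \<partial>lborel)"
    by (simp add: step.IH nn_integral_multc)
  also have "\<dots> = (\<integral>\<^sup>+x. (\<integral>\<^sup>+u. f x * ennreal (normal_density 0 (sqrt n) (x - u)) * ennreal (std_normal_density (u - y)) \<partial>lborel) \<partial>lborel)"
    by (rule lborel_pair.Fubini') measurable
  also have "\<dots> = (\<integral>\<^sup>+x. f x * (\<integral>\<^sup>+u. ennreal (normal_density 0 (sqrt n) (x - u) * std_normal_density (u - y)) \<partial>lborel) \<partial>lborel)"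
    by (simp add: nn_integral_cmult[symmetric] mult.assoc ennreal_mult'')
  finally show ?case by (simp only: conv)
qed

lemma normal_density_le:
  "0 < \<sigma> \<Longrightarrow> normal_density \<mu> \<sigma> x \<le> 1 / sqrt (2 * pi * \<sigma>\<^sup>2)"
  unfolding normal_density_def by (simp add: divide_right_mono)

text \<open>The density of the \<open>n\<close>-step law is bounded by its maximum. The bound is
  uniform in the starting point and supplies the factor of the middle stretch in the ballot
  estimate.\<close>

lemma gstep_pow_le:
  assumes [measurable]: "f \<in> borel_measurable borel" and "n \<ge> 1"
  shows "(gstep ^^ n) f y \<le> ennreal (1 / sqrt (2 * pi * n)) * (\<integral>\<^sup>+x. f x \<partial>lborel)"
proof -
  have "(gstep ^^ n) f y \<le> (\<integral>\<^sup>+x. f x * ennreal (1 / sqrt (2 * pi * n)) \<partial>lborel)"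
    unfolding gstep_pow[OF assms] using normal_density_le[of "sqrt n" 0] assms(2)
    by (intro nn_integral_mono mult_left_mono ennreal_leI) auto
  also have "\<dots> = ennreal (1 / sqrt (2 * pi * n)) * (\<integral>\<^sup>+x. f x \<partial>lborel)"
    by (simp add: nn_integral_multc mult.commute)
  finally show ?thesis .
qed

lemma kstep_mono: "(\<And>x. x \<le> b \<Longrightarrow> f x \<le> g x) \<Longrightarrow> kstep b f y \<le> kstep b g y"
  unfolding kstep_def by (intro gstep_mono) (auto simp: indicator_def)

lemma kstep_pow_mono: "(\<And>x. f x \<le> g x) \<Longrightarrow> (kstep b ^^ n) f y \<le> (kstep b ^^ n) g y"
  by (induction n arbitrary: y) (auto intro!: kstep_mono)

lemma kstep_pow_le_gstep_pow: "(kstep b ^^ n) f y \<le> (gstep ^^ n) f y"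
proof (induction n arbitrary: y)
  case (Suc n)
  have "kstep b ((kstep b ^^ n) f) y \<le> gstep ((gstep ^^ n) f) y"
    unfolding kstep_def[of b "(kstep b ^^ n) f"] by (rule gstep_mono) (auto simp: indicator_def Suc)
  then show ?case by simp
qed simp

lemma kstep_pow_cmult:
  assumes [measurable]: "f \<in> borel_measurable borel"
  shows "(kstep b ^^ n) (\<lambda>x. c * f x) = (\<lambda>y. c * (kstep b ^^ n) f y)"
proof (induction n)
  case (Suc n)
  have [measurable]: "(kstep b ^^ n) f \<in> borel_measurable borel" by simp
  have "kstep b (\<lambda>x. c * (kstep b ^^ n) f x) y = c * kstep b ((kstep b ^^ n) f) y" for y
    unfolding kstep_def[of b "(kstep b ^^ n) f"] kstep_def[of b "\<lambda>x. c * (kstep b ^^ n) f x"]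
    by (subst gstep_cmult[symmetric]) (measurable, simp only: mult.left_commute)
  then show ?case by (auto simp: Suc)
qed auto

section \<open>Half-line probabilities and the reflection principle\<close>

abbreviation halfline_prob :: "nat \<Rightarrow> real \<Rightarrow> ennreal" where
  "halfline_prob n \<equiv> (gstep ^^ n) (indicator {0..})"

lemma halfline_prob_mono: "w \<le> w' \<Longrightarrow> halfline_prob n w \<le> halfline_prob n w'"
proof (induction n arbitrary: w w')
  case (Suc n)
  show ?case unfolding funpow.simps comp_def gstep_def[of "halfline_prob n"]
    using Suc by (intro nn_integral_mono mult_right_mono) auto
qed (auto simp: indicator_def)

text \<open>Induction through the symmetry of the step law. It is only an inequality because both
  closed half-lines contain the origin, which is counted twice for \<open>n = 0\<close> and
  \<open>w = 0\<close>.\<close>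

lemma halfline_prob_sym: "1 \<le> halfline_prob n w + halfline_prob n (- w)"
proof (induction n arbitrary: w)
  case (Suc n)
  have "1 = (\<integral>\<^sup>+x. ennreal (std_normal_density x) \<partial>lborel)"
    by (simp add: nn_integral_normal_density)
  also have "\<dots> \<le> (\<integral>\<^sup>+x. halfline_prob n (w + x) * ennreal (std_normal_density x)
      + halfline_prob n (- w - x) * ennreal (std_normal_density x) \<partial>lborel)"
  proof (intro nn_integral_mono)
    fix x
    have "1 * ennreal (std_normal_density x)
        \<le> (halfline_prob n (w + x) + halfline_prob n (- (w + x))) * ennreal (std_normal_density x)"
      using Suc[of "w + x"] by (intro mult_right_mono) auto
    then show "ennreal (std_normal_density x) \<le> halfline_prob n (w + x) * ennreal (std_normal_density x)
      + halfline_prob n (- w - x) * ennreal (std_normal_density x)"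
      by (simp add: distrib_right)
  qed
  also have "\<dots> = halfline_prob (Suc n) w + halfline_prob (Suc n) (- w)"
    by (subst nn_integral_add) (simp_all add: gstep_reflect[of _ "-w"], simp add: gstep_def)
  finally show ?case .
qed (auto simp: indicator_def)

lemma halfline_prob_ge_half: "0 \<le> w \<Longrightarrow> 1 \<le> 2 * halfline_prob n w"
proof -
  assume "0 \<le> w"
  then have "1 \<le> halfline_prob n w + halfline_prob n w"
    using halfline_prob_sym[of n w] halfline_prob_mono[of "-w" w n]
    by (meson add_left_mono neg_le_0_iff_le order_trans)
  then show ?thesis by (simp add: mult_2)
qed

lemma halfline_prob_le:
  assumes "0 \<le> w" "n \<ge> 1"
  shows "2 * halfline_prob n w \<le> 1 + ennreal (2 * w / sqrt (2 * pi * n))"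
proof -
  let ?p = "\<lambda>x. ennreal (normal_density 0 (sqrt n) x)"
  have eq: "halfline_prob n w = (\<integral>\<^sup>+x. indicator {-w..} x * ?p x \<partial>lborel)"
  proof -
    have "halfline_prob n w = (\<integral>\<^sup>+x. indicator {0..} (w + x) * ennreal (normal_density 0 (sqrt n) (w + x - w)) \<partial>lborel)"
      using assms by (subst nn_integral_shift) (simp_all add: gstep_pow)
    also have "\<dots> = (\<integral>\<^sup>+x. indicator {-w..} x * ?p x \<partial>lborel)"
      by (intro nn_integral_cong) (auto simp: indicator_def)
    finally show ?thesis .
  qed
  have eq': "halfline_prob n w = (\<integral>\<^sup>+x. indicator {..w} x * ?p x \<partial>lborel)"
    unfolding eq by (subst nn_integral_reflect[symmetric], measurable)
      (intro nn_integral_cong, auto simp: indicator_def normal_density_def)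
  \<comment> \<open>The half-lines \<open>{-w..}\<close> and \<open>{..w}\<close> have the same
    mass, cover the real line and overlap in \<open>{-w..w}\<close>, where the density is at most
    its maximum.\<close>
  have "2 * halfline_prob n w = (\<integral>\<^sup>+x. indicator {-w..} x * ?p x + indicator {..w} x * ?p x \<partial>lborel)"
    by (subst nn_integral_add) (simp_all add: mult_2 eq[symmetric] eq'[symmetric])
  also have "\<dots> \<le> (\<integral>\<^sup>+x. ?p x + indicator {-w..w} x * ennreal (1 / sqrt (2 * pi * n)) \<partial>lborel)"
    using normal_density_le[of "sqrt n" 0] assms
    by (intro nn_integral_mono) (auto simp: indicator_def intro!: ennreal_leI)
  also have "\<dots> = 1 + ennreal (2 * w / sqrt (2 * pi * n))"
    using assms by (subst nn_integral_add)
      (auto simp: nn_integral_normal_density nn_integral_multc ennreal_mult''[symmetric] simp flip: ennreal_mult')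
  finally show ?thesis .
qed

lemma real_sqrt_nine: "sqrt 9 = 3"
  by (rule real_sqrt_unique) auto

text \<open>For \<open>x > u >= 0\<close> one has \<open>x^2 >= u^2 + (x - u)^2\<close>, so on the
  tail the density is at most \<open>exp (- u^2 / 2)\<close> times the density recentred at
  \<open>u\<close>, whose total mass is one.\<close>

lemma normal_tail_le:
  assumes "0 \<le> u"
  shows "(\<integral>\<^sup>+x. indicator {u<..} x * ennreal (std_normal_density x) \<partial>lborel) \<le> ennreal (exp (- u\<^sup>2 / 2))"
proof -
  have "indicator {u<..} x * ennreal (std_normal_density x)
      \<le> ennreal (exp (- u\<^sup>2 / 2)) * ennreal (normal_density u 1 x)" for x
  proof (cases "u < x")
    case True
    have "0 \<le> u * (x - u)" using True assms by simp
    then have "- x\<^sup>2 / 2 \<le> - u\<^sup>2 / 2 + (- (x - u)\<^sup>2 / 2)"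
      by (simp add: power2_eq_square field_simps)
    then have "exp (- x\<^sup>2 / 2) \<le> exp (- u\<^sup>2 / 2) * exp (- (x - u)\<^sup>2 / 2)"
      by (simp flip: exp_add)
    then have "std_normal_density x \<le> exp (- u\<^sup>2 / 2) * normal_density u 1 x"
      by (simp add: normal_density_def divide_right_mono)
    then show ?thesis using True by (simp add: ennreal_mult'[symmetric] ennreal_leI)
  qed simp
  then have "(\<integral>\<^sup>+x. indicator {u<..} x * ennreal (std_normal_density x) \<partial>lborel)
     \<le> (\<integral>\<^sup>+x. ennreal (exp (- u\<^sup>2 / 2)) * ennreal (normal_density u 1 x) \<partial>lborel)"
    by (intro nn_integral_mono)
  also have "\<dots> = ennreal (exp (- u\<^sup>2 / 2))"
    by (simp add: nn_integral_cmult nn_integral_normal_density)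
  finally show ?thesis .
qed

abbreviation survival :: "real \<Rightarrow> nat \<Rightarrow> real \<Rightarrow> ennreal" where
  "survival b n \<equiv> (kstep b ^^ n) (\<lambda>_. 1)"

text \<open>The reflection principle: \<open>w \<mapsto> 2 * halfline_prob n w - 1\<close> is odd and solves the heat equation, so
  up to overshoots larger than \<open>u\<close> it dominates the survival probability at distance \<open>w - u\<close> from the
  barrier.\<close>

lemma survival_add_one_le:
  fixes u b :: real
  assumes "0 \<le> u" "y \<le> b"
  shows "survival b n y + 1 \<le> 2 * halfline_prob n (b + u - y) + ennreal (n * exp (- u\<^sup>2 / 2))"
  using \<open>y \<le> b\<close>
proof (induction n arbitrary: y)
  case 0
  then show ?case using \<open>0 \<le> u\<close> by (simp add: indicator_def)
next
  case (Suc n)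
  let ?p = "\<lambda>x. ennreal (std_normal_density x)"
  let ?d = "ennreal (n * exp (- u\<^sup>2 / 2))"
  let ?w = "b + u - y"
  \<comment> \<open>The summand 1 on the left avoids the subtraction in
    \<open>2 * halfline_prob n w - 1\<close>. A step \<open>x <= u\<close> that crosses the barrier
    still has \<open>?w - x >= 0\<close>, where this odd function is nonnegative; larger crossing
    steps are paid for by the indicator.\<close>
  have pw: "indicator {..b} (y + x) * survival b n (y + x) + 1
      \<le> 2 * halfline_prob n (?w - x) + ?d + indicator {u<..} x" for x
  proof (cases "y + x \<le> b")
    case True
    then have "survival b n (y + x) + 1 \<le> 2 * halfline_prob n (b + u - (y + x)) + ?d"
      by (rule Suc.IH)
    also have "\<dots> \<le> 2 * halfline_prob n (?w - x) + ?d + indicator {u<..} x"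
      by (simp add: algebra_simps)
    finally show ?thesis using True by simp
  next
    case False
    show ?thesis
    proof (cases "u < x")
      case True
      then show ?thesis using False by simp
    next
      case uf: False
      have "1 \<le> 2 * halfline_prob n (?w - x)"
        using uf Suc.prems by (intro halfline_prob_ge_half) auto
      then show ?thesis using False uf by (simp add: add_increasing2)
    qed
  qed
  have "survival b (Suc n) y + 1
      = (\<integral>\<^sup>+x. (indicator {..b} (y + x) * survival b n (y + x) + 1) * ?p x \<partial>lborel)"
    by (simp add: kstep_def gstep_def distrib_right nn_integral_add nn_integral_normal_density)
  also have "\<dots> \<le> (\<integral>\<^sup>+x. (2 * halfline_prob n (?w - x) + ?d + indicator {u<..} x) * ?p x \<partial>lborel)"
    by (intro nn_integral_mono mult_right_mono pw) auto
  also have "\<dots> = 2 * halfline_prob (Suc n) ?w + ?d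
      + (\<integral>\<^sup>+x. indicator {u<..} x * ?p x \<partial>lborel)"
    by (simp add: distrib_right nn_integral_add nn_integral_cmult nn_integral_normal_density
        gstep_reflect mult.assoc)
  also have "\<dots> \<le> 2 * halfline_prob (Suc n) ?w + ?d + ennreal (exp (- u\<^sup>2 / 2))"
    by (intro add_left_mono normal_tail_le \<open>0 \<le> u\<close>)
  also have "\<dots> = 2 * halfline_prob (Suc n) ?w + ennreal (Suc n * exp (- u\<^sup>2 / 2))"
    by (simp add: add.assoc distrib_right add.commute flip: ennreal_plus)
  finally show ?case .
qed

lemma survival_le:
  fixes u b :: real
  assumes "0 \<le> u" "y \<le> b" "n \<ge> 1"
  shows "survival b n y \<le> ennreal (2 * (b + u - y) / sqrt (2 * pi * n) + n * exp (- u\<^sup>2 / 2))"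
proof -
  have "survival b n y + 1 \<le> (1 + ennreal (2 * (b + u - y) / sqrt (2 * pi * n))) + ennreal (n * exp (- u\<^sup>2 / 2))"
    by (rule order_trans[OF survival_add_one_le[OF assms(1,2)] add_right_mono[OF halfline_prob_le]])
      (use assms in auto)
  also have "\<dots> = ennreal (2 * (b + u - y) / sqrt (2 * pi * n) + n * exp (- u\<^sup>2 / 2)) + 1"
    using assms by (simp add: ennreal_plus[symmetric] ac_simps del: ennreal_plus)
  finally show ?thesis by (simp add: add_right_mono ennreal_add_left_cancel_le add.commute)
qed

section \<open>Time reversal and the ballot estimate\<close>

lemma integral_survival_kstep_pow:
  assumes [measurable]: "g \<in> borel_measurable borel"
  shows "(\<integral>\<^sup>+y. indicator {..b} y * survival b j y * (kstep b ^^ c) g y \<partial>lborel)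
     = (\<integral>\<^sup>+y. indicator {..b} y * survival b (j + c) y * g y \<partial>lborel)"
proof (induction c arbitrary: j)
  case (Suc c)
  have "(\<integral>\<^sup>+y. indicator {..b} y * survival b j y * (kstep b ^^ Suc c) g y \<partial>lborel)
      = (\<integral>\<^sup>+y. indicator {..b} y * survival b (Suc j) y * (kstep b ^^ c) g y \<partial>lborel)"
    unfolding funpow.simps comp_def kstep_def[of b "(kstep b ^^ c) g"]
    by (subst gstep_selfadjoint) (simp_all add: kstep_def[symmetric] mult_ac)
  with Suc[of "Suc j"] show ?case by simp
qed simp

text \<open>Lebesgue measure is invariant under the free step, so a path of \<open>Suc c\<close>
  killed steps, integrated over its starting point, can be read backwards from its endpoint. The
  unconstrained starting point absorbs one step: the reversed path starts below \<open>b\<close> and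
  has only \<open>c\<close> killed steps.\<close>

lemma integral_kstep_pow:
  assumes [measurable]: "g \<in> borel_measurable borel"
  shows "(\<integral>\<^sup>+y. (kstep b ^^ Suc c) g y \<partial>lborel) = (\<integral>\<^sup>+y. indicator {..b} y * survival b c y * g y \<partial>lborel)"
proof -
  have "(\<integral>\<^sup>+y. (kstep b ^^ Suc c) g y \<partial>lborel)
      = (\<integral>\<^sup>+y. indicator {..b} y * survival b 0 y * (kstep b ^^ c) g y \<partial>lborel)"
    using gstep_selfadjoint[of "\<lambda>_. 1" "\<lambda>x. indicator {..b} x * (kstep b ^^ c) g x"]
    by (simp add: kstep_def gstep_const)
  then show ?thesis using integral_survival_kstep_pow[of g b 0 c] by simp
qed

text \<open>The path is cut into three stretches. The first \<open>a\<close> steps must survive from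
  0, the next \<open>m\<close> steps contribute the decay of the transition density, and the last
  \<open>Suc c\<close> steps, read backwards, must survive from an endpoint in
  \<open>{-z..b}\<close>. Each stretch gives an inverse square root, whence the exponent
  3/2.\<close>

lemma ballot_aux:
  fixes b z u :: real
  assumes "0 \<le> b" "0 \<le> z" "0 \<le> u" "a \<ge> 1" "m \<ge> 1" "c \<ge> 1"
  shows "(kstep b ^^ (a + (m + Suc c))) (indicator {-z..}) 0
     \<le> ennreal ((2 * (b + u) / sqrt (2 * pi * a) + a * exp (- u\<^sup>2 / 2)) * (1 / sqrt (2 * pi * m))
        * ((b + z) * (2 * (b + u + z) / sqrt (2 * pi * c) + c * exp (- u\<^sup>2 / 2))))"
proof -
  let ?g = "indicator {-z..} :: real \<Rightarrow> ennreal"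
  let ?C = "2 * (b + u + z) / sqrt (2 * pi * c) + c * exp (- u\<^sup>2 / 2)"
  \<comment> \<open>After the reversal the endpoint lies in an interval of length
    \<open>b + z\<close>, at distance at most \<open>b + z\<close> below the barrier.\<close>
  have "(\<integral>\<^sup>+y. (kstep b ^^ Suc c) ?g y \<partial>lborel) \<le> (\<integral>\<^sup>+y. indicator {-z..b} y * ennreal ?C \<partial>lborel)"
  proof (subst integral_kstep_pow, measurable, intro nn_integral_mono)
    fix y
    show "indicator {..b} y * survival b c y * ?g y \<le> indicator {-z..b} y * ennreal ?C"
    proof (cases "y \<in> {-z..b}")
      case True
      then have "survival b c y \<le> ennreal (2 * (b + u - y) / sqrt (2 * pi * c) + c * exp (- u\<^sup>2 / 2))"
        using assms by (intro survival_le) auto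
      also have "\<dots> \<le> ennreal ?C"
        using True assms by (intro ennreal_leI add_right_mono divide_right_mono) auto
      finally show ?thesis using True by simp
    qed (auto simp: indicator_def)
  qed
  also have "\<dots> = ennreal ((b + z) * ?C)"
    using assms by (simp add: nn_integral_multc ennreal_mult' add.commute)
  finally have int: "(\<integral>\<^sup>+y. (kstep b ^^ Suc c) ?g y \<partial>lborel) \<le> ennreal ((b + z) * ?C)" .
  have pos: "0 \<le> 1 / sqrt (2 * pi * m)" by simp
  \<comment> \<open>The barrier is dropped during the middle stretch. The resulting bound does not
    depend on \<open>y\<close> and hence factors out of the first \<open>a\<close> steps.\<close>
  have mid: "(kstep b ^^ (m + Suc c)) ?g y \<le> ennreal (1 / sqrt (2 * pi * m) * ((b + z) * ?C)) * 1" for y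
  proof -
    have "(kstep b ^^ (m + Suc c)) ?g y \<le> (gstep ^^ m) ((kstep b ^^ Suc c) ?g) y"
      unfolding funpow_add comp_def by (rule kstep_pow_le_gstep_pow)
    also have "\<dots> \<le> ennreal (1 / sqrt (2 * pi * m)) * (\<integral>\<^sup>+x. (kstep b ^^ Suc c) ?g x \<partial>lborel)"
      using assms by (intro gstep_pow_le) auto
    also have "\<dots> \<le> ennreal (1 / sqrt (2 * pi * m)) * ennreal ((b + z) * ?C)"
      by (intro mult_left_mono int) auto
    also have "\<dots> = ennreal (1 / sqrt (2 * pi * m) * ((b + z) * ?C)) * 1"
      by (simp only: ennreal_mult'[OF pos] mult_1_right)
    finally show ?thesis .
  qed
  have "(kstep b ^^ (a + (m + Suc c))) ?g 0
      \<le> (kstep b ^^ a) (\<lambda>_. ennreal (1 / sqrt (2 * pi * m) * ((b + z) * ?C)) * 1) 0"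
    unfolding funpow_add[of a] comp_def by (intro kstep_pow_mono mid)
  also have "\<dots> = ennreal (1 / sqrt (2 * pi * m) * ((b + z) * ?C)) * survival b a 0"
    by (subst kstep_pow_cmult) auto
  also have "\<dots> \<le> ennreal (1 / sqrt (2 * pi * m) * ((b + z) * ?C))
      * ennreal (2 * (b + u) / sqrt (2 * pi * a) + a * exp (- u\<^sup>2 / 2))"
    using survival_le[of u 0 b a] assms by (intro mult_left_mono) auto
  also have "\<dots> = ennreal ((2 * (b + u) / sqrt (2 * pi * a) + a * exp (- u\<^sup>2 / 2)) * (1 / sqrt (2 * pi * m))
        * ((b + z) * ?C))"
    using assms by (subst ennreal_mult'[symmetric]) (auto simp: mult_ac)
  finally show ?thesis .
qed

lemma kstep_pow_le_one: "(\<And>x. f x \<le> 1) \<Longrightarrow> (kstep b ^^ n) f y \<le> 1"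
proof (induction n arbitrary: y)
  case (Suc n)
  have "kstep b ((kstep b ^^ n) f) y \<le> gstep (\<lambda>_. 1) y"
    unfolding kstep_def[of b "(kstep b ^^ n) f"] using Suc by (intro gstep_mono) (auto simp: indicator_def)
  then show ?case by (simp add: gstep_const)
qed simp

lemma ballot:
  fixes b z :: real
  assumes "0 \<le> b" "0 \<le> z" "n \<ge> 4"
  defines "u \<equiv> sqrt (ln n)"
  shows "(kstep b ^^ n) (indicator {-z..}) 0
     \<le> ennreal (200 * (1 + b + u) * (1 + b + z + u)\<^sup>2 / (n * sqrt n))"
proof -
  \<comment> \<open>Both outer stretches get \<open>q\<close> for the survival bound; the one extra
    step is the \<open>Suc\<close> of the reversed stretch. The assumption \<open>n >= 4\<close>
    makes \<open>q\<close> positive, and \<open>12 * q >= n\<close> keeps all three stretches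
    comparable to \<open>n\<close>.\<close>
  define q where "q = (n - 1) div 3"
  define m where "m = n - 1 - 2 * q"
  \<comment> \<open>The overshoot allowance is chosen so that
    \<open>exp (- w^2 / 2) = 1 / (n * sqrt n)\<close>. Then the overshoot error over at most
    \<open>n\<close> steps is at most \<open>1 / sqrt n\<close>, the order of the main term.\<close>
  define w where "w = sqrt 3 * u"
  have q1: "q \<ge> 1" and qn: "12 * q \<ge> n" and mq: "m \<ge> q" and n_eq: "n = q + (m + Suc q)" and "q \<le> n"
    using assms(3) unfolding q_def m_def by auto
  have u0: "0 \<le> u" using assms by (simp add: u_def)
  have w0: "0 \<le> w" "w \<le> 2 * u"
    using u0 by (auto simp: w_def intro!: mult_right_mono real_le_lsqrt)
  have n0: "0 < real n" using assms by simp
  have sn: "0 < sqrt (real n)" using n0 by simp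
  have ew: "exp (- w\<^sup>2 / 2) = 1 / (n * sqrt n)"
  proof -
    have "w\<^sup>2 = 3 * ln n" using n0 assms(3) by (simp add: w_def u_def power_mult_distrib)
    then have "exp (- w\<^sup>2 / 2) = exp (- (ln n + ln (sqrt n)))"
      using n0 by (simp add: ln_sqrt)
    also have "\<dots> = 1 / (n * sqrt n)"
      using n0 by (simp only: exp_minus exp_add exp_ln sn) (simp add: field_simps)
    finally show ?thesis .
  qed
  have tail: "real q * exp (- w\<^sup>2 / 2) \<le> 1 / sqrt n"
    unfolding ew using \<open>q \<le> n\<close> n0 by (simp add: field_simps)
  have inv: "1 / sqrt (2 * pi * k) \<le> 3 / (2 * sqrt n)" if "12 * k \<ge> n" for k :: nat
  proof -
    have "4 * n \<le> 9 * (2 * 3 * real k)" using that by linarith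
    also have "\<dots> \<le> 9 * (2 * pi * real k)"
      using pi_gt3 by (intro mult_left_mono mult_right_mono) auto
    finally have "sqrt (4 * n) \<le> sqrt (9 * (2 * pi * k))" by (rule real_sqrt_le_mono)
    then have "2 * sqrt n \<le> 3 * sqrt (2 * pi * k)"
      by (simp only: real_sqrt_mult real_sqrt_four real_sqrt_nine of_nat_mult of_nat_numeral)
    moreover have "0 < k" using that assms by (cases k) auto
    ultimately show ?thesis using sn by (simp add: field_simps)
  qed
  have fac: "2 * x / sqrt (2 * pi * q) + q * exp (- w\<^sup>2 / 2) \<le> (3 * x + 1) / sqrt n" if "0 \<le> x" for x
  proof -
    have "2 * x / sqrt (2 * pi * q) = 2 * x * (1 / sqrt (2 * pi * q))" by simp
    also have "\<dots> \<le> 2 * x * (3 / (2 * sqrt n))"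
      using that by (intro mult_left_mono inv qn) auto
    finally show ?thesis using tail by (simp add: add_divide_distrib)
  qed
  have "(kstep b ^^ n) (indicator {-z..}) 0
     \<le> ennreal ((2 * (b + w) / sqrt (2 * pi * q) + q * exp (- w\<^sup>2 / 2)) * (1 / sqrt (2 * pi * m))
        * ((b + z) * (2 * (b + w + z) / sqrt (2 * pi * q) + q * exp (- w\<^sup>2 / 2))))"
    by (subst n_eq, rule ballot_aux) (use assms w0 q1 mq in auto)
  also have "\<dots> \<le> ennreal ((3 * (b + w) + 1) / sqrt n * (3 / (2 * sqrt n)) * ((b + z) * ((3 * (b + w + z) + 1) / sqrt n)))"
    using assms w0 qn mq
    by (intro ennreal_leI mult_mono fac inv order_refl mult_nonneg_nonneg add_nonneg_nonneg divide_nonneg_nonneg) auto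
  also have "\<dots> = ennreal (3 / 2 * (3 * (b + w) + 1) * (b + z) * (3 * (b + w + z) + 1) / (n * sqrt n))"
    using sn n0 by (intro arg_cong[of _ _ ennreal]) (simp add: field_simps)
  also have "\<dots> \<le> ennreal (200 * (1 + b + u) * (1 + b + z + u)\<^sup>2 / (n * sqrt n))"
  proof (intro ennreal_leI divide_right_mono)
    have "3 / 2 * (3 * (b + w) + 1) * (b + z) * (3 * (b + w + z) + 1)
       \<le> 3 / 2 * (6 * (1 + b + u)) * (1 + b + z + u) * (6 * (1 + b + z + u))"
      using assms w0 u0 by (intro mult_mono) auto
    also have "\<dots> = 54 * ((1 + b + u) * (1 + b + z + u)\<^sup>2)" by algebra
    also have "\<dots> \<le> 200 * ((1 + b + u) * (1 + b + z + u)\<^sup>2)"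
      using assms u0 by (intro mult_right_mono) auto
    finally show "3 / 2 * (3 * (b + w) + 1) * (b + z) * (3 * (b + w + z) + 1) \<le> 200 * (1 + b + u) * (1 + b + z + u)\<^sup>2"
      by (simp only: mult.assoc)
  qed (use n0 in auto)
  finally show ?thesis .
qed

section \<open>Joint laws of Gaussian variables\<close>

context prob_space
begin

text \<open>The uniqueness theorem for characteristic functions concerns probability measures, while
  \<open>g\<close> may change sign. The weight \<open>(2 + g) / c\<close> is positive and
  normalised, and the hypothesis says that reweighting by it leaves the characteristic function of
  \<open>\<xi>\<close>, hence its law, unchanged. Undoing the affine change gives the factorisation
  for indicators.\<close>

lemma weighted_charfun_real:
  fixes g \<xi> :: "'a \<Rightarrow> real"
  assumes [measurable]: "g \<in> borel_measurable M" "\<xi> \<in> borel_measurable M" "A \<in> sets borel"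
    and g1: "\<And>\<omega>. \<bar>g \<omega>\<bar> \<le> 1"
    and eq: "\<And>t. (CLINT \<omega>|M. complex_of_real (g \<omega>) * iexp (t * \<xi> \<omega>))
        = complex_of_real (expectation g) * (CLINT \<omega>|M. iexp (t * \<xi> \<omega>))"
  shows "expectation (\<lambda>\<omega>. g \<omega> * indicator A (\<xi> \<omega>)) = expectation g * prob {\<omega> \<in> space M. \<xi> \<omega> \<in> A}"
proof -
  have int_g: "integrable M g"
    by (rule integrable_const_bound[where B=1]) (use g1 in auto)
  define c where "c = 2 + expectation g"
  have c1: "c \<ge> 1"
  proof -
    have "expectation (\<lambda>_. -1) \<le> expectation g"
      using g1 by (intro integral_mono int_g) (auto simp: abs_le_iff minus_le_iff)
    then show ?thesis by (simp add: c_def prob_space)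
  qed
  define w where "w \<omega> = (2 + g \<omega>) / c" for \<omega>
  have w0: "0 \<le> w \<omega>" for \<omega>
    using g1[of \<omega>] c1 unfolding w_def by (intro divide_nonneg_pos) (auto simp: abs_le_iff)
  have [measurable]: "w \<in> borel_measurable M" unfolding w_def by measurable
  have int_w: "integrable M w" unfolding w_def using int_g by auto
  have Ew: "expectation w = 1"
    unfolding w_def using int_g c1 by (simp add: prob_space c_def)
  define N where "N = density M (\<lambda>\<omega>. ennreal (w \<omega>))"
  have [measurable_cong, simp]: "sets N = sets M" by (simp add: N_def)
  have "prob_space N"
  proof
    show "emeasure N (space N) = 1"
      using nn_integral_eq_integral[OF int_w] w0 Ew
      by (simp add: N_def emeasure_density)
  qed
  then have dN: "real_distribution (distr N borel \<xi>)"
    by (auto intro!: prob_space.prob_space_distr simp: real_distribution_def real_distribution_axioms_def)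
  have dM: "real_distribution (distr M borel \<xi>)"
    by (simp add: prob_space_distr real_distribution_def real_distribution_axioms_def)
  have int_e: "integrable M (\<lambda>\<omega>. iexp (t * \<xi> \<omega>))" for t
    by (rule integrable_const_bound[where B=1]) auto
  have int_ge: "integrable M (\<lambda>\<omega>. complex_of_real (g \<omega>) * iexp (t * \<xi> \<omega>))" for t
    by (rule integrable_const_bound[where B=1]) (use g1 in \<open>auto simp: norm_mult\<close>)
  have "char (distr N borel \<xi>) t = char (distr M borel \<xi>) t" for t
  proof -
    have "char (distr N borel \<xi>) t = (CLINT \<omega>|N. iexp (t * \<xi> \<omega>))"
      unfolding char_def by (subst integral_distr) auto
    also have "\<dots> = (CLINT \<omega>|M. w \<omega> *\<^sub>R iexp (t * \<xi> \<omega>))"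
      unfolding N_def using w0 by (subst integral_density) auto
    also have "\<dots> = (CLINT \<omega>|M. (2 * iexp (t * \<xi> \<omega>) + complex_of_real (g \<omega>) * iexp (t * \<xi> \<omega>)) / c)"
      by (simp add: w_def scaleR_conv_of_real add_divide_distrib distrib_right)
    also have "\<dots> = (2 * (CLINT \<omega>|M. iexp (t * \<xi> \<omega>)) + (CLINT \<omega>|M. complex_of_real (g \<omega>) * iexp (t * \<xi> \<omega>))) / c"
      using int_e int_ge by simp
    also have "\<dots> = (CLINT \<omega>|M. iexp (t * \<xi> \<omega>))"
    proof -
      have "complex_of_real c \<noteq> 0" using c1 by simp
      then show ?thesis unfolding eq by (simp add: c_def field_simps)
    qed
    also have "\<dots> = char (distr M borel \<xi>) t"
      unfolding char_def by (subst integral_distr) auto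
    finally show ?thesis .
  qed
  then have deq: "distr N borel \<xi> = distr M borel \<xi>"
    by (intro Levy_uniqueness[OF dN dM]) auto
  have int_gA: "integrable M (\<lambda>\<omega>. g \<omega> * indicator A (\<xi> \<omega>))"
    by (rule integrable_const_bound[where B=1]) (use g1 in \<open>auto simp: indicator_def\<close>)
  have int_A: "integrable M (\<lambda>\<omega>. indicator A (\<xi> \<omega>) :: real)"
    by (rule integrable_const_bound[where B=1]) (auto simp: indicator_def)
  have PA: "expectation (\<lambda>\<omega>. indicator A (\<xi> \<omega>) :: real) = prob {\<omega> \<in> space M. \<xi> \<omega> \<in> A}"
  proof -
    have "expectation (\<lambda>\<omega>. indicator A (\<xi> \<omega>) :: real) = expectation (indicator {\<omega> \<in> space M. \<xi> \<omega> \<in> A})"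
      by (rule Bochner_Integration.integral_cong) (auto simp: indicator_def)
    then show ?thesis by simp
  qed
  have "prob {\<omega> \<in> space M. \<xi> \<omega> \<in> A} = (LINT x|distr N borel \<xi>. indicator A x)"
    unfolding deq PA[symmetric] by (subst integral_distr) auto
  also have "\<dots> = (LINT \<omega>|N. indicator A (\<xi> \<omega>))"
    by (subst integral_distr) auto
  also have "\<dots> = expectation (\<lambda>\<omega>. w \<omega> * indicator A (\<xi> \<omega>))"
    unfolding N_def using w0 by (subst integral_density) auto
  also have "\<dots> = expectation (\<lambda>\<omega>. (2 * indicator A (\<xi> \<omega>) + g \<omega> * indicator A (\<xi> \<omega>)) / c)"
    by (simp add: w_def add_divide_distrib distrib_right)
  also have "\<dots> = (2 * prob {\<omega> \<in> space M. \<xi> \<omega> \<in> A} + expectation (\<lambda>\<omega>. g \<omega> * indicator A (\<xi> \<omega>))) / c"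
    using int_A int_gA by (simp add: PA)
  finally show ?thesis using c1 by (simp add: c_def field_simps)
qed

text \<open>The real and imaginary parts of \<open>G\<close> are treated separately. They are
  combinations of \<open>G\<close> and its conjugate, so the factorisation is first needed for the
  conjugate too.\<close>

lemma weighted_charfun:
  fixes G :: "'a \<Rightarrow> complex" and \<xi> :: "'a \<Rightarrow> real"
  assumes [measurable]: "G \<in> borel_measurable M" "\<xi> \<in> borel_measurable M" "A \<in> sets borel"
    and G1: "\<And>\<omega>. cmod (G \<omega>) \<le> 1"
    and eq: "\<And>t. (CLINT \<omega>|M. G \<omega> * iexp (t * \<xi> \<omega>)) = (CLINT \<omega>|M. G \<omega>) * (CLINT \<omega>|M. iexp (t * \<xi> \<omega>))"
  shows "(CLINT \<omega>|M. G \<omega> * indicator A (\<xi> \<omega>)) = (CLINT \<omega>|M. G \<omega>) * prob {\<omega> \<in> space M. \<xi> \<omega> \<in> A}"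
proof -
  have int_G: "integrable M G"
    by (rule integrable_const_bound[where B=1]) (use G1 in auto)
  have int_e: "integrable M (\<lambda>\<omega>. iexp (t * \<xi> \<omega>))" for t
    by (rule integrable_const_bound[where B=1]) auto
  have int_Ge: "integrable M (\<lambda>\<omega>. G \<omega> * iexp (t * \<xi> \<omega>))" for t
    by (rule integrable_const_bound[where B=1]) (use G1 in \<open>auto simp: norm_mult\<close>)
  have [measurable]: "(\<lambda>\<omega>. cnj (G \<omega>)) \<in> borel_measurable M"
    by (rule measurable_compose[OF assms(1) borel_measurable_continuous_onI]) (intro continuous_intros)
  have int_cGe: "integrable M (\<lambda>\<omega>. cnj (G \<omega>) * iexp (t * \<xi> \<omega>))" for t
    by (rule integrable_const_bound[where B=1]) (use G1 in \<open>auto simp: norm_mult\<close>)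
  have cnj_e: "cnj (iexp s) = iexp (- s)" for s :: real
    by (simp add: exp_cnj)
  \<comment> \<open>Conjugate the hypothesis at the frequency \<open>- t\<close>.\<close>
  have eq': "(CLINT \<omega>|M. cnj (G \<omega>) * iexp (t * \<xi> \<omega>)) = cnj (CLINT \<omega>|M. G \<omega>) * (CLINT \<omega>|M. iexp (t * \<xi> \<omega>))" for t
  proof -
    have "(CLINT \<omega>|M. cnj (G \<omega>) * iexp (t * \<xi> \<omega>)) = (CLINT \<omega>|M. cnj (G \<omega> * iexp ((- t) * \<xi> \<omega>)))"
      by (simp only: complex_cnj_mult cnj_e) simp
    also have "\<dots> = cnj ((CLINT \<omega>|M. G \<omega>) * (CLINT \<omega>|M. iexp ((- t) * \<xi> \<omega>)))"
      unfolding eq[symmetric] by (rule Bochner_Integration.integral_cnj)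
    also have "\<dots> = cnj (CLINT \<omega>|M. G \<omega>) * (CLINT \<omega>|M. cnj (iexp ((- t) * \<xi> \<omega>)))"
      unfolding complex_cnj_mult by (subst Bochner_Integration.integral_cnj) (rule refl)
    also have "\<dots> = cnj (CLINT \<omega>|M. G \<omega>) * (CLINT \<omega>|M. iexp (t * \<xi> \<omega>))"
      by (simp only: cnj_e) simp
    finally show ?thesis .
  qed
  have re: "expectation (\<lambda>\<omega>. Re (G \<omega>) * indicator A (\<xi> \<omega>)) = expectation (\<lambda>\<omega>. Re (G \<omega>)) * prob {\<omega> \<in> space M. \<xi> \<omega> \<in> A}"
  proof (rule weighted_charfun_real)
    fix t
    have "(CLINT \<omega>|M. complex_of_real (Re (G \<omega>)) * iexp (t * \<xi> \<omega>))
        = (CLINT \<omega>|M. (G \<omega> * iexp (t * \<xi> \<omega>) + cnj (G \<omega>) * iexp (t * \<xi> \<omega>)) / 2)"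
      by (intro Bochner_Integration.integral_cong) (auto simp: complex_add_cnj simp flip: distrib_right)
    also have "\<dots> = ((CLINT \<omega>|M. G \<omega>) + cnj (CLINT \<omega>|M. G \<omega>)) / 2 * (CLINT \<omega>|M. iexp (t * \<xi> \<omega>))"
    proof -
      have "(CLINT \<omega>|M. (G \<omega> * iexp (t * \<xi> \<omega>) + cnj (G \<omega>) * iexp (t * \<xi> \<omega>)) / 2)
          = ((CLINT \<omega>|M. G \<omega> * iexp (t * \<xi> \<omega>)) + (CLINT \<omega>|M. cnj (G \<omega>) * iexp (t * \<xi> \<omega>))) / 2"
        using int_Ge[of t] int_cGe[of t] by (simp del: of_real_mult)
      then show ?thesis unfolding eq eq' by (simp only: distrib_right times_divide_eq_left)
    qed
    also have "\<dots> = complex_of_real (expectation (\<lambda>\<omega>. Re (G \<omega>))) * (CLINT \<omega>|M. iexp (t * \<xi> \<omega>))"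
      using int_G by (simp add: complex_add_cnj)
    finally show "(CLINT \<omega>|M. complex_of_real (Re (G \<omega>)) * iexp (t * \<xi> \<omega>))
       = complex_of_real (expectation (\<lambda>\<omega>. Re (G \<omega>))) * (CLINT \<omega>|M. iexp (t * \<xi> \<omega>))" .
  qed (use G1 abs_Re_le_cmod in \<open>auto intro: order_trans\<close>)
  have Im_eq: "complex_of_real (Im z) = (z - cnj z) / (2 * \<i>)" for z
    by (simp add: complex_eq_iff)
  have im: "expectation (\<lambda>\<omega>. Im (G \<omega>) * indicator A (\<xi> \<omega>)) = expectation (\<lambda>\<omega>. Im (G \<omega>)) * prob {\<omega> \<in> space M. \<xi> \<omega> \<in> A}"
  proof (rule weighted_charfun_real)
    fix t
    have "(CLINT \<omega>|M. complex_of_real (Im (G \<omega>)) * iexp (t * \<xi> \<omega>))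
        = (CLINT \<omega>|M. (G \<omega> * iexp (t * \<xi> \<omega>) - cnj (G \<omega>) * iexp (t * \<xi> \<omega>)) / (2 * \<i>))"
    proof (intro Bochner_Integration.integral_cong refl)
      fix \<omega>
      show "complex_of_real (Im (G \<omega>)) * iexp (t * \<xi> \<omega>)
          = (G \<omega> * iexp (t * \<xi> \<omega>) - cnj (G \<omega>) * iexp (t * \<xi> \<omega>)) / (2 * \<i>)"
        by (simp only: Im_eq left_diff_distrib times_divide_eq_left)
    qed
    also have "\<dots> = ((CLINT \<omega>|M. G \<omega>) - cnj (CLINT \<omega>|M. G \<omega>)) / (2 * \<i>) * (CLINT \<omega>|M. iexp (t * \<xi> \<omega>))"
    proof -
      have "(CLINT \<omega>|M. (G \<omega> * iexp (t * \<xi> \<omega>) - cnj (G \<omega>) * iexp (t * \<xi> \<omega>)) / (2 * \<i>))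
          = ((CLINT \<omega>|M. G \<omega> * iexp (t * \<xi> \<omega>)) - (CLINT \<omega>|M. cnj (G \<omega>) * iexp (t * \<xi> \<omega>))) / (2 * \<i>)"
        using int_Ge[of t] int_cGe[of t] by (simp del: of_real_mult)
      then show ?thesis unfolding eq eq' by (simp only: left_diff_distrib times_divide_eq_left)
    qed
    also have "\<dots> = complex_of_real (expectation (\<lambda>\<omega>. Im (G \<omega>))) * (CLINT \<omega>|M. iexp (t * \<xi> \<omega>))"
      using int_G by (simp only: Im_eq[symmetric] integral_Im)
    finally show "(CLINT \<omega>|M. complex_of_real (Im (G \<omega>)) * iexp (t * \<xi> \<omega>))
       = complex_of_real (expectation (\<lambda>\<omega>. Im (G \<omega>))) * (CLINT \<omega>|M. iexp (t * \<xi> \<omega>))" .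
  qed (use G1 abs_Im_le_cmod in \<open>auto intro: order_trans\<close>)
  have int_GA: "integrable M (\<lambda>\<omega>. G \<omega> * indicator A (\<xi> \<omega>))"
    by (rule integrable_const_bound[where B=1]) (use G1 in \<open>auto simp: indicator_def\<close>)
  have ind: "Re (indicator A x) = indicator A x" "Im (indicator A x) = 0" for x :: real
    by (auto simp: indicator_def)
  show ?thesis
    using re im int_G int_GA
    by (intro complex_eqI) (simp_all add: ind integral_Re[symmetric] integral_Im[symmetric] del: integral_Re integral_Im)
qed

text \<open>Kac's theorem: the coordinates are replaced one at a time, a character \<open>iexp (c i * Z i)\<close> by an
  indicator.\<close>

lemma distr_eq_PiM_of_charfun:
  fixes Z :: "'i \<Rightarrow> 'a \<Rightarrow> real"
  assumes fin: "finite I" and Z[measurable]: "\<And>i. i \<in> I \<Longrightarrow> Z i \<in> borel_measurable M"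
    and fac: "\<And>c. (CLINT \<omega>|M. iexp (\<Sum>i\<in>I. c i * Z i \<omega>)) = (\<Prod>i\<in>I. CLINT \<omega>|M. iexp (c i * Z i \<omega>))"
  shows "distr M (PiM I (\<lambda>_. borel)) (\<lambda>\<omega>. \<lambda>i\<in>I. Z i \<omega>) = PiM I (\<lambda>i. distr M borel (Z i))"
proof -
  \<comment> \<open>The frequencies \<open>c\<close> stay arbitrary in the induction: replacing the
    character of the coordinate \<open>j\<close> by an indicator needs the factorisation for every
    frequency \<open>t\<close> there, obtained from \<open>c(j := t)\<close>.\<close>
  have key: "(CLINT \<omega>|M. (\<Prod>i\<in>J. indicator (A i) (Z i \<omega>)) * iexp (\<Sum>i\<in>I - J. c i * Z i \<omega>))
      = (\<Prod>i\<in>J. complex_of_real (prob {\<omega> \<in> space M. Z i \<omega> \<in> A i})) * (\<Prod>i\<in>I - J. CLINT \<omega>|M. iexp (c i * Z i \<omega>))"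
    if A: "\<And>i. i \<in> I \<Longrightarrow> A i \<in> sets borel" and "finite J" "J \<subseteq> I" for J A c
    using \<open>finite J\<close> \<open>J \<subseteq> I\<close>
  proof (induction J arbitrary: c)
    case empty
    then show ?case using fac by simp
  next
    case (insert j J)
    define K where "K = I - insert j J"
    have IJ: "I - J = insert j K" "j \<notin> K" "finite K" and jI: "j \<in> I" "A j \<in> sets borel"
      and KI: "\<And>k. k \<in> K \<Longrightarrow> k \<in> I" and JI: "\<And>k. k \<in> J \<Longrightarrow> k \<in> I"
      using insert A fin by (auto simp: K_def)
    define G where "G \<omega> = (\<Prod>i\<in>J. indicator (A i) (Z i \<omega>)) * iexp (\<Sum>i\<in>K. c i * Z i \<omega>)" for \<omega>
    have [measurable]: "(\<lambda>\<omega>. indicator (A i) (Z i \<omega>) :: complex) \<in> borel_measurable M" if "i \<in> J" for i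
      using measurable_compose[OF Z[OF JI[OF that]] borel_measurable_indicator[OF A[OF JI[OF that]]]] .
    have [measurable]: "(\<lambda>\<omega>. Z i \<omega>) \<in> borel_measurable M" if "i \<in> K" for i
      using Z[OF KI[OF that]] .
    have [measurable]: "G \<in> borel_measurable M" unfolding G_def by measurable
    have G1: "cmod (G \<omega>) \<le> 1" for \<omega>
      unfolding G_def norm_mult norm_exp_i_times mult_1_right
      by (subst prod_norm[symmetric], rule prod_le_1) (auto simp: indicator_def)
    let ?C = "(\<Prod>i\<in>J. complex_of_real (prob {\<omega> \<in> space M. Z i \<omega> \<in> A i})) * (\<Prod>i\<in>K. CLINT \<omega>|M. iexp (c i * Z i \<omega>))"
    have Gt: "(CLINT \<omega>|M. G \<omega> * iexp (t * Z j \<omega>)) = ?C * (CLINT \<omega>|M. iexp (t * Z j \<omega>))" for t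
    proof -
      have s: "(\<Sum>i\<in>insert j K. (c(j := t)) i * Z i \<omega>) = t * Z j \<omega> + (\<Sum>i\<in>K. c i * Z i \<omega>)" for \<omega>
        using IJ by (auto intro!: sum.cong)
      have p: "(\<Prod>i\<in>insert j K. CLINT \<omega>|M. iexp ((c(j := t)) i * Z i \<omega>))
          = (CLINT \<omega>|M. iexp (t * Z j \<omega>)) * (\<Prod>i\<in>K. CLINT \<omega>|M. iexp (c i * Z i \<omega>))"
        using IJ by (auto intro!: prod.cong)
      have "(CLINT \<omega>|M. G \<omega> * iexp (t * Z j \<omega>))
         = (CLINT \<omega>|M. (\<Prod>i\<in>J. indicator (A i) (Z i \<omega>)) * iexp (\<Sum>i\<in>I - J. (c(j := t)) i * Z i \<omega>))"
        unfolding IJ(1) s G_def by (simp only: of_real_add distrib_left exp_add mult_ac)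
      also have "\<dots> = (\<Prod>i\<in>J. complex_of_real (prob {\<omega> \<in> space M. Z i \<omega> \<in> A i}))
          * (\<Prod>i\<in>insert j K. CLINT \<omega>|M. iexp ((c(j := t)) i * Z i \<omega>))"
        using insert.IH[of "c(j := t)"] insert.prems unfolding IJ(1) by blast
      also have "\<dots> = ?C * (CLINT \<omega>|M. iexp (t * Z j \<omega>))"
        unfolding p by (simp only: mult_ac)
      finally show ?thesis .
    qed
    have G0: "(CLINT \<omega>|M. G \<omega>) = ?C"
      using Gt[of 0] by (simp add: prob_space)
    have "(CLINT \<omega>|M. G \<omega> * indicator (A j) (Z j \<omega>)) = ?C * prob {\<omega> \<in> space M. Z j \<omega> \<in> A j}"
      using weighted_charfun[of G "Z j" "A j"] G1 Gt jI Z by (simp add: G0)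
    then show ?case
      using insert by (simp add: G_def K_def mult_ac)
  qed
  \<comment> \<open>The locale asks for a sigma-finite measure at every index of the type, whereas
    \<open>Z\<close> is measurable only on \<open>I\<close>; a point mass fills the remaining
    indices.\<close>
  interpret P: product_sigma_finite "\<lambda>i. if i \<in> I then distr M borel (Z i) else return borel 0"
    by (intro product_sigma_finite.intro prob_space_imp_sigma_finite) (auto intro!: prob_space_distr prob_space_return)
  have PiM_eq: "PiM I (\<lambda>i. if i \<in> I then distr M borel (Z i) else return borel 0) = PiM I (\<lambda>i. distr M borel (Z i))"
    by (intro PiM_cong) auto
  show ?thesis
    unfolding PiM_eq[symmetric]
  proof (rule P.PiM_eqI[OF fin])
    fix A assume "\<And>i. i \<in> I \<Longrightarrow> A i \<in> sets (if i \<in> I then distr M borel (Z i) else return borel 0)"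
    then have A: "\<And>i. i \<in> I \<Longrightarrow> A i \<in> sets borel" by simp
    have S: "(\<lambda>\<omega>. \<lambda>i\<in>I. Z i \<omega>) \<in> measurable M (PiM I (\<lambda>_. borel))"
      by (rule measurable_restrict) simp
    have "of_real (prob {\<omega> \<in> space M. \<forall>i\<in>I. Z i \<omega> \<in> A i})
       = (CLINT \<omega>|M. complex_of_real (indicator {\<omega> \<in> space M. \<forall>i\<in>I. Z i \<omega> \<in> A i} \<omega>))"
    proof -
      have "{\<omega> \<in> space M. \<forall>i\<in>I. Z i \<omega> \<in> A i} \<in> sets M"
        using fin A by (intro sets.sets_Collect_finite_All) (auto intro: measurable_sets_Collect[OF Z, of _ "\<lambda>x. x \<in> A _"])
      then show ?thesis
        by simp
    qed
    also have "\<dots> = (CLINT \<omega>|M. (\<Prod>i\<in>I. indicator (A i) (Z i \<omega>)))"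
      using fin by (intro Bochner_Integration.integral_cong) (auto simp: indicator_def)
    also have "\<dots> = of_real (\<Prod>i\<in>I. prob {\<omega> \<in> space M. Z i \<omega> \<in> A i})"
      using key[OF A fin order_refl] by simp
    finally have pr: "prob {\<omega> \<in> space M. \<forall>i\<in>I. Z i \<omega> \<in> A i} = (\<Prod>i\<in>I. prob {\<omega> \<in> space M. Z i \<omega> \<in> A i})"
      by (simp only: of_real_eq_iff)
    have "emeasure (distr M (PiM I (\<lambda>_. borel)) (\<lambda>\<omega>. \<lambda>i\<in>I. Z i \<omega>)) (Pi\<^sub>E I A)
       = emeasure M {\<omega> \<in> space M. \<forall>i\<in>I. Z i \<omega> \<in> A i}"
      using S A fin by (subst emeasure_distr) (auto intro!: arg_cong[of _ _ "emeasure M"] simp: PiE_iff)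
    also have "\<dots> = (\<Prod>i\<in>I. emeasure M {\<omega> \<in> space M. Z i \<omega> \<in> A i})"
      by (simp add: emeasure_eq_measure pr prod_ennreal)
    also have "\<dots> = (\<Prod>i\<in>I. emeasure (if i \<in> I then distr M borel (Z i) else return borel 0) (A i))"
      using A by (intro prod.cong refl) (auto simp: emeasure_distr vimage_def Int_def intro!: arg_cong[of _ _ "emeasure M"])
    finally show "emeasure (distr M (PiM I (\<lambda>_. borel)) (\<lambda>\<omega>. \<lambda>i\<in>I. Z i \<omega>)) (Pi\<^sub>E I A)
       = (\<Prod>i\<in>I. emeasure (if i \<in> I then distr M borel (Z i) else return borel 0) (A i))" .
  qed (auto intro!: sets_PiM_cong)
qed

end

section \<open>Moments and characteristic functions of a single Gaussian variable\<close>

lemma nn_integral_exp_normal: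
  assumes "0 < \<sigma>"
  shows "(\<integral>\<^sup>+x. ennreal (exp x) * ennreal (normal_density 0 \<sigma> x) \<partial>lborel) = ennreal (exp (\<sigma>\<^sup>2 / 2))"
proof -
  have "exp x * normal_density 0 \<sigma> x = exp (\<sigma>\<^sup>2 / 2) * normal_density (\<sigma>\<^sup>2) \<sigma> x" for x
  proof -
    have "x + - x\<^sup>2 / (2 * \<sigma>\<^sup>2) = \<sigma>\<^sup>2 / 2 + - (x - \<sigma>\<^sup>2)\<^sup>2 / (2 * \<sigma>\<^sup>2)"
      using assms by (simp add: field_simps power2_eq_square)
    then have "exp x * exp (- x\<^sup>2 / (2 * \<sigma>\<^sup>2)) = exp (\<sigma>\<^sup>2 / 2) * exp (- (x - \<sigma>\<^sup>2)\<^sup>2 / (2 * \<sigma>\<^sup>2))"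
      unfolding exp_add[symmetric] by simp
    then show ?thesis by (simp add: normal_density_def)
  qed
  then have "(\<integral>\<^sup>+x. ennreal (exp x) * ennreal (normal_density 0 \<sigma> x) \<partial>lborel)
      = (\<integral>\<^sup>+x. ennreal (exp (\<sigma>\<^sup>2 / 2)) * ennreal (normal_density (\<sigma>\<^sup>2) \<sigma> x) \<partial>lborel)"
    by (intro nn_integral_cong) (simp flip: ennreal_mult')
  then show ?thesis using assms by (simp add: nn_integral_cmult nn_integral_normal_density)
qed

context prob_space
begin

lemma centered_gaussian_rvE:
  assumes "centered_gaussian_rv M Y"
  obtains "AE \<omega> in M. Y \<omega> = 0" "expectation (\<lambda>\<omega>. (Y \<omega>)\<^sup>2) = 0" 
  | \<sigma> where "0 < \<sigma>" "distributed M lborel Y (\<lambda>y. ennreal (normal_density 0 \<sigma> y))"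
      "expectation (\<lambda>\<omega>. (Y \<omega>)\<^sup>2) = \<sigma>\<^sup>2"
proof -
  have [measurable]: "Y \<in> borel_measurable M" using assms by (simp add: centered_gaussian_rv_def)
  consider "AE \<omega> in M. Y \<omega> = 0"
    | \<sigma> where "0 < \<sigma>" "distributed M lborel Y (\<lambda>y. ennreal (normal_density 0 \<sigma> y))"
    using assms unfolding centered_gaussian_rv_def by blast
  then show ?thesis
  proof cases
    case 1
    then have "expectation (\<lambda>\<omega>. (Y \<omega>)\<^sup>2) = expectation (\<lambda>\<omega>. 0)"
      by (intro integral_cong_AE) auto
    then show ?thesis using 1 that(1) by simp
  next
    case 2
    then show ?thesis
      using normal_distributed_variance[of \<sigma> Y 0] normal_distributed_expectation[of \<sigma> Y 0] that(2)[of \<sigma>]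
      by simp
  qed
qed

lemma centered_gaussian_square_integrable:
  assumes "centered_gaussian_rv M Y"
  shows "integrable M (\<lambda>\<omega>. (Y \<omega>)\<^sup>2)"
  using assms
proof (cases rule: centered_gaussian_rvE)
  case 1
  have "Y \<in> borel_measurable M" using assms by (simp add: centered_gaussian_rv_def)
  with 1 show ?thesis by (subst integrable_cong_AE[where g="\<lambda>_. 0"]) auto
next
  case (2 \<sigma>)
  have "integrable lborel (\<lambda>x. normal_density 0 \<sigma> x * x\<^sup>2)"
    using integrable_normal_moment[of \<sigma> 0 2] 2 by simp
  then show ?thesis
    using distributed_integrable[OF 2(2), of "\<lambda>x. x\<^sup>2"] by simp
qed

lemma gaussian_charfun:
  assumes "centered_gaussian_rv M Y"
  shows "(CLINT \<omega>|M. iexp (Y \<omega>)) = of_real (exp (- expectation (\<lambda>\<omega>. (Y \<omega>)\<^sup>2) / 2))"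
  using assms
proof (cases rule: centered_gaussian_rvE)
  case 1
  have [measurable]: "Y \<in> borel_measurable M" using assms by (simp add: centered_gaussian_rv_def)
  have "(CLINT \<omega>|M. iexp (Y \<omega>)) = (CLINT \<omega>|M. 1)"
    by (rule integral_cong_AE) (use 1 in auto)
  with 1 show ?thesis by (simp add: prob_space)
next
  case (2 \<sigma>)
  have "distributed M lborel (\<lambda>\<omega>. Y \<omega> / \<sigma>) std_normal_density"
    using 2 normal_standard_normal_convert[of \<sigma> Y 0] by simp
  then have eq: "distr M borel (\<lambda>\<omega>. Y \<omega> / \<sigma>) = std_normal_distribution"
    by (auto dest: distributed_distr_eq_density cong: distr_cong)
  have [measurable]: "Y \<in> borel_measurable M"
    using assms by (simp add: centered_gaussian_rv_def)
  have "char std_normal_distribution \<sigma> = (CLINT \<omega>|M. iexp (\<sigma> * (Y \<omega> / \<sigma>)))"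
    unfolding char_def eq[symmetric] by (subst integral_distr) auto
  then show ?thesis using 2 by (simp add: char_std_normal_distribution)
qed

lemma gaussian_mgf:
  assumes "centered_gaussian_rv M Y"
  shows "(\<integral>\<^sup>+\<omega>. ennreal (exp (Y \<omega>)) \<partial>M) = ennreal (exp (expectation (\<lambda>\<omega>. (Y \<omega>)\<^sup>2) / 2))"
  using assms
proof (cases rule: centered_gaussian_rvE)
  case 1
  have "(\<integral>\<^sup>+\<omega>. ennreal (exp (Y \<omega>)) \<partial>M) = (\<integral>\<^sup>+\<omega>. 1 \<partial>M)"
    by (rule nn_integral_cong_AE) (use 1 in auto)
  with 1 show ?thesis by (simp add: emeasure_space_1)
next
  case (2 \<sigma>)
  then show ?thesis
    using distributed_nn_integral[OF 2(2), of "\<lambda>x. ennreal (exp x)"] nn_integral_exp_normal[of \<sigma>]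
    by (simp add: mult.commute)
qed

lemma gaussian_distr_std:
  assumes "centered_gaussian_rv M Y" "expectation (\<lambda>\<omega>. (Y \<omega>)\<^sup>2) = 1"
  shows "distr M borel Y = std_normal_distribution"
  using assms(1)
proof (cases rule: centered_gaussian_rvE)
  case 1
  then show ?thesis using assms by simp
next
  case (2 \<sigma>)
  then have "\<sigma> = 1" using assms by (simp add: power2_eq_1_iff)
  with 2 show ?thesis by (auto dest: distributed_distr_eq_density cong: distr_cong)
qed

end

section \<open>Exponential tilting of a Gaussian walk\<close>

text \<open>Cameron--Martin in one dimension: by completing the square, the weight
  \<open>exp (\<rho> * y - \<rho>^2 / 2)\<close> moves the standard normal law to mean
  \<open>\<rho>\<close>, so \<open>y - \<rho>\<close> is again standard.\<close>

lemma nn_integral_tilted_kstep: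
  fixes \<rho> T :: real
  assumes [measurable]: "f \<in> borel_measurable borel"
  shows "(\<integral>\<^sup>+y. c * ((ennreal (exp (\<rho> * y - \<rho>\<^sup>2 / 2)) * indicator {..b} (T + (y - \<rho>))) * f (T + (y - \<rho>)))
     \<partial>std_normal_distribution) = c * kstep b f T"
proof -
  have "(\<integral>\<^sup>+y. c * ((ennreal (exp (\<rho> * y - \<rho>\<^sup>2 / 2)) * indicator {..b} (T + (y - \<rho>))) * f (T + (y - \<rho>))) \<partial>std_normal_distribution)
      = c * (\<integral>\<^sup>+y. (ennreal (exp (\<rho> * y - \<rho>\<^sup>2 / 2)) * indicator {..b} (T + (y - \<rho>))) * f (T + (y - \<rho>)) \<partial>std_normal_distribution)"
    by (rule nn_integral_cmult) measurable
  also have "(\<integral>\<^sup>+y. (ennreal (exp (\<rho> * y - \<rho>\<^sup>2 / 2)) * indicator {..b} (T + (y - \<rho>))) * f (T + (y - \<rho>)) \<partial>std_normal_distribution)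
     = (\<integral>\<^sup>+y. ennreal (std_normal_density y) * ((ennreal (exp (\<rho> * y - \<rho>\<^sup>2 / 2)) * indicator {..b} (T + (y - \<rho>))) * f (T + (y - \<rho>))) \<partial>lborel)"
    by (rule nn_integral_density) measurable
  also have "\<dots> = (\<integral>\<^sup>+y. indicator {..b} (T + (- \<rho> + y)) * f (T + (- \<rho> + y)) * ennreal (std_normal_density (- \<rho> + y)) \<partial>lborel)"
  proof (intro nn_integral_cong)
    fix y
    have "exp (\<rho> * y - \<rho>\<^sup>2 / 2) * exp (- y\<^sup>2 / 2) = exp (- (- \<rho> + y)\<^sup>2 / 2)"
      by (simp add: power2_eq_square field_simps flip: exp_add)
    then have "std_normal_density y * exp (\<rho> * y - \<rho>\<^sup>2 / 2) = std_normal_density (- \<rho> + y)"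
      by (simp add: std_normal_density_def mult_ac)
    then show "ennreal (std_normal_density y) * ((ennreal (exp (\<rho> * y - \<rho>\<^sup>2 / 2)) * indicator {..b} (T + (y - \<rho>))) * f (T + (y - \<rho>)))
       = indicator {..b} (T + (- \<rho> + y)) * f (T + (- \<rho> + y)) * ennreal (std_normal_density (- \<rho> + y))"
      by (simp add: ennreal_mult'[symmetric] mult.assoc[symmetric]) (simp add: mult_ac)
  qed
  also have "\<dots> = kstep b f T"
    unfolding kstep_def gstep_def
    using nn_integral_shift[of "\<lambda>y. indicator {..b} (T + y) * f (T + y) * ennreal (std_normal_density y)" "- \<rho>"]
    by simp
  finally show ?thesis .
qed

text \<open>Peeling off the last coordinate integrates out one shifted step of the killed walk.\<close>

lemma nn_integral_PiM_tilted_walk: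
  fixes r :: "nat \<Rightarrow> real"
  assumes [measurable]: "f \<in> borel_measurable borel"
  shows "(\<integral>\<^sup>+z. ennreal (exp ((\<Sum>k<n. r k * z k) - (\<Sum>k<n. (r k)\<^sup>2) / 2))
       * ((\<Prod>k<n. indicator {..b} (\<Sum>i<Suc k. z i - r i)) * f (\<Sum>i<n. z i - r i))
       \<partial>(PiM {..<n} (\<lambda>_. std_normal_distribution))) = (kstep b ^^ n) f 0"
  using assms
proof (induction n arbitrary: f)
  case 0
  show ?case by (simp add: PiM_empty nn_integral_count_space_finite)
next
  case (Suc n)
  note [measurable] = Suc.prems
  interpret P: product_sigma_finite "\<lambda>_::nat. std_normal_distribution"
    by (intro product_sigma_finite.intro prob_space_imp_sigma_finite prob_space_normal_density) simp
  let ?P = "\<lambda>n. PiM {..<n} (\<lambda>_::nat. std_normal_distribution)"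
  let ?w = "\<lambda>n z. ennreal (exp ((\<Sum>k<n. r k * z k) - (\<Sum>k<n. (r k)\<^sup>2) / 2)) * (\<Prod>k<n. indicator {..b} (\<Sum>i<Suc k. z i - r i))"
  have inner: "(\<integral>\<^sup>+y. ?w (Suc n) (z(n := y)) * f (\<Sum>i<Suc n. (z(n := y)) i - r i) \<partial>std_normal_distribution)
      = ?w n z * kstep b f (\<Sum>i<n. z i - r i)" for z :: "nat \<Rightarrow> real"
  proof -
    let ?T = "\<Sum>i<n. z i - r i"
    have upd: "(\<Sum>i<k. (z(n := y)) i - r i) = (\<Sum>i<k. z i - r i)" if "k \<le> n" for k y
      using that by (intro sum.cong) auto
    have e1: "(\<Sum>k<Suc n. r k * (z(n := y)) k) = (\<Sum>k<n. r k * z k) + r n * y" for y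
    proof -
      have "(\<Sum>k<n. r k * (z(n := y)) k) = (\<Sum>k<n. r k * z k)" by (intro sum.cong) auto
      then show ?thesis unfolding sum.lessThan_Suc by (simp only: fun_upd_same)
    qed
    have e2: "(\<Sum>i<Suc n. (z(n := y)) i - r i) = ?T + (y - r n)" for y
      unfolding sum.lessThan_Suc upd[OF order_refl] by (simp only: fun_upd_same)
    have e3: "(\<Prod>k<Suc n. indicator {..b} (\<Sum>i<Suc k. (z(n := y)) i - r i) :: ennreal)
        = (\<Prod>k<n. indicator {..b} (\<Sum>i<Suc k. z i - r i)) * indicator {..b} (?T + (y - r n))" for y
    proof -
      have "(\<Prod>k<n. indicator {..b} (\<Sum>i<Suc k. (z(n := y)) i - r i) :: ennreal) = (\<Prod>k<n. indicator {..b} (\<Sum>i<Suc k. z i - r i))"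
        by (intro prod.cong refl) (subst upd, auto)
      then show ?thesis unfolding prod.lessThan_Suc e2 by (simp only:)
    qed
    have e4: "exp (x + r n * y - (v + (r n)\<^sup>2) / 2) = exp (x - v / 2) * exp (r n * y - (r n)\<^sup>2 / 2)" for x v y
      by (simp add: field_simps flip: exp_add)
    have w: "?w (Suc n) (z(n := y)) = ?w n z * (ennreal (exp (r n * y - (r n)\<^sup>2 / 2)) * indicator {..b} (?T + (y - r n)))" for y
      unfolding e1 e3 sum.lessThan_Suc[of "\<lambda>k. (r k)\<^sup>2"] e4 ennreal_mult'[OF exp_ge_zero]
      by (simp only: mult_ac)
    have "(\<integral>\<^sup>+y. ?w (Suc n) (z(n := y)) * f (\<Sum>i<Suc n. (z(n := y)) i - r i) \<partial>std_normal_distribution)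
       = (\<integral>\<^sup>+y. ?w n z * ((ennreal (exp (r n * y - (r n)\<^sup>2 / 2)) * indicator {..b} (?T + (y - r n))) * f (?T + (y - r n))) \<partial>std_normal_distribution)"
      by (simp only: w e2 mult.assoc)
    also have "\<dots> = ?w n z * kstep b f ?T"
      by (rule nn_integral_tilted_kstep[OF Suc.prems, of "?w n z" "r n" b ?T])
    finally show ?thesis .
  qed
  have [measurable]: "(\<lambda>z. z i) \<in> measurable (?P n) borel" if "i < n" for i
    using measurable_component_singleton[of i "{..<n}" "\<lambda>_. std_normal_distribution"] that by simp
  have [measurable]: "(\<lambda>z. z i) \<in> measurable (?P (Suc n)) borel" if "i < Suc n" for i
    using measurable_component_singleton[of i "{..<Suc n}" "\<lambda>_. std_normal_distribution"] that by simp
  have "(\<integral>\<^sup>+z. ?w (Suc n) z * f (\<Sum>i<Suc n. z i - r i) \<partial>?P (Suc n))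
      = (\<integral>\<^sup>+z. (\<integral>\<^sup>+y. ?w (Suc n) (z(n := y)) * f (\<Sum>i<Suc n. (z(n := y)) i - r i) \<partial>std_normal_distribution) \<partial>?P n)"
    (is "?lhs = ?rhs")
    unfolding lessThan_Suc[of n]
  proof (rule P.product_nn_integral_insert)
    show "(\<lambda>z. ennreal (exp ((\<Sum>k\<in>insert n {..<n}. r k * z k) - (\<Sum>k\<in>insert n {..<n}. (r k)\<^sup>2) / 2)) *
         (\<Prod>k\<in>insert n {..<n}. indicator {..b} (\<Sum>i<Suc k. z i - r i)) * f (\<Sum>i\<in>insert n {..<n}. z i - r i))
       \<in> borel_measurable (PiM (insert n {..<n}) (\<lambda>_. std_normal_distribution))"
      unfolding lessThan_Suc[of n, symmetric] by measurable
  qed auto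
  also have "\<dots> = (\<integral>\<^sup>+z. ?w n z * kstep b f (\<Sum>i<n. z i - r i) \<partial>?P n)"
    by (simp only: inner)
  also have "\<dots> = (kstep b ^^ n) (kstep b f) 0"
    using Suc.IH[of "kstep b f"] by (simp add: mult.assoc)
  also have "\<dots> = (kstep b ^^ Suc n) f 0"
    by (simp add: funpow_swap1)
  finally show ?case unfolding mult.assoc .
qed

text \<open>A linear space all of whose members are centred Gaussian encodes joint Gaussianity of
  every finite family without a multivariate density, so degenerate covariances need no separate
  treatment.\<close>

definition gaussian_space :: "'w measure \<Rightarrow> ('w \<Rightarrow> real) set \<Rightarrow> bool" where
  "gaussian_space M V \<longleftrightarrow> (\<forall>Y\<in>V. centered_gaussian_rv M Y) \<and> (\<lambda>_. 0) \<in> V \<and>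
     (\<forall>Y\<in>V. \<forall>Z\<in>V. (\<lambda>\<omega>. Y \<omega> + Z \<omega>) \<in> V) \<and> (\<forall>Y\<in>V. \<forall>c. (\<lambda>\<omega>. c * Y \<omega>) \<in> V)"

lemma gaussian_space_add: "gaussian_space M V \<Longrightarrow> Y \<in> V \<Longrightarrow> Z \<in> V \<Longrightarrow> (\<lambda>\<omega>. Y \<omega> + Z \<omega>) \<in> V"
  and gaussian_space_cmult: "gaussian_space M V \<Longrightarrow> Y \<in> V \<Longrightarrow> (\<lambda>\<omega>. c * Y \<omega>) \<in> V"
  and gaussian_space_rv: "gaussian_space M V \<Longrightarrow> Y \<in> V \<Longrightarrow> centered_gaussian_rv M Y"
  and gaussian_space_zero: "gaussian_space M V \<Longrightarrow> (\<lambda>_. 0) \<in> V"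
  unfolding gaussian_space_def by blast+

lemma gaussian_space_measurable: "gaussian_space M V \<Longrightarrow> Y \<in> V \<Longrightarrow> Y \<in> borel_measurable M"
  using gaussian_space_rv by (auto simp: centered_gaussian_rv_def)

lemma gaussian_space_diff: "gaussian_space M V \<Longrightarrow> Y \<in> V \<Longrightarrow> Z \<in> V \<Longrightarrow> (\<lambda>\<omega>. Y \<omega> - Z \<omega>) \<in> V"
  using gaussian_space_add[of M V Y "\<lambda>\<omega>. - 1 * Z \<omega>"] gaussian_space_cmult[of M V Z "-1"] by simp

lemma gaussian_space_sum:
  assumes "gaussian_space M V" "finite I" "\<And>i. i \<in> I \<Longrightarrow> Y i \<in> V"
  shows "(\<lambda>\<omega>. \<Sum>i\<in>I. c i * Y i \<omega>) \<in> V"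
  using assms(2,3)
proof (induction I rule: finite_induct)
  case empty
  show ?case using gaussian_space_zero[OF assms(1)] by simp
next
  case (insert x F)
  have "(\<lambda>\<omega>. c x * Y x \<omega> + (\<Sum>i\<in>F. c i * Y i \<omega>)) \<in> V"
    using insert by (intro gaussian_space_add[OF assms(1), of "\<lambda>\<omega>. c x * Y x \<omega>"] gaussian_space_cmult[OF assms(1)]) auto
  then show ?case using insert by simp
qed

context prob_space
begin

lemma gaussian_space_integrable_mult:
  assumes "gaussian_space M V" "Y \<in> V" "Z \<in> V"
  shows "integrable M (\<lambda>\<omega>. Y \<omega> * Z \<omega>)"
proof (rule Bochner_Integration.integrable_bound)
  show "integrable M (\<lambda>\<omega>. (Y \<omega>)\<^sup>2 + (Z \<omega>)\<^sup>2)"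
    using assms by (intro Bochner_Integration.integrable_add centered_gaussian_square_integrable gaussian_space_rv[OF assms(1)])
  show "(\<lambda>\<omega>. Y \<omega> * Z \<omega>) \<in> borel_measurable M"
    using gaussian_space_measurable[OF assms(1,2)] gaussian_space_measurable[OF assms(1,3)] by measurable
  have "\<bar>y * z\<bar> \<le> y\<^sup>2 + z\<^sup>2" for y z :: real
  proof -
    have "0 \<le> (y + z)\<^sup>2" "0 \<le> (y - z)\<^sup>2" "0 \<le> y\<^sup>2" "0 \<le> z\<^sup>2" by auto
    then show ?thesis unfolding power2_sum power2_diff abs_le_iff by linarith
  qed
  then show "AE \<omega> in M. norm (Y \<omega> * Z \<omega>) \<le> norm ((Y \<omega>)\<^sup>2 + (Z \<omega>)\<^sup>2)"
    by (auto simp: abs_mult)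
qed

text \<open>Without correlations the variance of a linear combination is the sum of the individual
  variances, so its characteristic function \<open>exp (- variance / 2)\<close> is a product and
  Kac's theorem gives independence.\<close>

lemma gaussian_space_distr_PiM:
  fixes Z :: "'i \<Rightarrow> 'a \<Rightarrow> real"
  assumes V: "gaussian_space M V" and fin: "finite I" and Z: "\<And>i. i \<in> I \<Longrightarrow> Z i \<in> V"
    and orth: "\<And>i j. i \<in> I \<Longrightarrow> j \<in> I \<Longrightarrow> i \<noteq> j \<Longrightarrow> expectation (\<lambda>\<omega>. Z i \<omega> * Z j \<omega>) = 0"
  shows "distr M (PiM I (\<lambda>_. borel)) (\<lambda>\<omega>. \<lambda>i\<in>I. Z i \<omega>) = PiM I (\<lambda>i. distr M borel (Z i))"
proof (rule distr_eq_PiM_of_charfun[OF fin])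
  show "Z i \<in> borel_measurable M" if "i \<in> I" for i
    using gaussian_space_measurable[OF V Z[OF that]] .
  fix c
  have int: "integrable M (\<lambda>\<omega>. Z i \<omega> * Z j \<omega>)" if "i \<in> I" "j \<in> I" for i j
    using that by (intro gaussian_space_integrable_mult[OF V] Z)
  have "expectation (\<lambda>\<omega>. (\<Sum>i\<in>I. c i * Z i \<omega>)\<^sup>2) = expectation (\<lambda>\<omega>. \<Sum>i\<in>I. \<Sum>j\<in>I. c i * c j * (Z i \<omega> * Z j \<omega>))"
    by (simp add: power2_eq_square sum_product mult_ac)
  also have "\<dots> = (\<Sum>i\<in>I. \<Sum>j\<in>I. c i * c j * expectation (\<lambda>\<omega>. Z i \<omega> * Z j \<omega>))"
    using int by (simp add: Bochner_Integration.integral_sum)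
  also have "\<dots> = (\<Sum>i\<in>I. \<Sum>j\<in>I. if j = i then c i * c j * expectation (\<lambda>\<omega>. Z i \<omega> * Z j \<omega>) else 0)"
    by (intro sum.cong) (auto simp: orth)
  also have "\<dots> = (\<Sum>i\<in>I. (c i)\<^sup>2 * expectation (\<lambda>\<omega>. (Z i \<omega>)\<^sup>2))"
    using fin by (simp add: power2_eq_square)
  finally have var: "expectation (\<lambda>\<omega>. (\<Sum>i\<in>I. c i * Z i \<omega>)\<^sup>2) = (\<Sum>i\<in>I. (c i)\<^sup>2 * expectation (\<lambda>\<omega>. (Z i \<omega>)\<^sup>2))" .
  have "(CLINT \<omega>|M. iexp (\<Sum>i\<in>I. c i * Z i \<omega>))
      = of_real (exp (- expectation (\<lambda>\<omega>. (\<Sum>i\<in>I. c i * Z i \<omega>)\<^sup>2) / 2))"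
    by (rule gaussian_charfun[OF gaussian_space_rv[OF V gaussian_space_sum[OF V fin Z]]])
  also have "\<dots> = of_real (exp (\<Sum>i\<in>I. - ((c i)\<^sup>2 * expectation (\<lambda>\<omega>. (Z i \<omega>)\<^sup>2)) / 2))"
    unfolding var
    by (simp only: sum_negf[symmetric] sum_divide_distrib minus_divide_left)
  also have "\<dots> = (\<Prod>i\<in>I. complex_of_real (exp (- ((c i)\<^sup>2 * expectation (\<lambda>\<omega>. (Z i \<omega>)\<^sup>2)) / 2)))"
    using fin by (simp add: exp_sum)
  also have "\<dots> = (\<Prod>i\<in>I. CLINT \<omega>|M. iexp (c i * Z i \<omega>))"
  proof (intro prod.cong refl)
    fix i assume i: "i \<in> I"
    show "complex_of_real (exp (- ((c i)\<^sup>2 * expectation (\<lambda>\<omega>. (Z i \<omega>)\<^sup>2)) / 2)) = (CLINT \<omega>|M. iexp (c i * Z i \<omega>))"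
      using gaussian_charfun[OF gaussian_space_rv[OF V gaussian_space_cmult[OF V Z[OF i]]], of "c i"]
      by (simp add: power_mult_distrib)
  qed
  finally show "(CLINT \<omega>|M. iexp (\<Sum>i\<in>I. c i * Z i \<omega>)) = (\<Prod>i\<in>I. CLINT \<omega>|M. iexp (c i * Z i \<omega>))" .
qed

end

context prob_space
begin

definition ip :: "('a \<Rightarrow> real) \<Rightarrow> ('a \<Rightarrow> real) \<Rightarrow> real" where
  "ip Y Z = expectation (\<lambda>\<omega>. Y \<omega> * Z \<omega>)"

lemma ip_commute: "ip Y Z = ip Z Y"
  by (simp add: ip_def mult.commute)

lemma ip_cmult: "ip (\<lambda>\<omega>. c * Y \<omega>) Z = c * ip Y Z"
  by (simp add: ip_def mult.assoc)

lemma ip_add: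
  assumes "gaussian_space M V" "X \<in> V" "Y \<in> V" "Z \<in> V"
  shows "ip (\<lambda>\<omega>. X \<omega> + Y \<omega>) Z = ip X Z + ip Y Z"
  unfolding ip_def using assms
  by (simp add: distrib_right gaussian_space_integrable_mult)

lemma ip_diff:
  assumes "gaussian_space M V" "X \<in> V" "Y \<in> V" "Z \<in> V"
  shows "ip (\<lambda>\<omega>. X \<omega> - Y \<omega>) Z = ip X Z - ip Y Z"
  unfolding ip_def using assms
  by (simp add: left_diff_distrib gaussian_space_integrable_mult)

lemma ip_sum:
  assumes "gaussian_space M V" "\<And>i. i \<in> I \<Longrightarrow> Y i \<in> V" "Z \<in> V"
  shows "ip (\<lambda>\<omega>. \<Sum>i\<in>I. c i * Y i \<omega>) Z = (\<Sum>i\<in>I. c i * ip (Y i) Z)"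
  unfolding ip_def using assms
  by (simp add: sum_distrib_right gaussian_space_integrable_mult mult.assoc)

lemma ip_diff_right:
  assumes "gaussian_space M V" "X \<in> V" "Y \<in> V" "Z \<in> V"
  shows "ip Z (\<lambda>\<omega>. X \<omega> - Y \<omega>) = ip Z X - ip Z Y"
  using ip_diff[OF assms] by (simp add: ip_commute)

text \<open>Tilting by \<open>exp Y\<close> with \<open>Y = \<gamma> * S n + c * D\<close> turns the walk \<open>S\<close> into a standard walk plus the
  drift \<open>ip Y (S k) = \<gamma> * k + c * ip D (S k)\<close> (Cameron--Martin); the second summand is a bounded
  perturbation of the barrier.\<close>

lemma gaussian_walk_bound:
  fixes S :: "nat \<Rightarrow> 'a \<Rightarrow> real" and D :: "'a \<Rightarrow> real"
  assumes V: "gaussian_space M V" and S: "\<And>k. S k \<in> V" and D: "D \<in> V"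
    and S0: "\<And>\<omega>. S 0 \<omega> = 0"
    and cov: "\<And>j k. j \<le> n \<Longrightarrow> k \<le> n \<Longrightarrow> ip (S j) (S k) = real (min j k)"
    and c: "0 \<le> c" and rho: "\<And>k. k \<le> n \<Longrightarrow> c * \<bar>ip D (S k)\<bar> \<le> b'"
    and var: "ip D D \<le> s" and \<gamma>: "0 \<le> \<gamma>"
  shows "emeasure M {\<omega> \<in> space M. (\<forall>k\<le>n. S k \<omega> \<le> \<gamma> * k + \<beta>) \<and> \<gamma> * n - z \<le> S n \<omega> \<and> a \<le> D \<omega>}
    \<le> ennreal (exp (- \<gamma>\<^sup>2 * n / 2 + \<gamma> * z - c * a + \<gamma> * b' + c\<^sup>2 * s / 2))
      * (kstep (\<beta> + b') ^^ n) (indicator {- (z + b')..}) 0"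
proof -
  note add = gaussian_space_add[OF V] and cmult = gaussian_space_cmult[OF V] and diff = gaussian_space_diff[OF V]
  define \<xi> where "\<xi> k \<omega> = S (Suc k) \<omega> - S k \<omega>" for k \<omega>
  define \<rho> where "\<rho> k = ip D (S k)" for k
  define Y where "Y \<omega> = \<gamma> * S n \<omega> + c * D \<omega>" for \<omega>
  define r where "r k = \<gamma> + c * (\<rho> (Suc k) - \<rho> k)" for k
  \<comment> \<open>The increments \<open>\<xi> k\<close> with \<open>k < n\<close> are orthonormal
    and \<open>r k\<close> is the covariance of \<open>Y\<close> with \<open>\<xi> k\<close>, so
    \<open>U\<close> is the orthogonal projection of \<open>Y\<close> onto their span. The residual
    \<open>W\<close> is then independent of the walk.\<close>
  define U where "U \<omega> = (\<Sum>k<n. r k * \<xi> k \<omega>)" for \<omega>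
  define W where "W \<omega> = Y \<omega> - U \<omega>" for \<omega>
  have \<xi>V: "\<xi> k \<in> V" for k unfolding \<xi>_def[abs_def] by (intro diff S)
  have YV: "Y \<in> V" unfolding Y_def[abs_def] by (intro add cmult S D)
  have UV: "U \<in> V" unfolding U_def[abs_def] by (intro gaussian_space_sum[OF V] \<xi>V) simp
  have WV: "W \<in> V" unfolding W_def[abs_def] by (intro diff YV UV)
  have ip\<xi>: "ip (\<xi> i) (\<xi> j) = (if i = j then 1 else 0)" if "i < n" "j < n" for i j
  proof -
    have "ip (\<xi> i) (\<xi> j) = ip (S (Suc i)) (S (Suc j)) - ip (S i) (S (Suc j)) - (ip (S (Suc i)) (S j) - ip (S i) (S j))"
      unfolding \<xi>_def[abs_def] by (simp add: ip_diff[OF V] ip_diff_right[OF V] S diff)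
    then show ?thesis using that by (auto simp: cov min_def)
  qed
  have ipY: "ip Y (\<xi> k) = r k" if "k < n" for k
  proof -
    have "ip Y (\<xi> k) = \<gamma> * ip (S n) (\<xi> k) + c * ip D (\<xi> k)"
      unfolding Y_def[abs_def] by (subst ip_add[OF V]) (auto simp: cmult S D \<xi>V ip_cmult)
    also have "ip (S n) (\<xi> k) = 1"
      unfolding \<xi>_def[abs_def] ip_diff_right[OF V S S S] using that by (simp add: cov)
    also have "ip D (\<xi> k) = \<rho> (Suc k) - \<rho> k"
      unfolding \<xi>_def[abs_def] ip_diff_right[OF V S S D] by (simp add: \<rho>_def)
    finally show ?thesis by (simp add: r_def)
  qed
  have ipU\<xi>: "ip U (\<xi> j) = r j" if "j < n" for j
  proof -
    have "ip U (\<xi> j) = (\<Sum>k<n. r k * ip (\<xi> k) (\<xi> j))"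
      unfolding U_def[abs_def] by (intro ip_sum[OF V] \<xi>V)
    also have "\<dots> = (\<Sum>k<n. if k = j then r k else 0)"
      using that by (intro sum.cong) (auto simp: ip\<xi>)
    finally show ?thesis using that by simp
  qed
  have ipW\<xi>: "ip W (\<xi> j) = 0" if "j < n" for j
    unfolding W_def[abs_def] using that by (simp add: ip_diff[OF V YV UV \<xi>V] ipY ipU\<xi>)
  have ipUX: "ip U X = (\<Sum>k<n. r k * ip (\<xi> k) X)" if "X \<in> V" for X
    unfolding U_def[abs_def] using that by (intro ip_sum[OF V] \<xi>V)
  have ipUU: "ip U U = (\<Sum>k<n. (r k)\<^sup>2)"
    unfolding ipUX[OF UV] by (intro sum.cong) (auto simp: ip_commute[of _ U] ipU\<xi> power2_eq_square)
  have ipUW: "ip U W = 0"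
    unfolding ipUX[OF WV] by (intro sum.neutral) (auto simp: ip_commute[of _ W] ipW\<xi>)
  have ipYY: "ip Y Y = (\<Sum>k<n. (r k)\<^sup>2) + ip W W"
  proof -
    have "Y = (\<lambda>\<omega>. W \<omega> + U \<omega>)" by (auto simp: W_def)
    then have "ip Y Y = ip W Y + ip U Y" using ip_add[OF V WV UV YV] by simp
    moreover have "ip W Y = ip Y W" "ip U Y = ip Y U" by (rule ip_commute)+
    moreover have "ip Y X = ip W X + ip U X" if "X \<in> V" for X
      using ip_add[OF V WV UV that] \<open>Y = (\<lambda>\<omega>. W \<omega> + U \<omega>)\<close> by simp
    ultimately show ?thesis using UV WV ipUU ipUW ip_commute[of W U] by simp
  qed
  \<comment> \<open>The cross term \<open>2 * \<gamma> * c * \<rho> n\<close>, halved in the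
    exponent later, is the source of \<open>\<gamma> * b'\<close> in the bound.\<close>
  have ipYY_le: "ip Y Y \<le> \<gamma>\<^sup>2 * n + 2 * \<gamma> * b' + c\<^sup>2 * s"
  proof -
    have "ip Y Y = \<gamma> * ip (S n) Y + c * ip D Y"
      using ip_add[OF V cmult[OF S] cmult[OF D] YV] by (simp add: Y_def[abs_def] ip_cmult)
    also have "ip (S n) Y = \<gamma> * n + c * \<rho> n"
      using ip_add[OF V cmult[OF S] cmult[OF D] S] cov[of n n]
      by (simp add: ip_commute[of "S n" Y]) (simp add: Y_def[abs_def] ip_cmult \<rho>_def)
    also have "ip D Y = \<gamma> * \<rho> n + c * ip D D"
      using ip_add[OF V cmult[OF S] cmult[OF D] D]
      by (simp add: ip_commute[of D Y]) (simp add: Y_def[abs_def] ip_cmult \<rho>_def ip_commute[of D "S n"])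
    finally have "ip Y Y = \<gamma>\<^sup>2 * n + 2 * \<gamma> * (c * \<rho> n) + c\<^sup>2 * ip D D"
      by (simp add: power2_eq_square algebra_simps)
    moreover have "\<bar>c * \<rho> n\<bar> \<le> b'" using rho[of n] c by (simp add: \<rho>_def abs_mult)
    then have "c * \<rho> n \<le> b'" by linarith
    ultimately show ?thesis
      using \<gamma> var by (auto intro!: add_mono mult_left_mono)
  qed
  have sum\<xi>: "(\<Sum>i<k. \<xi> i \<omega>) = S k \<omega>" for k \<omega>
    by (induction k) (auto simp: \<xi>_def S0)
  have sumr: "(\<Sum>i<k. r i) = \<gamma> * k + c * \<rho> k" for k
    by (induction k) (auto simp: r_def algebra_simps \<rho>_def ip_def S0)

  \<comment> \<open>The residual takes the index \<open>n\<close>, after the increments with indices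
    below \<open>n\<close>, so that it is the coordinate peeled off first.\<close>
  define Z where "Z k = (if k < n then \<xi> k else W)" for k
  define \<nu> where "\<nu> k = (if k < n then std_normal_distribution else distr M borel W)" for k
  have [measurable_cong, simp]: "sets (\<nu> k) = sets borel" for k by (simp add: \<nu>_def)
  have Wm[measurable]: "W \<in> borel_measurable M" and Ym[measurable]: "Y \<in> borel_measurable M"
    and \<xi>m[measurable]: "\<xi> k \<in> borel_measurable M" and Sm[measurable]: "S k \<in> borel_measurable M"
    and Dm[measurable]: "D \<in> borel_measurable M" for k
    using gaussian_space_measurable[OF V] WV YV \<xi>V S D by auto
  interpret P: product_sigma_finite \<nu>
    unfolding \<nu>_def
    by (intro product_sigma_finite.intro prob_space_imp_sigma_finite)
      (auto intro!: prob_space_normal_density prob_space_distr)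
  have law: "distr M (PiM {..<Suc n} (\<lambda>_. borel)) (\<lambda>\<omega>. \<lambda>i\<in>{..<Suc n}. Z i \<omega>) = PiM {..<Suc n} \<nu>"
  proof -
    have "distr M (PiM {..<Suc n} (\<lambda>_. borel)) (\<lambda>\<omega>. \<lambda>i\<in>{..<Suc n}. Z i \<omega>) = PiM {..<Suc n} (\<lambda>i. distr M borel (Z i))"
    proof (rule gaussian_space_distr_PiM[OF V])
      show "Z i \<in> V" for i by (simp add: Z_def \<xi>V WV)
      show "expectation (\<lambda>\<omega>. Z i \<omega> * Z j \<omega>) = 0" if "i \<in> {..<Suc n}" "j \<in> {..<Suc n}" "i \<noteq> j" for i j
        unfolding ip_def[symmetric] using that ip\<xi>[of i j] ipW\<xi>[of i] ipW\<xi>[of j] by (auto simp: Z_def ip_commute[of _ W])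
    qed simp
    also have "\<dots> = PiM {..<Suc n} \<nu>"
    proof (intro PiM_cong refl)
      fix i
      show "distr M borel (Z i) = \<nu> i"
        using gaussian_distr_std[OF gaussian_space_rv[OF V \<xi>V[of i]]] ip\<xi>[of i i]
        by (auto simp: Z_def \<nu>_def ip_def power2_eq_square)
    qed
    finally show ?thesis .
  qed

  let ?b = "\<beta> + b'" and ?f = "indicator {- (z + b')..} :: real \<Rightarrow> ennreal"
  define F where "F x = (\<Prod>k<n. indicator {..?b} (\<Sum>i<Suc k. x i - r i)) * ?f (\<Sum>i<n. x i - r i)" for x :: "nat \<Rightarrow> real"
  define e where "e x = exp (\<Sum>k<n. r k * x k)" for x :: "nat \<Rightarrow> real"
  have meas_comp: "(\<lambda>x. x i) \<in> borel_measurable (PiM J N)" 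
    if "i \<in> J" "\<And>j. j \<in> J \<Longrightarrow> sets (N j) = sets borel" for i J and N :: "nat \<Rightarrow> real measure"
    using measurable_component_singleton[OF that(1), of N] that by (simp cong: measurable_cong_sets)
  have Fm: "(\<lambda>x. F x) \<in> borel_measurable (PiM J N)" and em: "(\<lambda>x. e x) \<in> borel_measurable (PiM J N)"
    if "{..<n} \<subseteq> J" "\<And>j. j \<in> J \<Longrightarrow> sets (N j) = sets borel" for J and N :: "nat \<Rightarrow> real measure"
  proof -
    have [measurable]: "(\<lambda>x. x i) \<in> borel_measurable (PiM J N)" if "i < n" for i
      using meas_comp that \<open>{..<n} \<subseteq> J\<close> \<open>\<And>j. j \<in> J \<Longrightarrow> sets (N j) = sets borel\<close> by blast
    show "(\<lambda>x. F x) \<in> borel_measurable (PiM J N)" unfolding F_def by measurable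
    show "(\<lambda>x. e x) \<in> borel_measurable (PiM J N)" unfolding e_def by measurable
  qed
  have Feq: "F (\<lambda>i\<in>{..<Suc n}. Z i \<omega>) = F (\<lambda>i. \<xi> i \<omega>)" for \<omega>
    unfolding F_def by (intro arg_cong2[of _ _ _ _ "(*)"] prod.cong arg_cong[of _ _ "indicator _"] sum.cong refl) (auto simp: Z_def)
  have eeq: "e (\<lambda>i\<in>{..<Suc n}. Z i \<omega>) = exp (U \<omega>)" for \<omega>
    unfolding e_def U_def by (intro arg_cong[of _ _ exp] sum.cong refl) (auto simp: Z_def)
  \<comment> \<open>Integrating out \<open>W\<close> yields \<open>exp (ip W W / 2)\<close>.
    Pythagoras, in the form of \<open>ipYY\<close>, combines it with the normalisation of the tilted
    walk into \<open>exp (ip Y Y / 2)\<close>.\<close>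
  have exp_int: "(\<integral>\<^sup>+\<omega>. ennreal (exp (Y \<omega>)) * F (\<lambda>i. \<xi> i \<omega>) \<partial>M)
      = ennreal (exp (ip Y Y / 2)) * (kstep ?b ^^ n) ?f 0"
  proof -
    define H where "H x = ennreal (exp (x n)) * (ennreal (e x) * F x)" for x
    have Hm: "H \<in> borel_measurable (PiM {..<Suc n} N)" if N: "\<And>j. sets (N j) = sets borel" for N :: "nat \<Rightarrow> real measure"
    proof -
      have [measurable]: "(\<lambda>x. x n) \<in> borel_measurable (PiM {..<Suc n} N)"
        by (rule meas_comp) (auto simp: N)
      have [measurable]: "(\<lambda>x. F x) \<in> borel_measurable (PiM {..<Suc n} N)"
        "(\<lambda>x. e x) \<in> borel_measurable (PiM {..<Suc n} N)"
        by (intro Fm em; auto simp: N)+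
      show ?thesis unfolding H_def[abs_def] by measurable
    qed
    have Zm: "(\<lambda>\<omega>. \<lambda>i\<in>{..<Suc n}. Z i \<omega>) \<in> measurable M (PiM {..<Suc n} (\<lambda>_. borel))"
      by (intro measurable_restrict) (auto simp: Z_def)
    have "(\<integral>\<^sup>+\<omega>. ennreal (exp (Y \<omega>)) * F (\<lambda>i. \<xi> i \<omega>) \<partial>M)
       = (\<integral>\<^sup>+\<omega>. H (\<lambda>i\<in>{..<Suc n}. Z i \<omega>) \<partial>M)"
      unfolding H_def eeq Feq
      by (intro nn_integral_cong) (simp add: Z_def W_def exp_diff mult.assoc[symmetric] flip: ennreal_mult')
    also have "\<dots> = integral\<^sup>N (PiM {..<Suc n} \<nu>) H"
      unfolding law[symmetric] by (subst nn_integral_distr[OF Zm]) (auto intro: Hm)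
    also have "\<dots> = (\<integral>\<^sup>+x. (\<integral>\<^sup>+y. H (x(n := y)) \<partial>\<nu> n) \<partial>PiM {..<n} \<nu>)"
      using Hm[of \<nu>] unfolding lessThan_Suc by (intro P.product_nn_integral_insert) auto
    also have "\<dots> = (\<integral>\<^sup>+x. ennreal (exp (ip W W / 2)) * (ennreal (e x) * F x) \<partial>PiM {..<n} \<nu>)"
    proof (intro nn_integral_cong)
      fix x :: "nat \<Rightarrow> real"
      have "F (x(n := y)) = F x" for y
        unfolding F_def by (intro arg_cong2[of _ _ _ _ "(*)"] prod.cong arg_cong[of _ _ "indicator _"] sum.cong refl) auto
      moreover have "e (x(n := y)) = e x" for y
        unfolding e_def by (intro arg_cong[of _ _ exp] sum.cong refl) auto
      moreover have "(\<integral>\<^sup>+y. ennreal (exp y) \<partial>\<nu> n) = ennreal (exp (ip W W / 2))"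
        using gaussian_mgf[OF gaussian_space_rv[OF V WV]]
        by (simp add: \<nu>_def nn_integral_distr ip_def power2_eq_square)
      ultimately show "(\<integral>\<^sup>+y. H (x(n := y)) \<partial>\<nu> n) = ennreal (exp (ip W W / 2)) * (ennreal (e x) * F x)"
        by (simp add: H_def nn_integral_multc)
    qed
    also have "\<dots> = (\<integral>\<^sup>+x. ennreal (exp (ip W W / 2)) * (ennreal (e x) * F x) \<partial>PiM {..<n} (\<lambda>_. std_normal_distribution))"
      by (intro arg_cong2[of _ _ _ _ nn_integral] PiM_cong refl) (auto simp: \<nu>_def)
    also have "\<dots> = (\<integral>\<^sup>+x. ennreal (exp (ip Y Y / 2)) * (ennreal (exp ((\<Sum>k<n. r k * x k) - (\<Sum>k<n. (r k)\<^sup>2) / 2)) * F x)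
        \<partial>PiM {..<n} (\<lambda>_. std_normal_distribution))"
    proof (intro nn_integral_cong)
      fix x :: "nat \<Rightarrow> real"
      have "exp (w / 2) * exp t = exp ((s + w) / 2) * exp (t - s / 2)" for w t s :: real
        by (simp add: exp_add[symmetric] add_divide_distrib)
      then show "ennreal (exp (ip W W / 2)) * (ennreal (e x) * F x)
          = ennreal (exp (ip Y Y / 2)) * (ennreal (exp ((\<Sum>k<n. r k * x k) - (\<Sum>k<n. (r k)\<^sup>2) / 2)) * F x)"
        unfolding ipYY e_def mult.assoc[symmetric] ennreal_mult'[OF exp_ge_zero, symmetric] by presburger
    qed
    also have "\<dots> = ennreal (exp (ip Y Y / 2)) * (\<integral>\<^sup>+x. ennreal (exp ((\<Sum>k<n. r k * x k) - (\<Sum>k<n. (r k)\<^sup>2) / 2)) * F x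
        \<partial>PiM {..<n} (\<lambda>_. std_normal_distribution))"
    proof (rule nn_integral_cmult)
      have [measurable]: "(\<lambda>x. F x) \<in> borel_measurable (PiM {..<n} (\<lambda>_. std_normal_distribution))"
        by (intro Fm) auto
      have [measurable]: "(\<lambda>x. x i) \<in> borel_measurable (PiM {..<n} (\<lambda>_. std_normal_distribution))" if "i < n" for i
        using that by (intro meas_comp) auto
      show "(\<lambda>x. ennreal (exp ((\<Sum>k<n. r k * x k) - (\<Sum>k<n. (r k)\<^sup>2) / 2)) * F x)
          \<in> borel_measurable (PiM {..<n} (\<lambda>_. std_normal_distribution))"
        by measurable
    qed
    also have "\<dots> = ennreal (exp (ip Y Y / 2)) * (kstep ?b ^^ n) ?f 0"
      unfolding F_def by (subst nn_integral_PiM_tilted_walk) auto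
    finally show ?thesis .
  qed
  let ?E = "{\<omega> \<in> space M. (\<forall>k\<le>n. S k \<omega> \<le> \<gamma> * k + \<beta>) \<and> \<gamma> * n - z \<le> S n \<omega> \<and> a \<le> D \<omega>}"
  \<comment> \<open>Exponential Chebyshev inequality: on the event \<open>Y\<close> is at least
    \<open>- ?e0\<close>, so the indicator is dominated by \<open>exp (?e0 + Y)\<close>.\<close>
  let ?e0 = "- \<gamma> * (\<gamma> * n - z) - c * a"
  have "emeasure M ?E = (\<integral>\<^sup>+\<omega>. indicator ?E \<omega> \<partial>M)" by simp
  also have "\<dots> \<le> (\<integral>\<^sup>+\<omega>. ennreal (exp ?e0) * (ennreal (exp (Y \<omega>)) * F (\<lambda>i. \<xi> i \<omega>)) \<partial>M)"
  proof (intro nn_integral_mono)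
    fix \<omega>
    show "indicator ?E \<omega> \<le> ennreal (exp ?e0) * (ennreal (exp (Y \<omega>)) * F (\<lambda>i. \<xi> i \<omega>))"
    proof (cases "\<omega> \<in> ?E")
      case True
      then have E: "\<And>k. k \<le> n \<Longrightarrow> S k \<omega> \<le> \<gamma> * k + \<beta>" "\<gamma> * n - z \<le> S n \<omega>" "a \<le> D \<omega>" by auto
      have "\<gamma> * (\<gamma> * n - z) + c * a \<le> Y \<omega>"
        unfolding Y_def using E \<gamma> c by (intro add_mono mult_left_mono) auto
      then have 1: "1 \<le> exp (?e0 + Y \<omega>)" by simp
      have sd: "(\<Sum>i<k. \<xi> i \<omega> - r i) = S k \<omega> - \<gamma> * k - c * \<rho> k" for k
        by (simp add: sum_subtractf sum\<xi> sumr)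
      have rb: "\<bar>c * \<rho> k\<bar> \<le> b'" if "k \<le> n" for k
        using rho[OF that] c by (simp add: abs_mult \<rho>_def)
      \<comment> \<open>Beyond the drift \<open>\<gamma> * k\<close> the tilt shifts the walk by
        \<open>c * \<rho> k\<close>, at most \<open>b'\<close> in absolute value; both the barrier
        and the lower bound at the endpoint are relaxed by \<open>b'\<close>.\<close>
      have "F (\<lambda>i. \<xi> i \<omega>) = 1"
      proof -
        have "(\<Sum>i<Suc k. \<xi> i \<omega> - r i) \<le> ?b" if "k < n" for k
          unfolding sd using E(1)[OF Suc_leI[OF that]] rb[OF Suc_leI[OF that]] by linarith
        moreover have "- (z + b') \<le> (\<Sum>i<n. \<xi> i \<omega> - r i)"
          unfolding sd using E(2) rb[of n] by auto
        ultimately show ?thesis unfolding F_def by (simp del: sum.lessThan_Suc)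
      qed
      then show ?thesis using True 1 by (simp add: exp_add flip: ennreal_mult')
    qed simp
  qed
  also have "\<dots> = ennreal (exp ?e0) * (\<integral>\<^sup>+\<omega>. ennreal (exp (Y \<omega>)) * F (\<lambda>i. \<xi> i \<omega>) \<partial>M)"
  proof (rule nn_integral_cmult)
    have [measurable]: "(\<lambda>\<omega>. F (\<lambda>i. \<xi> i \<omega>)) \<in> borel_measurable M"
      unfolding F_def by measurable
    show "(\<lambda>\<omega>. ennreal (exp (Y \<omega>)) * F (\<lambda>i. \<xi> i \<omega>)) \<in> borel_measurable M" by measurable
  qed
  also have "\<dots> = ennreal (exp (?e0 + ip Y Y / 2)) * (kstep ?b ^^ n) ?f 0"
    unfolding exp_int by (simp add: mult.assoc[symmetric] exp_add flip: ennreal_mult')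
  also have "\<dots> \<le> ennreal (exp (- \<gamma>\<^sup>2 * n / 2 + \<gamma> * z - c * a + \<gamma> * b' + c\<^sup>2 * s / 2)) * (kstep ?b ^^ n) ?f 0"
    using ipYY_le by (intro mult_right_mono ennreal_leI) (auto simp: power2_eq_square algebra_simps)
  finally show ?thesis .
qed

end

section \<open>Nested grids\<close>

text \<open>With base 16 the standard deviations of the chaining increments decay like \<open>1 / 4 ^ j\<close>, against
  thresholds proportional to \<open>1 / 2 ^ j\<close>.\<close>

definition grid_size :: "nat \<Rightarrow> nat \<Rightarrow> real" where
  "grid_size n j = exp (- real n) / 16 ^ j"

definition grid_point :: "nat \<Rightarrow> nat \<Rightarrow> ('a::euclidean_space \<Rightarrow> int) \<Rightarrow> 'a" where
  "grid_point n j z = (\<Sum>b\<in>Basis. (grid_size n j * real_of_int (z b)) *\<^sub>R b)"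

definition grid_time :: "nat \<Rightarrow> nat \<Rightarrow> nat \<Rightarrow> real" where
  "grid_time n j i = real n + real i / 16 ^ j"

definition grid_radius :: "real \<Rightarrow> nat \<Rightarrow> nat \<Rightarrow> nat" where
  "grid_radius R n j = nat \<lceil>R * exp (real n) * 16 ^ j\<rceil> + 1"

definition grid_index :: "real \<Rightarrow> nat \<Rightarrow> nat \<Rightarrow> (nat \<times> ('a::euclidean_space \<Rightarrow> int)) set" where
  "grid_index R n j = {..<16 ^ j} \<times> PiE Basis (\<lambda>_. {- int (grid_radius R n j)..int (grid_radius R n j)})"

lemma grid_size_pos: "0 < grid_size n j"
  by (simp add: grid_size_def)

lemma finite_grid_index: "finite (grid_index R n j)"
  unfolding grid_index_def by (intro finite_cartesian_product finite_PiE) auto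

text \<open>Each of the \<open>DIM('a)\<close> space directions and the time direction is refined by
  16 per level. The factor \<open>exp (DIM('a) * n)\<close> is what the tilt has to cancel, through
  \<open>speed^2 / 2 = DIM('a)\<close>.\<close>

lemma card_grid_index:
  assumes "0 \<le> R"
  shows "real (card (grid_index R n j :: (nat \<times> ('a::euclidean_space \<Rightarrow> int)) set))
    \<le> (2 * R + 5) ^ DIM('a) * exp (DIM('a) * n) * 16 ^ (j * (DIM('a) + 1))"
proof -
  let ?N = "grid_radius R n j" and ?e = "exp (real n) * 16 ^ j"
  have e1: "1 \<le> ?e" by (intro mult_ge1_I) auto
  have "real ?N \<le> R * ?e + 2"
    unfolding grid_radius_def using assms by (simp add: mult.assoc) linarith
  then have "2 * real ?N + 1 \<le> 2 * R * ?e + 5" by simp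
  also have "\<dots> \<le> 2 * R * ?e + 5 * ?e" using e1 by simp
  also have "\<dots> = (2 * R + 5) * ?e" by (simp add: distrib_right)
  finally have N: "2 * real ?N + 1 \<le> (2 * R + 5) * ?e" .
  have "card (grid_index R n j :: (nat \<times> ('a \<Rightarrow> int)) set) = 16 ^ j * (2 * ?N + 1) ^ DIM('a)"
    unfolding grid_index_def by (simp add: card_cartesian_product card_PiE nat_add_distrib nat_mult_distrib)
  then have "real (card (grid_index R n j :: (nat \<times> ('a \<Rightarrow> int)) set)) = 16 ^ j * (2 * real ?N + 1) ^ DIM('a)"
    by (simp add: add.commute)
  also have "\<dots> \<le> 16 ^ j * ((2 * R + 5) * ?e) ^ DIM('a)"
    using N by (intro mult_left_mono power_mono) auto
  also have "\<dots> = (2 * R + 5) ^ DIM('a) * exp (DIM('a) * n) * 16 ^ (j * (DIM('a) + 1))"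
  proof -
    have "exp (real (DIM('a) * n)) = exp (real n) ^ DIM('a)"
      unfolding of_nat_mult by (rule exp_of_nat_mult)
    moreover have "(16::real) ^ (j * (DIM('a) + 1)) = 16 ^ j * (16 ^ j) ^ DIM('a)"
      by (simp add: power_add power_mult)
    ultimately show ?thesis by (simp only: power_mult_distrib mult_ac)
  qed
  finally show ?thesis .
qed

lemma norm_le_sum_Basis: "norm (\<Sum>b\<in>Basis. c b *\<^sub>R (b::'a::euclidean_space)) \<le> (\<Sum>b\<in>Basis. \<bar>c b\<bar>)"
  by (rule sum_norm_le) simp

text \<open>The ancestor of a grid point is obtained by dividing its index by a power of 16.\<close>

lemma dist_grid_point_parent:
  "dist (grid_point n (Suc j) z) (grid_point n j (\<lambda>b. z b div 16) :: 'a::euclidean_space) \<le> DIM('a) * grid_size n j"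
proof -
  have c: "\<bar>grid_size n (Suc j) * real_of_int (z b) - grid_size n j * real_of_int (z b div 16)\<bar> \<le> grid_size n j" for b :: 'a
  proof -
    have "real_of_int (z b) = 16 * real_of_int (z b div 16) + real_of_int (z b mod 16)"
      by (metis div_mult_mod_eq mult.commute of_int_add of_int_mult of_int_numeral)
    then have "grid_size n (Suc j) * real_of_int (z b) - grid_size n j * real_of_int (z b div 16)
       = grid_size n j * (real_of_int (z b mod 16) / 16)"
      by (simp add: grid_size_def field_simps)
    then have eq: "\<bar>grid_size n (Suc j) * real_of_int (z b) - grid_size n j * real_of_int (z b div 16)\<bar>
        = grid_size n j * \<bar>real_of_int (z b mod 16) / 16\<bar>"
      using grid_size_pos[of n j] by (simp only: abs_mult abs_of_pos)
    have "\<bar>real_of_int (z b mod 16) / 16\<bar> \<le> 1"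
      using pos_mod_bound[of 16 "z b"] pos_mod_sign[of 16 "z b"] by linarith
    then show ?thesis
      unfolding eq using grid_size_pos[of n j] by (intro mult_left_le) auto
  qed
  have "dist (grid_point n (Suc j) z) (grid_point n j (\<lambda>b. z b div 16) :: 'a)
      = norm (\<Sum>b\<in>Basis. (grid_size n (Suc j) * real_of_int (z b) - grid_size n j * real_of_int (z b div 16)) *\<^sub>R (b::'a))"
    by (simp add: dist_norm grid_point_def sum_subtractf scaleR_left_diff_distrib)
  also have "\<dots> \<le> (\<Sum>b\<in>(Basis::'a set). grid_size n j)"
    by (rule order_trans[OF norm_le_sum_Basis sum_mono]) (rule c)
  finally show ?thesis by simp
qed

text \<open>The reason for rounding down: the rounded point at one level is then exactly the parent
  of the rounded point at the next, so the chaining increments along a fixed \<open>x\<close> and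
  \<open>t\<close> telescope.\<close>

lemma floor_div_16: "\<lfloor>x * 16\<rfloor> div 16 = \<lfloor>x :: real\<rfloor>"
  using floor_divide_real_eq_div[of 16 "x * 16"] by simp

definition floor_index :: "nat \<Rightarrow> nat \<Rightarrow> 'a::euclidean_space \<Rightarrow> 'a \<Rightarrow> int" where
  "floor_index n j x = (\<lambda>b\<in>Basis. \<lfloor>(x \<bullet> b) / grid_size n j\<rfloor>)"

definition floor_time :: "nat \<Rightarrow> nat \<Rightarrow> real \<Rightarrow> nat" where
  "floor_time n j t = nat \<lfloor>(t - real n) * 16 ^ j\<rfloor>"

lemma floor_index_parent:
  "b \<in> Basis \<Longrightarrow> floor_index n (Suc j) x b div 16 = floor_index n j x b"
  using floor_div_16[of "(x \<bullet> b) / grid_size n j"] by (simp add: floor_index_def grid_size_def mult_ac)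

lemma floor_index_root:
  "b \<in> Basis \<Longrightarrow> floor_index n j x b div 16 ^ j = floor_index n 0 x b"
proof (induction j)
  case (Suc j)
  have "floor_index n (Suc j) x b div 16 ^ Suc j = (floor_index n (Suc j) x b div 16) div 16 ^ j"
    by (simp add: zdiv_zmult2_eq)
  then show ?case using Suc by (simp add: floor_index_parent)
qed simp

lemma floor_time_parent: "real n \<le> t \<Longrightarrow> floor_time n (Suc j) t div 16 = floor_time n j t"
proof -
  assume "real n \<le> t"
  have "\<lfloor>(t - real n) * 16 ^ Suc j\<rfloor> div 16 = \<lfloor>(t - real n) * 16 ^ j\<rfloor>"
    using floor_div_16[of "(t - real n) * 16 ^ j"] by (simp add: mult_ac)
  then show ?thesis
    using \<open>real n \<le> t\<close> unfolding floor_time_def by (metis nat_div_distrib' nat_numeral zero_le_numeral)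
qed

lemma dist_floor_point: "dist x (grid_point n j (floor_index n j x) :: 'a::euclidean_space) \<le> DIM('a) * grid_size n j"
proof -
  have c: "\<bar>x \<bullet> b - grid_size n j * real_of_int (floor_index n j x b)\<bar> \<le> grid_size n j" if "b \<in> Basis" for b
  proof -
    let ?y = "(x \<bullet> b) / grid_size n j"
    have "x \<bullet> b - grid_size n j * real_of_int (floor_index n j x b) = grid_size n j * (?y - \<lfloor>?y\<rfloor>)"
      using grid_size_pos[of n j] that by (simp add: floor_index_def right_diff_distrib)
    moreover have "\<bar>?y - \<lfloor>?y\<rfloor>\<bar> \<le> 1" by linarith
    ultimately show ?thesis using grid_size_pos[of n j] by (simp add: abs_mult mult_left_le)
  qed
  have "dist x (grid_point n j (floor_index n j x)) = norm (\<Sum>b\<in>Basis. (x \<bullet> b - grid_size n j * real_of_int (floor_index n j x b)) *\<^sub>R b)"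
    by (simp add: dist_norm grid_point_def sum_subtractf scaleR_left_diff_distrib euclidean_representation)
  also have "\<dots> \<le> (\<Sum>b\<in>(Basis::'a set). grid_size n j)"
    by (rule order_trans[OF norm_le_sum_Basis sum_mono]) (rule c)
  finally show ?thesis by simp
qed

lemma floor_in_grid_index:
  fixes t :: real
  assumes "n \<le> t" "t < n + 1" "norm x \<le> R"
  shows "(floor_time n j t, floor_index n j x) \<in> grid_index R n j"
proof -
  have "(t - real n) * 16 ^ j < 1 * 16 ^ j" using assms by (intro mult_strict_right_mono) auto
  then have "\<lfloor>(t - real n) * 16 ^ j\<rfloor> < 16 ^ j"
    by (simp add: floor_less_iff)
  then have t: "floor_time n j t < 16 ^ j"
    unfolding floor_time_def by (simp add: nat_less_iff)
  have "floor_index n j x b \<in> {- int (grid_radius R n j)..int (grid_radius R n j)}" if b: "b \<in> Basis" for b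
  proof -
    let ?y = "(x \<bullet> b) * (exp (real n) * 16 ^ j)"
    have R0: "0 \<le> R" using assms(3) norm_ge_zero order_trans by blast
    have y: "(x \<bullet> b) / grid_size n j = ?y" by (simp add: grid_size_def exp_minus field_simps)
    have "\<bar>?y\<bar> \<le> R * (exp (real n) * 16 ^ j)"
      unfolding abs_mult using Basis_le_norm[OF b, of x] assms(3) by (intro mult_mono) auto
    also have "\<dots> \<le> of_int \<lceil>R * exp (real n) * 16 ^ j\<rceil>" by (simp add: mult.assoc)
    also have "\<dots> = real (nat \<lceil>R * exp (real n) * 16 ^ j\<rceil>)" using R0 by simp
    finally have "\<bar>?y\<bar> \<le> real (grid_radius R n j) - 1" by (simp add: grid_radius_def)
    moreover have "floor_index n j x b = \<lfloor>?y\<rfloor>"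
      using b y by (simp add: floor_index_def)
    ultimately show ?thesis by (auto simp: le_floor_iff floor_le_iff abs_le_iff)
  qed
  then show ?thesis using t by (auto simp: grid_index_def floor_index_def)
qed

lemma floor_time_bounds:
  fixes t :: real
  assumes "n \<le> t"
  shows "grid_time n j (floor_time n j t) \<le> t" "t \<le> grid_time n j (floor_time n j t) + 1 / 16 ^ j"
proof -
  have r: "real (floor_time n j t) = of_int \<lfloor>(t - n) * 16 ^ j\<rfloor>"
    using assms by (simp add: floor_time_def)
  have "real (floor_time n j t) \<le> (t - n) * 16 ^ j" "(t - n) * 16 ^ j \<le> real (floor_time n j t) + 1"
    unfolding r by linarith+
  then show "grid_time n j (floor_time n j t) \<le> t" "t \<le> grid_time n j (floor_time n j t) + 1 / 16 ^ j"
    by (simp_all add: grid_time_def field_simps)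
qed

lemma grid_converges:
  fixes t :: real
  assumes "n \<le> t"
  shows "(\<lambda>j. (grid_time n j (floor_time n j t), grid_point n j (floor_index n j x)))
      \<longlonglongrightarrow> (t, x :: 'a::euclidean_space)"
proof (rule tendsto_Pair)
  have z: "(\<lambda>j. c / 16 ^ j) \<longlonglongrightarrow> 0" for c :: real
    by (rule LIMSEQ_divide_realpow_zero) simp
  show "(\<lambda>j. grid_time n j (floor_time n j t)) \<longlonglongrightarrow> t"
  proof (rule tendsto_sandwich)
    show "(\<lambda>j. t - 1 / 16 ^ j) \<longlonglongrightarrow> t" using tendsto_diff[OF tendsto_const[of t] z[of 1]] by simp
  qed (use floor_time_bounds[OF assms] in \<open>auto simp: algebra_simps\<close>)
  show "(\<lambda>j. grid_point n j (floor_index n j x)) \<longlonglongrightarrow> x"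
  proof (rule metric_tendsto_imp_tendsto)
    show "(\<lambda>j. DIM('a) * exp (- real n) / 16 ^ j) \<longlonglongrightarrow> 0" by (rule z)
    have "dist (grid_point n j (floor_index n j x)) x \<le> dist (DIM('a) * exp (- real n) / 16 ^ j) 0" for j
      using dist_floor_point[of x n j] by (simp add: grid_size_def dist_commute)
    then show "\<forall>\<^sub>F j in sequentially. dist (grid_point n j (floor_index n j x)) x \<le> dist (DIM('a) * exp (- real n) / 16 ^ j) 0"
      by simp
  qed
qed

section \<open>Chaining\<close>

lemma linear_minus_square_le:
  fixes A k u :: real
  assumes "0 < k"
  shows "A * u - k * u\<^sup>2 / 2 \<le> A\<^sup>2 / (2 * k)"
proof -
  have "0 \<le> (A - k * u)\<^sup>2 / (2 * k)" using assms by simp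
  also have "\<dots> = A\<^sup>2 / (2 * k) - (A * u - k * u\<^sup>2 / 2)"
    using assms by (simp add: power2_eq_square field_simps)
  finally show ?thesis by simp
qed

lemma chaining_sum_bound:
  fixes g k :: real and m :: nat
  assumes "0 < k" "0 \<le> g"
  obtains C where "0 < C"
    "\<And>v j :: nat. 16 ^ (Suc j * m) * (1 + real (Suc v)) ^ 3 * exp (g * Suc v - k * (real (Suc v))\<^sup>2 * 4 ^ j) \<le> C * (1 / 2) ^ v * (1 / 2) ^ j"
proof -
  \<comment> \<open>\<open>A\<close> collects the exponential rates in \<open>j\<close>:
    \<open>m * ln 16\<close> from counting grid points and \<open>ln 2\<close> from the required
    decay. The rate \<open>g + 4\<close> in \<open>Suc v\<close> is \<open>g\<close>, plus 3 for the
    cube and 1 for the decay in \<open>v\<close>.\<close>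
  define A where "A = m * ln 16 + ln 2"
  define C where "C = exp (m * ln 16 + A\<^sup>2 / (2 * k)) * exp ((g + 4)\<^sup>2 / (2 * k))"
  have "16 ^ (Suc j * m) * (1 + real (Suc v)) ^ 3 * exp (g * Suc v - k * (real (Suc v))\<^sup>2 * 4 ^ j) \<le> C * (1 / 2) ^ v * (1 / 2) ^ j" for v j :: nat
  proof -
    define x where "x = real (Suc v)"
    have x1: "1 \<le> x" by (simp add: x_def)
    have four: "(4::real) ^ j = (2 ^ j)\<^sup>2" by (simp add: power2_eq_square flip: power_mult_distrib)
    have j2: "(real j)\<^sup>2 \<le> 4 ^ j"
      unfolding four using of_nat_less_two_power[of j, where 'a=real] by (intro power_mono) auto
    \<comment> \<open>Separation of variables: this product bounds \<open>x^2 * 4 ^ j\<close> below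
      by \<open>x^2 + 4 ^ j - 1\<close>, and half of \<open>x^2 + 4 ^ j\<close> absorbs the 1. The
      exponent becomes a sum of two negative quadratics, each of which beats its linear
      term.\<close>
    have "0 \<le> (x\<^sup>2 - 1) * (4 ^ j - 1)" using x1 by (intro mult_nonneg_nonneg) auto
    then have "x\<^sup>2 + 4 ^ j - 1 \<le> x\<^sup>2 * 4 ^ j" by (simp add: algebra_simps)
    moreover have "(2::real) \<le> x\<^sup>2 + 4 ^ j"
      using one_le_power[OF x1, of 2] one_le_power[of "4::real" j] by linarith
    moreover have "(x\<^sup>2 + (real j)\<^sup>2) / 2 \<le> (x\<^sup>2 + 4 ^ j) / 2" using j2 by simp
    ultimately have "(x\<^sup>2 + (real j)\<^sup>2) / 2 \<le> x\<^sup>2 * 4 ^ j" by argo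
    then have e: "k * ((x\<^sup>2 + (real j)\<^sup>2) / 2) \<le> k * (x\<^sup>2 * 4 ^ j)" using assms by (intro mult_left_mono) auto
    have p16: "16 ^ (Suc j * m) = exp (real j * (m * ln 16) + m * ln 16)"
    proof -
      have "16 ^ (Suc j * m) = exp (real (Suc j * m) * ln 16)" by (simp only: exp_of_nat_mult) simp
      then show ?thesis by (simp add: algebra_simps)
    qed
    have p2: "(2::real) ^ j = exp (j * ln 2)" by (simp add: exp_of_nat_mult)
    have px: "(1 + x) ^ 3 \<le> exp (3 * x)"
      using power_mono[OF exp_ge_add_one_self[of x], of 3] x1 by (simp add: exp_of_nat_mult[of 3 x, simplified])
    have pv: "(2::real) ^ v \<le> exp x"
    proof -
      have "(2::real) ^ v \<le> exp 1 ^ v" using exp_ge_add_one_self[of 1] by (intro power_mono) auto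
      also have "\<dots> \<le> exp x" by (simp add: x_def flip: exp_of_nat_mult)
      finally show ?thesis .
    qed
    have "16 ^ (Suc j * m) * (1 + x) ^ 3 * exp (g * x - k * x\<^sup>2 * 4 ^ j) * (2 ^ v * 2 ^ j)
       \<le> exp (real j * (m * ln 16) + m * ln 16) * exp (3 * x) * exp (g * x - k * ((x\<^sup>2 + (real j)\<^sup>2) / 2)) * (exp x * exp (j * ln 2))"
      unfolding p16 p2 using x1 px pv e
      by (intro mult_mono mult_nonneg_nonneg order_refl) (auto simp: mult.assoc)
    also have "\<dots> = exp (m * ln 16 + (A * j - k * (real j)\<^sup>2 / 2) + ((g + 4) * x - k * x\<^sup>2 / 2))"
      unfolding exp_add[symmetric] A_def by (intro arg_cong[of _ _ exp]) (simp add: field_simps)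
    also have "\<dots> \<le> exp (m * ln 16 + A\<^sup>2 / (2 * k) + (g + 4)\<^sup>2 / (2 * k))"
      using assms(1) by (subst exp_le_cancel_iff) (intro add_mono order_refl linear_minus_square_le)
    also have "\<dots> = C" by (simp add: C_def exp_add)
    finally show ?thesis by (simp add: x_def power_divide field_simps)
  qed
  moreover have "0 < C" by (simp add: C_def)
  ultimately show ?thesis using that by blast
qed

text \<open>The part of the hypotheses on which the extreme value argument rests, with
  \<open>B\<close> for the field minus its value at time 0. Covariances depend on the smaller time,
  so at a fixed point the increments over disjoint time intervals are uncorrelated;
  \<open>Q_lip\<close> says that the kernel at time \<open>t\<close> varies on the spatial scale
  \<open>exp (- t)\<close>.\<close>

locale star_field = prob_space M for M :: "'w measure" +
  fixes V :: "('w \<Rightarrow> real) set" and B :: "real \<Rightarrow> 'a::euclidean_space \<Rightarrow> 'w \<Rightarrow> real"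
    and Q :: "real \<Rightarrow> 'a \<Rightarrow> 'a \<Rightarrow> real" and \<Lambda> speed :: real
  assumes speed: "speed = sqrt (2 * DIM('a))" and gaussian: "gaussian_space M V"
    and B_in: "\<And>t x. 0 \<le> t \<Longrightarrow> B t x \<in> V"
    and B_zero: "\<And>x \<omega>. B 0 x \<omega> = 0"
    and B_cov: "\<And>s t x y. 0 \<le> s \<Longrightarrow> 0 \<le> t \<Longrightarrow> ip (B s x) (B t y) = Q (min s t) x y"
    and Q_diag: "\<And>t x. 0 \<le> t \<Longrightarrow> Q t x x = t"
    and Q_lip: "\<And>t x x' y. 0 \<le> t \<Longrightarrow> \<bar>Q t x y - Q t x' y\<bar> \<le> \<Lambda> * exp t * dist x x'"
    and \<Lambda>_nonneg: "0 \<le> \<Lambda>"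
    and B_cont: "\<And>\<omega>. \<omega> \<in> space M \<Longrightarrow> continuous_on ({0..} \<times> UNIV) (\<lambda>(t, x). B t x \<omega>)"
begin

lemma speed_nonneg: "0 \<le> speed" and speed_square: "speed\<^sup>2 = 2 * DIM('a)"
  by (simp_all add: speed)

text \<open>\<open>z\<close> is the depth of the endpoint below the line of slope
  \<open>speed\<close>, and \<open>D\<close> a chaining increment that must reach \<open>a\<close>.
  Taking zero for both \<open>D\<close> and \<open>a\<close> leaves an event of the walk
  alone.\<close>

definition pair_event :: "nat \<Rightarrow> real \<Rightarrow> real \<Rightarrow> 'a \<Rightarrow> ('w \<Rightarrow> real) \<Rightarrow> real \<Rightarrow> 'w set" where
  "pair_event n \<beta> z x D a =
     {\<omega> \<in> space M. (\<forall>k\<le>n. B (real k) x \<omega> \<le> speed * k + \<beta>) \<and> speed * n - z \<le> B (real n) x \<omega> \<and> a \<le> D \<omega>}"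

definition grid_incr :: "nat \<Rightarrow> nat \<Rightarrow> nat \<times> ('a \<Rightarrow> int) \<Rightarrow> 'w \<Rightarrow> real" where
  "grid_incr n j p \<omega> = B (grid_time n (Suc j) (fst p)) (grid_point n (Suc j) (snd p)) \<omega>
     - B (grid_time n j (fst p div 16)) (grid_point n j (\<lambda>b. snd p b div 16)) \<omega>"

definition grid_root :: "nat \<Rightarrow> nat \<Rightarrow> ('a \<Rightarrow> int) \<Rightarrow> 'a" where
  "grid_root n j z = grid_point n 0 (\<lambda>b. z b div 16 ^ j)"

text \<open>Either the root of the chain is already within \<open>L + 1\<close> of the line, or it
  misses the level \<open>speed * n - L\<close> by about \<open>Suc v\<close> and some increment of
  level \<open>j\<close> reaches \<open>Suc v / 2 ^ (j + 2)\<close>. These thresholds add up to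
  \<open>Suc v / 2\<close>, which is too little to make up the deficit.\<close>

definition cover :: "nat \<Rightarrow> real \<Rightarrow> real \<Rightarrow> real \<Rightarrow> 'w set" where
  "cover n \<beta> L R =
     (\<Union>p\<in>grid_index R n 0. pair_event n \<beta> (L + 1) (grid_root n 0 (snd p)) (\<lambda>_. 0) 0) \<union>
     (\<Union>v. \<Union>j. \<Union>p\<in>grid_index R n (Suc j). pair_event n \<beta> (L + real (Suc v) + 1) (grid_root n (Suc j) (snd p))
        (grid_incr n j p) (real (Suc v) / 2 ^ (j + 2)))"

lemma B_measurable: "0 \<le> t \<Longrightarrow> B t x \<in> borel_measurable M"
  using gaussian_space_measurable[OF gaussian B_in] .

lemma grid_time_nonneg: "0 \<le> grid_time n j i"
  by (simp add: grid_time_def)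

lemma grid_incr_in: "grid_incr n j p \<in> V"
  unfolding grid_incr_def[abs_def]
  by (intro gaussian_space_diff[OF gaussian] B_in grid_time_nonneg)

lemma pair_event_sets:
  assumes "D \<in> V"
  shows "pair_event n \<beta> z x D a \<in> sets M"
proof -
  have [measurable]: "D \<in> borel_measurable M" "\<And>k. B (real k) x \<in> borel_measurable M"
    using gaussian_space_measurable[OF gaussian assms] B_measurable by auto
  show ?thesis unfolding pair_event_def by measurable
qed

lemma cover_sets: "cover n \<beta> L R \<in> sets M"
  unfolding cover_def
  by (intro sets.Un sets.finite_UN sets.countable_UN'' finite_grid_index pair_event_sets
      grid_incr_in gaussian_space_zero[OF gaussian]) auto

text \<open>A pathwise statement: by continuity \<open>B t x\<close> is the limit of the values
  along the grid points below \<open>t\<close> and \<open>x\<close>. The barrier is assumed on the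
  radius \<open>R + DIM('a)\<close> since rounding to mesh at most one moves a point by at most
  \<open>DIM('a)\<close>.\<close>

lemma cover_bad:
  fixes t \<beta> L R :: real
  assumes \<omega>: "\<omega> \<in> space M"
    and barrier: "\<And>k y. k \<le> n \<Longrightarrow> norm y \<le> R + DIM('a) \<Longrightarrow> B (real k) y \<omega> \<le> speed * k + \<beta>"
    and t: "n \<le> t" "t < real n + 1" and x: "norm x \<le> R"
    and bad: "speed * n - L \<le> B t x \<omega>"
  shows "\<omega> \<in> cover n \<beta> L R"
proof -
  define i where "i j = floor_time n j t" for j
  define z where "z j = floor_index n j x" for j
  define A where "A j = B (grid_time n j (i j)) (grid_point n j (z j)) \<omega>" for j
  define g where "g = grid_point n 0 (z 0)"
  have idx: "(i j, z j) \<in> grid_index R n j" for j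
    unfolding i_def z_def by (rule floor_in_grid_index) (use t x in auto)
  have i0: "i 0 = 0" using idx[of 0] by (simp add: grid_index_def)
  have root: "grid_root n j (z j) = g" for j
    unfolding grid_root_def g_def grid_point_def z_def by (intro sum.cong refl) (simp add: floor_index_root)
  have incr: "grid_incr n j (i (Suc j), z (Suc j)) \<omega> = A (Suc j) - A j" for j
  proof -
    have "grid_point n j (\<lambda>b. z (Suc j) b div 16) = (grid_point n j (z j) :: 'a)"
      unfolding grid_point_def z_def by (intro sum.cong refl) (simp add: floor_index_parent)
    then show ?thesis
      by (simp only: grid_incr_def A_def i_def fst_conv snd_conv floor_time_parent[OF t(1)])
  qed
  have A0: "A 0 = B (real n) g \<omega>" by (simp add: A_def i0 g_def grid_time_def)
  have "dist x g \<le> DIM('a) * grid_size n 0" unfolding g_def z_def by (rule dist_floor_point)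
  also have "\<dots> \<le> DIM('a)" by (simp add: grid_size_def mult_left_le)
  finally have "norm g \<le> R + DIM('a)"
    using x norm_triangle_ineq4[of x "x - g"] by (simp add: dist_norm)
  then have bar: "\<forall>k\<le>n. B (real k) g \<omega> \<le> speed * k + \<beta>" using barrier by blast
  have lim: "A \<longlonglongrightarrow> B t x \<omega>"
  proof -
    have "(\<lambda>j. (\<lambda>(t, x). B t x \<omega>) (grid_time n j (i j), grid_point n j (z j))) \<longlonglongrightarrow> (\<lambda>(t, x). B t x \<omega>) (t, x)"
      by (rule continuous_on_tendsto_compose[OF B_cont[OF \<omega>]])
        (use t grid_converges[of n t x] in \<open>auto simp: i_def z_def grid_time_nonneg\<close>)
    then show ?thesis by (simp add: A_def[abs_def])
  qed
  show ?thesis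
  proof (cases "speed * n - (L + 1) \<le> A 0")
    case True
    then have "\<omega> \<in> pair_event n \<beta> (L + 1) (grid_root n 0 (snd (i 0, z 0))) (\<lambda>_. 0) 0"
      using \<omega> bar by (simp add: pair_event_def root A0)
    then show ?thesis using idx[of 0] unfolding cover_def by blast
  next
    case False
    \<comment> \<open>The deficit exceeds one here, so its integer part is at least one and equals
      \<open>Suc v\<close>.\<close>
    define v where "v = nat \<lfloor>speed * n - L - A 0\<rfloor> - 1"
    have v: "real (Suc v) \<le> speed * n - L - A 0" "speed * n - L - A 0 \<le> real (Suc v) + 1"
    proof -
      have "1 \<le> \<lfloor>speed * n - L - A 0\<rfloor>" using False by linarith
      then have "real (Suc v) = of_int \<lfloor>speed * n - L - A 0\<rfloor>" unfolding v_def by simp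
      then show "real (Suc v) \<le> speed * n - L - A 0" "speed * n - L - A 0 \<le> real (Suc v) + 1"
        by linarith+
    qed
    have "\<exists>j. real (Suc v) / 2 ^ (j + 2) \<le> A (Suc j) - A j"
    \<comment> \<open>If every increment stayed below its threshold, telescoping would lift the
      limit by at most half of \<open>Suc v\<close>, although the deficit is at least
      \<open>Suc v\<close>.\<close>
    proof (rule ccontr)
      assume "\<not> ?thesis"
      then have small: "A (Suc j) - A j \<le> real (Suc v) / 2 ^ (j + 2)" for j by (meson not_le less_imp_le)
      have "A j \<le> A 0 + real (Suc v) / 2 * (1 - 1 / 2 ^ j)" for j
      proof (induction j)
        case (Suc j)
        have "real (Suc v) / 2 * (1 - 1 / 2 ^ j) + real (Suc v) / 2 ^ (j + 2) = real (Suc v) / 2 * (1 - 1 / 2 ^ Suc j)"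
          by (simp add: field_simps)
        then show ?case using Suc small[of j] by linarith
      qed simp
      then have "A j \<le> A 0 + real (Suc v) / 2" for j
        by (rule order_trans) (intro add_left_mono mult_left_le, auto)
      then have "B t x \<omega> \<le> A 0 + real (Suc v) / 2"
        using lim by (intro LIMSEQ_le_const2) auto
      moreover have "0 < real (Suc v)" by simp
      ultimately show False using v(1) bad by argo
    qed
    then obtain j where j: "real (Suc v) / 2 ^ (j + 2) \<le> A (Suc j) - A j" ..
    have "\<omega> \<in> pair_event n \<beta> (L + real (Suc v) + 1) (grid_root n (Suc j) (snd (i (Suc j), z (Suc j))))
        (grid_incr n j (i (Suc j), z (Suc j))) (real (Suc v) / 2 ^ (j + 2))"
      using \<omega> bar j v(2) by (simp add: pair_event_def root A0 incr)
    then show ?thesis using idx[of "Suc j"] unfolding cover_def by blast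
  qed
qed

text \<open>The summand 1 is the variance gained in time. In \<open>6 * \<Lambda> * DIM('a)\<close>
  a factor 2 comes from the two spatial covariance differences and a factor 3 from
  \<open>exp 1 <= 3\<close>, as the grid times reach up to \<open>n + 1\<close>.\<close>

definition var_const :: real where
  "var_const = 1 + 6 * \<Lambda> * DIM('a)"

lemma var_const_pos: "0 < var_const"
  using \<Lambda>_nonneg by (simp add: var_const_def add_pos_nonneg)

lemma dist_parent_le:
  fixes z :: "'a \<Rightarrow> int"
  shows "exp (real n) * dist (grid_point n (Suc j) z :: 'a) (grid_point n j (\<lambda>b. z b div 16)) \<le> DIM('a) / 16 ^ j"
proof -
  have "exp (real n) * dist (grid_point n (Suc j) z :: 'a) (grid_point n j (\<lambda>b. z b div 16)) \<le> exp (real n) * (DIM('a) * grid_size n j)"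
    by (intro mult_left_mono dist_grid_point_parent) auto
  also have "\<dots> = DIM('a) / 16 ^ j" by (simp add: grid_size_def exp_minus field_simps)
  finally show ?thesis .
qed

text \<open>Both grid times are at least \<open>k\<close>, so only \<open>Q k\<close> enters: the
  time part of the increment is uncorrelated with the past, and in the space part the mesh
  \<open>exp (- n)\<close> compensates the Lipschitz constant of order \<open>exp k\<close>.\<close>

lemma grid_incr_cov:
  assumes "k \<le> n"
  shows "\<bar>ip (grid_incr n j p) (B (real k) y)\<bar> \<le> var_const / 16 ^ j"
proof -
  let ?T = "grid_time n (Suc j) (fst p)" and ?s = "grid_time n j (fst p div 16)"
  let ?x = "grid_point n (Suc j) (snd p)" and ?y = "grid_point n j (\<lambda>b. snd p b div 16)"
  have Ts: "real k \<le> ?T" "real k \<le> ?s" using assms by (auto simp: grid_time_def intro: add_increasing2)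
  have "ip (grid_incr n j p) (B (real k) y) = ip (B ?T ?x) (B (real k) y) - ip (B ?s ?y) (B (real k) y)"
    unfolding grid_incr_def[abs_def] by (intro ip_diff[OF gaussian] B_in grid_time_nonneg) auto
  also have "\<dots> = Q k ?x y - Q k ?y y"
    using Ts by (simp add: B_cov grid_time_nonneg min_absorb2)
  finally have "\<bar>ip (grid_incr n j p) (B (real k) y)\<bar> \<le> \<Lambda> * exp k * dist ?x ?y"
    using Q_lip[of k ?x y ?y] by simp
  also have "\<dots> \<le> \<Lambda> * (exp n * dist ?x ?y)"
    using assms \<Lambda>_nonneg by (simp only: mult.assoc) (intro mult_left_mono mult_right_mono, auto)
  also have "\<dots> \<le> \<Lambda> * (DIM('a) / 16 ^ j)"
    using \<Lambda>_nonneg by (intro mult_left_mono dist_parent_le)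
  also have "\<dots> \<le> var_const / 16 ^ j"
    using \<Lambda>_nonneg by (simp add: var_const_def divide_right_mono)
  finally show ?thesis .
qed

lemma grid_incr_var:
  assumes "fst p < 16 ^ Suc j"
  shows "ip (grid_incr n j p) (grid_incr n j p) \<le> var_const / 16 ^ j"
proof -
  let ?T = "grid_time n (Suc j) (fst p)" and ?s = "grid_time n j (fst p div 16)"
  let ?x = "grid_point n (Suc j) (snd p) :: 'a" and ?y = "grid_point n j (\<lambda>b. snd p b div 16) :: 'a"
  have pe: "real (fst p) = 16 * real (fst p div 16) + real (fst p mod 16)"
    by (metis div_mult_mod_eq mult.commute of_nat_add of_nat_mult of_nat_numeral)
  have p16: "real (fst p mod 16) \<le> 16" using mod_less_divisor[of 16 "fst p"] by linarith
  have Ts: "?T - ?s = (real (fst p mod 16) / 16) / 16 ^ j"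
    unfolding grid_time_def pe by (simp add: add_divide_distrib)
  have "0 \<le> ?T - ?s" "?T - ?s \<le> 1 / 16 ^ j"
    unfolding Ts using p16 by (auto intro!: divide_right_mono simp del: divide_divide_eq_left)
  then have sT: "?s \<le> ?T" "?T - ?s \<le> 1 / 16 ^ j" by auto
  have sn: "?s \<le> real n + 1"
  proof -
    have "fst p div 16 < 16 ^ j" using assms by (simp add: less_mult_imp_div_less mult.commute)
    then have "real (fst p div 16) \<le> 16 ^ j"
      by (metis less_imp_le of_nat_le_iff of_nat_numeral of_nat_power)
    then show ?thesis by (simp add: grid_time_def)
  qed
  have s0: "0 \<le> ?s" "0 \<le> ?T" by (rule grid_time_nonneg)+
  have inV: "B ?T ?x \<in> V" "B ?s ?y \<in> V" by (intro B_in s0)+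
  have "ip (grid_incr n j p) (grid_incr n j p)
     = ip (B ?T ?x) (B ?T ?x) - ip (B ?T ?x) (B ?s ?y) - (ip (B ?s ?y) (B ?T ?x) - ip (B ?s ?y) (B ?s ?y))"
    unfolding grid_incr_def[abs_def]
    by (simp add: ip_diff[OF gaussian] ip_diff_right[OF gaussian] inV gaussian_space_diff[OF gaussian])
  also have "\<dots> = ?T - Q ?s ?x ?y - (Q ?s ?y ?x - ?s)"
    using sT s0 by (simp add: B_cov Q_diag min_absorb1 min_absorb2)
  also have "\<dots> \<le> (?T - ?s) + 2 * (\<Lambda> * exp ?s * dist ?x ?y)"
    using Q_lip[OF s0(1), of ?x ?y ?y] Q_lip[OF s0(1), of ?y ?x ?x]
    unfolding Q_diag[OF s0(1)] dist_commute[of ?y ?x] by linarith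
  also have "\<dots> \<le> 1 / 16 ^ j + 2 * (\<Lambda> * (3 * (DIM('a) / 16 ^ j)))"
  proof (intro add_mono sT mult_left_mono)
    have "exp ?s \<le> exp (real n) * exp 1" using sn by (simp flip: exp_add)
    also have "\<dots> \<le> exp (real n) * 3" using exp_le by (intro mult_left_mono) auto
    finally have "exp ?s * dist ?x ?y \<le> exp (real n) * 3 * dist ?x ?y" by (rule mult_right_mono) simp
    also have "\<dots> = 3 * (exp (real n) * dist ?x ?y)" by simp
    also have "\<dots> \<le> 3 * (DIM('a) / 16 ^ j)" by (intro mult_left_mono dist_parent_le) simp
    finally show "\<Lambda> * exp ?s * dist ?x ?y \<le> \<Lambda> * (3 * (DIM('a) / 16 ^ j))"
      unfolding mult.assoc using \<Lambda>_nonneg by (rule mult_left_mono)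
  qed simp
  also have "\<dots> = var_const / 16 ^ j" by (simp add: var_const_def field_simps)
  finally show ?thesis .
qed

lemma pair_event_bound:
  assumes D: "D \<in> V" and c: "0 \<le> c" and rho: "\<And>k. k \<le> n \<Longrightarrow> c * \<bar>ip D (B (real k) x)\<bar> \<le> b'"
    and var: "ip D D \<le> s" 
    and H: "(kstep (\<beta> + b') ^^ n) (indicator {- (z + b')..}) 0 \<le> ennreal h" "0 \<le> h"
  shows "emeasure M (pair_event n \<beta> z x D a)
    \<le> ennreal (exp (- (real DIM('a) * n) + speed * z - c * a + speed * b' + c\<^sup>2 * s / 2) * h)"
proof -
  have "emeasure M (pair_event n \<beta> z x D a)
    \<le> ennreal (exp (- speed\<^sup>2 * n / 2 + speed * z - c * a + speed * b' + c\<^sup>2 * s / 2))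
      * (kstep (\<beta> + b') ^^ n) (indicator {- (z + b')..}) 0"
    unfolding pair_event_def
    by (rule gaussian_walk_bound[OF gaussian _ D _ _ c rho var])
      (auto simp: B_in B_zero B_cov Q_diag min_def speed_nonneg)
  also have "\<dots> \<le> ennreal (exp (- speed\<^sup>2 * n / 2 + speed * z - c * a + speed * b' + c\<^sup>2 * s / 2)) * ennreal h"
    by (intro mult_left_mono H) auto
  also have "\<dots> = ennreal (exp (- (real DIM('a) * n) + speed * z - c * a + speed * b' + c\<^sup>2 * s / 2) * h)"
    using H(2) by (simp add: ennreal_mult'' speed_square)
  finally show ?thesis .
qed

text \<open>The number of roots cancels \<open>exp (- DIM('a) * n)\<close>, leaving
  \<open>exp (speed * L)\<close> times a ballot probability. Tilting by an increment of size
  \<open>Suc v\<close> raises the barrier by \<open>Suc v\<close> and deepens the endpoint; the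
  cubic allowance in \<open>v\<close> is how the ballot bound grows under such changes.\<close>

lemma cover_prob:
  assumes "0 \<le> R"
  obtains K where "0 < K"
    "\<And>n \<beta> L h. 0 \<le> h \<Longrightarrow>
       (\<And>v::nat. (kstep (\<beta> + real v) ^^ n) (indicator {- (L + 2 * real v + 1)..}) 0 \<le> ennreal (h * (1 + real v) ^ 3)) \<Longrightarrow>
       emeasure M (cover n \<beta> L R) \<le> ennreal (K * exp (speed * L) * h)"
proof -
  let ?d = "DIM('a)"
  define dd where "dd = real ?d"
  define CR where "CR = (2 * R + 5) ^ ?d"
  have CR: "0 < CR" using assms by (simp add: CR_def)
  \<comment> \<open>With \<open>a = Suc v / 2 ^ (j + 2)\<close> and
    \<open>s = var_const / 16 ^ j\<close>, the Gaussian exponent \<open>a^2 / (2 * s)\<close> equals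
    \<open>(Suc v)^2 * 4 ^ j / (32 * var_const)\<close>.\<close>
  define \<kappa> where "\<kappa> = 1 / (32 * var_const)"
  have \<kappa>: "0 < \<kappa>" using var_const_pos by (simp add: \<kappa>_def)
  obtain C where C: "0 < C"
    "\<And>v j :: nat. 16 ^ (Suc j * (?d + 1)) * (1 + real (Suc v)) ^ 3 * exp (2 * speed * Suc v - \<kappa> * (real (Suc v))\<^sup>2 * 4 ^ j) \<le> C * (1 / 2) ^ v * (1 / 2) ^ j"
    using chaining_sum_bound[OF \<kappa>, of "2 * speed" "?d + 1"] speed_nonneg by auto
  define K where "K = CR * exp speed * (1 + 4 * C)"
  have K0: "0 < K" using CR C(1) by (simp add: K_def add_pos_pos)
  have card0: "real (card (grid_index R n j :: (nat \<times> ('a \<Rightarrow> int)) set)) \<le> CR * exp (dd * n) * 16 ^ (j * (?d + 1))" for n j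
    unfolding CR_def dd_def of_nat_mult[symmetric] by (rule card_grid_index[OF assms])
  have main: "emeasure M (cover n \<beta> L R) \<le> ennreal (K * exp (speed * L) * h)"
    if h: "0 \<le> h" and H: "\<And>v::nat. (kstep (\<beta> + real v) ^^ n) (indicator {- (L + 2 * real v + 1)..}) 0 \<le> ennreal (h * (1 + real v) ^ 3)"
    for n \<beta> L h
  proof -
    define E0 where "E0 p = pair_event n \<beta> (L + 1) (grid_root n 0 (snd p)) (\<lambda>_. 0) 0" for p :: "nat \<times> ('a \<Rightarrow> int)"
    define E where "E v j p = pair_event n \<beta> (L + real (Suc v) + 1) (grid_root n (Suc j) (snd p)) (grid_incr n j p) (real (Suc v) / 2 ^ (j + 2))" for v j p
    define h' where "h' = CR * exp (speed * (L + 1)) * h"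
    have ee: "exp (dd * n) * exp (- (dd * n) + speed * (L + 1)) = exp (speed * (L + 1))" by (simp flip: exp_add)
    have h'0: "0 \<le> h'" using h CR by (simp add: h'_def)
    have zV: "(\<lambda>_. 0) \<in> V" by (rule gaussian_space_zero[OF gaussian])
    have E0s: "E0 p \<in> sets M" for p unfolding E0_def by (intro pair_event_sets zV)
    have Es: "E v j p \<in> sets M" for v j p unfolding E_def by (intro pair_event_sets grid_incr_in)
    have E0b: "emeasure M (E0 p) \<le> ennreal (exp (- (dd * n) + speed * (L + 1)) * h)" for p
      unfolding E0_def
      using pair_event_bound[OF zV order_refl, where n=n and x="grid_root n 0 (snd p)" and b'=0 and s=0 and \<beta>=\<beta>
          and z="L + 1" and h=h and a=0] H[of 0] h
      by (simp add: ip_def dd_def)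
    have Eb: "emeasure M (E v j p) \<le> ennreal (exp (- (dd * n) + speed * (L + 1)) * h *
        ((1 + real (Suc v)) ^ 3 * exp (2 * speed * Suc v - \<kappa> * (real (Suc v))\<^sup>2 * 4 ^ j)))"
      if p: "p \<in> grid_index R n (Suc j)" for v j p
    proof -
      let ?v = "real (Suc v)"
      define s where "s = var_const / 16 ^ j"
      define a where "a = ?v / 2 ^ (j + 2)"
      \<comment> \<open>The value of \<open>c\<close> minimising
        \<open>- c * a + c^2 * s / 2\<close>. As \<open>s\<close> bounds the covariances with the
        walk as well as the variance, the shift of the barrier is at most \<open>c * s = a\<close>,
        hence at most \<open>Suc v\<close>.\<close>
      define c where "c = a / s"
      have s0: "0 < s" using var_const_pos by (simp add: s_def)
      have a0: "0 < a" "a \<le> ?v" by (auto simp: a_def divide_le_eq mult_left_le_one_le intro: order_trans[OF _ mult_left_mono[OF one_le_power]])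
      have c0: "0 \<le> c" using s0 a0 by (simp add: c_def)
      have rho: "c * \<bar>ip (grid_incr n j p) (B (real k) x)\<bar> \<le> ?v" if "k \<le> n" for k x
      proof -
        have "c * \<bar>ip (grid_incr n j p) (B (real k) x)\<bar> \<le> c * s"
          unfolding s_def using that c0 by (intro mult_left_mono grid_incr_cov)
        also have "\<dots> \<le> ?v" using s0 a0 by (simp add: c_def)
        finally show ?thesis .
      qed
      have var: "ip (grid_incr n j p) (grid_incr n j p) \<le> s"
        unfolding s_def using p by (intro grid_incr_var) (auto simp: grid_index_def)
      have hv: "(kstep (\<beta> + ?v) ^^ n) (indicator {- (L + ?v + 1 + ?v)..}) 0 \<le> ennreal (h * (1 + ?v) ^ 3)"
      proof -
        have "- (L + ?v + 1 + ?v) = - (L + 2 * ?v + 1)" by simp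
        then show ?thesis using H[of "Suc v"] by (simp only:)
      qed
      have "emeasure M (E v j p) \<le> ennreal (exp (- (dd * n) + speed * (L + ?v + 1) - c * a + speed * ?v + c\<^sup>2 * s / 2) * (h * (1 + ?v) ^ 3))"
        unfolding E_def a_def[symmetric]
        using pair_event_bound[OF grid_incr_in c0 rho var hv, where a=a] h by (simp add: dd_def)
      also have "- (dd * n) + speed * (L + ?v + 1) - c * a + speed * ?v + c\<^sup>2 * s / 2
          = - (dd * n) + speed * (L + 1) + (2 * speed * ?v - \<kappa> * ?v\<^sup>2 * 4 ^ j)"
      proof -
        have "- c * a + c\<^sup>2 * s / 2 = - a\<^sup>2 / (2 * s)"
          using s0 by (simp add: c_def power2_eq_square field_simps)
        also have "\<dots> = - (\<kappa> * ?v\<^sup>2 * 4 ^ j)"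
        proof -
          have "(16::real) ^ j = 4 ^ j * 4 ^ j" by (simp flip: power_mult_distrib)
          moreover have "((2::real) ^ (j + 2))\<^sup>2 = 16 * 4 ^ j" 
            by (simp add: power2_eq_square power_add flip: power_mult_distrib)
          ultimately show ?thesis
            using var_const_pos by (simp add: a_def s_def \<kappa>_def power_divide field_simps)
        qed
        finally show ?thesis by (simp add: algebra_simps)
      qed
      finally show ?thesis by (simp add: exp_add mult_ac)
    qed
    have sum0: "emeasure M (\<Union>p\<in>grid_index R n 0. E0 p) \<le> ennreal h'"
    proof -
      have "emeasure M (\<Union>p\<in>grid_index R n 0. E0 p) \<le> (\<Sum>p\<in>grid_index R n 0. emeasure M (E0 p))"
        by (intro emeasure_subadditive_finite finite_grid_index) (auto simp: E0s)
      also have "\<dots> \<le> (\<Sum>p\<in>(grid_index R n 0 :: (nat \<times> ('a \<Rightarrow> int)) set). ennreal (exp (- (dd * n) + speed * (L + 1)) * h))"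
        by (intro sum_mono E0b)
      also have "\<dots> = ennreal (card (grid_index R n 0 :: (nat \<times> ('a \<Rightarrow> int)) set) * (exp (- (dd * n) + speed * (L + 1)) * h))"
        using h by (simp add: ennreal_mult'' ennreal_of_nat_eq_real_of_nat)
      also have "\<dots> \<le> ennreal ((CR * exp (dd * n)) * (exp (- (dd * n) + speed * (L + 1)) * h))"
        using card0[of n 0] h by (intro ennreal_leI mult_right_mono) auto
      also have "(CR * exp (dd * n)) * (exp (- (dd * n) + speed * (L + 1)) * h) = h'"
        unfolding h'_def ee[symmetric] by (simp only: mult_ac)
      finally show ?thesis .
    qed
    have sum1: "emeasure M (\<Union>p\<in>grid_index R n (Suc j). E v j p) \<le> ennreal (h' * C * ((1 / 2) ^ v * (1 / 2) ^ j))" for v j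
    proof -
      let ?f = "(1 + real (Suc v)) ^ 3 * exp (2 * speed * Suc v - \<kappa> * (real (Suc v))\<^sup>2 * 4 ^ j)"
      let ?e = "exp (- (dd * n) + speed * (L + 1)) * h * ?f"
      have e0: "0 \<le> ?e" using h by simp
      have "emeasure M (\<Union>p\<in>grid_index R n (Suc j). E v j p) \<le> (\<Sum>p\<in>grid_index R n (Suc j). emeasure M (E v j p))"
        by (intro emeasure_subadditive_finite finite_grid_index) (auto simp: Es)
      also have "\<dots> \<le> (\<Sum>p\<in>(grid_index R n (Suc j) :: (nat \<times> ('a \<Rightarrow> int)) set). ennreal ?e)"
        by (intro sum_mono Eb)
      also have "\<dots> = ennreal (card (grid_index R n (Suc j) :: (nat \<times> ('a \<Rightarrow> int)) set) * ?e)"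
        using e0 by (simp add: ennreal_mult'' ennreal_of_nat_eq_real_of_nat)
      also have "\<dots> \<le> ennreal ((CR * exp (dd * n) * 16 ^ (Suc j * (?d + 1))) * ?e)"
        using card0[of n "Suc j"] e0 by (intro ennreal_leI mult_right_mono)
      also have "(CR * exp (dd * n) * 16 ^ (Suc j * (?d + 1))) * ?e = h' * (16 ^ (Suc j * (?d + 1)) * (1 + real (Suc v)) ^ 3 * exp (2 * speed * Suc v - \<kappa> * (real (Suc v))\<^sup>2 * 4 ^ j))"
        unfolding h'_def ee[symmetric] by (simp only: mult_ac)
      also have "\<dots> \<le> h' * (C * (1 / 2) ^ v * (1 / 2) ^ j)"
        by (intro mult_left_mono C h'0)
      finally show ?thesis by (simp add: mult.assoc ennreal_leI)
    qed
    have half: "(\<Sum>j. ennreal (c * (1 / 2) ^ j)) = ennreal (c * 2)" if "0 \<le> c" for c :: real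
    proof -
      have "(\<lambda>j. c * (1 / 2) ^ j) sums (c * 2)"
        using sums_mult[OF geometric_sums[of "1 / 2 :: real"], of c] by simp
      then show ?thesis using that by (intro suminf_ennreal_eq) auto
    qed
    have sum2: "emeasure M (\<Union>j. \<Union>p\<in>grid_index R n (Suc j). E v j p) \<le> ennreal ((h' * C * 2) * (1 / 2) ^ v)" for v
    proof -
      have "emeasure M (\<Union>j. \<Union>p\<in>grid_index R n (Suc j). E v j p) \<le> (\<Sum>j. emeasure M (\<Union>p\<in>grid_index R n (Suc j). E v j p))"
        by (intro emeasure_subadditive_countably) (auto intro!: sets.finite_UN finite_grid_index Es)
      also have "\<dots> \<le> (\<Sum>j. ennreal ((h' * C * (1 / 2) ^ v) * (1 / 2) ^ j))"
        using sum1[of v] by (intro suminf_le summableI) (simp only: mult.assoc)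
      also have "\<dots> = ennreal ((h' * C * 2) * (1 / 2) ^ v)"
        using h'0 C(1) by (subst half) (auto simp: mult_ac)
      finally show ?thesis .
    qed
    have Us: "(\<Union>j. \<Union>p\<in>grid_index R n (Suc j). E v j p) \<in> sets M" for v
      by (rule sets.countable_UN) (auto intro!: sets.finite_UN finite_grid_index Es)
    have sum3: "emeasure M (\<Union>v. \<Union>j. \<Union>p\<in>grid_index R n (Suc j). E v j p) \<le> ennreal (h' * C * 4)"
    proof -
      have "emeasure M (\<Union>v. \<Union>j. \<Union>p\<in>grid_index R n (Suc j). E v j p)
          \<le> (\<Sum>v. emeasure M (\<Union>j. \<Union>p\<in>grid_index R n (Suc j). E v j p))"
        using Us by (intro emeasure_subadditive_countably) auto
      also have "\<dots> \<le> (\<Sum>v. ennreal ((h' * C * 2) * (1 / 2) ^ v))"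
        using sum2 by (intro suminf_le summableI)
      also have "\<dots> = ennreal (h' * C * 4)"
        using h'0 C(1) by (subst half) (auto simp: mult_ac)
      finally show ?thesis .
    qed
    have "emeasure M (cover n \<beta> L R) \<le> emeasure M (\<Union>p\<in>grid_index R n 0. E0 p)
        + emeasure M (\<Union>v. \<Union>j. \<Union>p\<in>grid_index R n (Suc j). E v j p)"
      unfolding cover_def E0_def[symmetric] E_def[symmetric]
      using Us by (intro emeasure_subadditive) (auto intro!: sets.finite_UN finite_grid_index E0s)
    also have "\<dots> \<le> ennreal h' + ennreal (h' * C * 4)" by (intro add_mono sum0 sum3)
    also have "\<dots> = ennreal (K * exp (speed * L) * h)"
    proof -
      have "0 \<le> h' * C * 4" using h'0 C(1) by simp
      then have "ennreal h' + ennreal (h' * C * 4) = ennreal (h' + h' * C * 4)" using h'0 by simp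
      also have "h' + h' * C * 4 = K * exp (speed * L) * h"
        by (simp add: h'_def K_def exp_add algebra_simps)
      finally show ?thesis .
    qed
    finally show ?thesis .
  qed
  show ?thesis using that[OF K0 main] .
qed

end

section \<open>Borel--Cantelli arguments\<close>

text \<open>Cauchy condensation reduces the series to that of \<open>n powr (- 3 / 2)\<close>. The
  shift by two keeps the logarithm positive and the terms decreasing.\<close>

lemma summable_inverse_n_ln: "summable (\<lambda>n::nat. 1 / (real n * ln (real n) powr (3 / 2)))"
proof -
  let ?f = "\<lambda>n::nat. 1 / (real (n + 2) * ln (real (n + 2)) powr (3 / 2))"
  have "summable (\<lambda>n. 2 ^ n * ?f (2 ^ n))"
  proof (rule summable_comparison_test_bigo)
    show "summable (\<lambda>n. norm (real n powr (- 3 / 2)))"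
      by (simp add: summable_real_powr_iff)
    show "(\<lambda>n. 2 ^ n * ?f (2 ^ n)) \<in> O(\<lambda>n. real n powr (- 3 / 2))"
      by real_asymp
  qed
  moreover have "?f (Suc m) \<le> ?f m" for m
    by (intro divide_left_mono mult_mono powr_mono2) (auto intro!: mult_pos_pos)
  ultimately have "summable ?f" by (subst condensation_test) auto
  then show ?thesis using summable_iff_shift[of "\<lambda>n::nat. 1 / (real n * ln (real n) powr (3 / 2))" 2] by simp
qed

text \<open>The exponential divided by \<open>n * sqrt n\<close> is of order
  \<open>1 / (n * ln n ^ 6)\<close>, and the three remaining factors are each of order
  \<open>ln n\<close>; what is left has three powers of \<open>ln n\<close> in the
  denominator.\<close>

lemma summable_rough:
  fixes g q :: real assumes "g > 0"
  shows "summable (\<lambda>n::nat. exp (g * ((ln n / 2 - 6 * ln (ln n)) / g)) * (1 + (q + 2 / g * ln n) + sqrt (ln n))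
      * (1 + (q + 2 / g * ln n) + (ln n / 2 - 6 * ln (ln n)) / g + sqrt (ln n))\<^sup>2 / (n * sqrt n))"
proof (rule summable_comparison_test_bigo)
  show "summable (\<lambda>n::nat. norm (1 / (real n * ln (real n) powr (3 / 2))))"
    using summable_inverse_n_ln by simp
  have 1: "(\<lambda>n::nat. 1 + (q + 2 / g * ln n) + sqrt (ln n)) \<in> O(\<lambda>n. ln n)"
    using assms by real_asymp
  have 2: "(\<lambda>n::nat. (ln n / 2 - 6 * ln (ln n)) / g) \<in> O(\<lambda>n. ln n)"
    using assms by real_asymp
  have 3: "(\<lambda>n::nat. 1 + (q + 2 / g * ln n) + (ln n / 2 - 6 * ln (ln n)) / g + sqrt (ln n)) \<in> O(\<lambda>n. ln n)"
    using sum_in_bigo(1)[OF 1 2] by (simp add: algebra_simps)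
  have 4: "(\<lambda>n::nat. exp (g * ((ln n / 2 - 6 * ln (ln n)) / g)) / (n * sqrt n)) \<in> O(\<lambda>n. 1 / (n * ln n ^ 6))"
    using assms by real_asymp
  have "(\<lambda>n::nat. exp (g * ((ln n / 2 - 6 * ln (ln n)) / g)) / (n * sqrt n) * ((1 + (q + 2 / g * ln n) + sqrt (ln n))
      * (1 + (q + 2 / g * ln n) + (ln n / 2 - 6 * ln (ln n)) / g + sqrt (ln n))\<^sup>2)) \<in> O(\<lambda>n. 1 / (n * ln n ^ 6) * (ln n * (ln n)\<^sup>2))"
    by (intro landau_o.big.mult landau_o.big_power 1 3 4)
  also have "(\<lambda>n::nat. 1 / (real n * ln n ^ 6) * (ln n * (ln n)\<^sup>2)) \<in> O(\<lambda>n. 1 / (real n * ln (real n) powr (3 / 2)))"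
    by real_asymp
  finally show "(\<lambda>n::nat. exp (g * ((ln n / 2 - 6 * ln (ln n)) / g)) * (1 + (q + 2 / g * ln n) + sqrt (ln n))
      * (1 + (q + 2 / g * ln n) + (ln n / 2 - 6 * ln (ln n)) / g + sqrt (ln n))\<^sup>2 / (n * sqrt n)) \<in> O(\<lambda>n. 1 / (real n * ln (real n) powr (3 / 2)))"
    by (simp add: mult_ac)
qed

text \<open>The powers of \<open>ln n\<close> are \<open>- 4\<close> from the level,
  \<open>1 / 2\<close> from the constant barrier with its overshoot allowance and \<open>2\<close>
  from the squared depth, together exactly \<open>- 3 / 2\<close>.\<close>

lemma summable_sharp:
  fixes g q :: real assumes "g > 0"
  shows "summable (\<lambda>n::nat. exp (g * ((ln n / 2 - 4 * ln (ln n)) / g)) * (1 + q + sqrt (ln n)) * (1 + q + (ln n / 2 - 4 * ln (ln n)) / g + sqrt (ln n))\<^sup>2 / (n * sqrt n))"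
proof (rule summable_comparison_test_bigo)
  show "summable (\<lambda>n::nat. norm (1 / (real n * ln (real n) powr (3 / 2))))"
    using summable_inverse_n_ln by simp
  show "(\<lambda>n::nat. exp (g * ((ln n / 2 - 4 * ln (ln n)) / g)) * (1 + q + sqrt (ln n)) * (1 + q + (ln n / 2 - 4 * ln (ln n)) / g + sqrt (ln n))\<^sup>2 / (n * sqrt n))
   \<in> O(\<lambda>n. 1 / (real n * ln (real n) powr (3 / 2)))"
  using assms by real_asymp
qed

lemma eventually_level_nonneg:
  fixes g c :: real assumes "g > 0"
  shows "eventually (\<lambda>n::nat. 0 \<le> (ln n / 2 - c * ln (ln n)) / g) sequentially"
  using assms by real_asymp

lemma (in prob_space) AE_eventually_notin:
  assumes C: "\<And>n. C n \<in> sets M" and \<epsilon>: "summable \<epsilon>" "\<And>n. 0 \<le> \<epsilon> n"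
    and le: "\<forall>\<^sub>F n in sequentially. emeasure M (C n) \<le> ennreal (\<epsilon> n)"
  shows "AE \<omega> in M. \<forall>\<^sub>F n in sequentially. \<omega> \<notin> C n"
proof -
  have "summable (\<lambda>n. measure M (C n))"
  proof (rule summable_comparison_test_ev[OF _ \<epsilon>(1)])
    show "\<forall>\<^sub>F n in sequentially. norm (measure M (C n)) \<le> \<epsilon> n"
      using le by eventually_elim (use \<epsilon>(2) in \<open>simp add: emeasure_eq_measure\<close>)
  qed
  then have "AE \<omega> in M. \<forall>\<^sub>F n in sequentially. \<omega> \<in> space M - C n"
    by (intro borel_cantelli_AE1 C) (auto simp: emeasure_eq_measure)
  then show ?thesis by eventually_elim (auto elim: eventually_mono)
qed

section \<open>From summable probabilities to almost sure bounds\<close>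

context star_field
begin

lemma speed_pos: "0 < speed"
  by (simp add: speed)

lemma bounded_on_compact:
  assumes \<omega>: "\<omega> \<in> space M"
  obtains q :: nat where "\<And>t x. 0 \<le> t \<Longrightarrow> t \<le> T \<Longrightarrow> norm x \<le> R \<Longrightarrow> B t x \<omega> \<le> real q"
proof -
  let ?K = "{0..T} \<times> cball (0::'a) R"
  have "compact ((\<lambda>(t, x). B t x \<omega>) ` ?K)"
    by (intro compact_continuous_image continuous_on_subset[OF B_cont[OF \<omega>]] compact_Times) auto
  then have "bounded ((\<lambda>(t, x). B t x \<omega>) ` ?K)" by (rule compact_imp_bounded)
  then obtain b where b: "\<And>p. p \<in> ?K \<Longrightarrow> \<bar>(\<lambda>(t, x). B t x \<omega>) p\<bar> \<le> b"
    unfolding bounded_iff by auto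
  obtain q :: nat where "b \<le> real q" using real_arch_simple by blast
  show ?thesis
  proof (rule that[of q])
    fix t :: real and x :: 'a assume "0 \<le> t" "t \<le> T" "norm x \<le> R"
    then show "B t x \<omega> \<le> real q" using b[of "(t, x)"] \<open>b \<le> real q\<close> by auto
  qed
qed

text \<open>\<open>L n\<close> is a depth below the line, so a bound above the line has negative
  \<open>L\<close>. The level is frozen at the integer \<open>n\<close> over the whole interval from
  \<open>n\<close> to \<open>n + 1\<close>, matching \<open>cover\<close>.\<close>

definition below :: "(nat \<Rightarrow> real) \<Rightarrow> real \<Rightarrow> 'w \<Rightarrow> bool" where
  "below L R \<omega> \<longleftrightarrow> (\<forall>\<^sub>F n in sequentially. \<forall>t x. real n \<le> t \<and> t < real n + 1 \<and> norm x \<le> R \<longrightarrow> B t x \<omega> < speed * n - L n)"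

text \<open>The finitely many early times are absorbed by a random constant \<open>q\<close>, finite
  by compactness. Monotonicity of \<open>f\<close> lets the bound obtained at a time
  \<open>k\<close> serve as a barrier for every later \<open>n\<close>.\<close>

lemma below_integer_times:
  fixes f :: "nat \<Rightarrow> real" and R :: real
  assumes \<omega>: "\<omega> \<in> space M" and "below L R \<omega>" and f: "\<forall>\<^sub>F n in sequentially. - L n \<le> f n"
    and f_mono: "\<And>m n. 1 \<le> m \<Longrightarrow> m \<le> n \<Longrightarrow> f m \<le> f n" and f_nonneg: "\<And>n. 0 \<le> f n"
  obtains q :: nat where "\<And>n k x. 1 \<le> n \<Longrightarrow> k \<le> n \<Longrightarrow> norm x \<le> R \<Longrightarrow> B (real k) x \<omega> \<le> speed * k + (q + f n)"
proof -
  obtain N where N: "\<And>n t x. N \<le> n \<Longrightarrow> real n \<le> t \<Longrightarrow> t < real n + 1 \<Longrightarrow> norm x \<le> R \<Longrightarrow> B t x \<omega> < speed * n - L n"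
    "\<And>n. N \<le> n \<Longrightarrow> - L n \<le> f n"
    using eventually_conj[OF assms(2)[unfolded below_def] f] unfolding eventually_sequentially by blast
  obtain q :: nat where q: "\<And>t x. 0 \<le> t \<Longrightarrow> t \<le> real N \<Longrightarrow> norm x \<le> R \<Longrightarrow> B t x \<omega> \<le> real q"
    using bounded_on_compact[OF \<omega>, of "real N" R] by blast
  show ?thesis
  proof (rule that[of q])
    fix n k :: nat and x :: 'a assume nk: "1 \<le> n" "k \<le> n" "norm x \<le> R"
    show "B (real k) x \<omega> \<le> speed * k + (q + f n)"
    proof (cases "k \<le> N")
      case True
      then have "B (real k) x \<omega> \<le> real q" using nk by (intro q) auto
      moreover have "0 \<le> speed * k" using speed_pos by simp
      ultimately show ?thesis using f_nonneg[of n] by linarith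
    next
      case False
      then have "B (real k) x \<omega> < speed * k - L k" "- L k \<le> f k" "f k \<le> f n"
        using nk by (auto intro!: N f_mono)
      then show ?thesis by linarith
    qed
  qed
qed

text \<open>With the trivial ballot bound 1 the estimate of \<open>cover\<close> is uniform in the
  barrier, and every path respects some constant barrier up to time \<open>n\<close>; hence the
  increasing union over \<open>q\<close> may be taken inside the probability. The coefficient
  \<open>2 / speed\<close> makes \<open>exp (speed * L)\<close> equal to
  \<open>1 / n^2\<close>.\<close>

lemma AE_below_without_barrier:
  assumes R: "0 \<le> R"
  shows "AE \<omega> in M. below (\<lambda>n. - (2 / speed * ln n)) R \<omega>"
proof -
  let ?L = "\<lambda>n::nat. - (2 / speed * ln n)"
  obtain K where K: "0 < K"
    "\<And>n \<beta> L h. 0 \<le> h \<Longrightarrow>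
       (\<And>v::nat. (kstep (\<beta> + real v) ^^ n) (indicator {- (L + 2 * real v + 1)..}) 0 \<le> ennreal (h * (1 + real v) ^ 3)) \<Longrightarrow>
       emeasure M (cover n \<beta> L R) \<le> ennreal (K * exp (speed * L) * h)"
    using cover_prob[OF R] by blast
  define C where "C n = (\<Union>q::nat. cover n (real q) (?L n) R)" for n
  have Cs: "C n \<in> sets M" for n
    unfolding C_def by (intro sets.countable_UN) (auto simp: cover_sets)
  have Cle: "emeasure M (C n) \<le> ennreal (K * (1 / real n ^ 2))" if "1 \<le> n" for n
  proof -
    have inc: "incseq (\<lambda>q::nat. cover n (real q) (?L n) R)"
    proof (rule incseq_SucI)
      fix q
      have "pair_event n (real q) z x D a \<subseteq> pair_event n (real (Suc q)) z x D a" for z x D a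
        unfolding pair_event_def by force
      then show "cover n (real q) (?L n) R \<subseteq> cover n (real (Suc q)) (?L n) R"
        unfolding cover_def by (intro Un_mono UN_mono order_refl)
    qed
    have "emeasure M (C n) = (SUP q. emeasure M (cover n (real q) (?L n) R))"
      unfolding C_def by (intro SUP_emeasure_incseq[symmetric] inc) (auto simp: cover_sets)
    also have "\<dots> \<le> ennreal (K * exp (speed * ?L n) * 1)"
    proof (intro SUP_least K(2))
      fix q v :: nat
      have "(kstep (real q + real v) ^^ n) (indicator {- (?L n + 2 * real v + 1)..}) 0 \<le> 1"
        by (rule kstep_pow_le_one) (simp add: indicator_def)
      also have "\<dots> \<le> ennreal (1 * (1 + real v) ^ 3)"
        by (simp add: one_le_power)
      finally show "(kstep (real q + real v) ^^ n) (indicator {- (?L n + 2 * real v + 1)..}) 0 \<le> ennreal (1 * (1 + real v) ^ 3)" .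
    qed simp
    also have "exp (speed * ?L n) = 1 / real n ^ 2"
    proof -
      have "exp (speed * ?L n) = exp (- (2 * ln n))" using speed_pos by simp
      also have "\<dots> = 1 / (exp (ln (real n)))\<^sup>2" by (simp add: exp_minus exp_double inverse_eq_divide)
      finally show ?thesis using that by simp
    qed
    finally show ?thesis by simp
  qed
  have "AE \<omega> in M. \<forall>\<^sub>F n in sequentially. \<omega> \<notin> C n"
  proof (rule AE_eventually_notin[OF Cs])
    show "summable (\<lambda>n. K * (1 / real n ^ 2))"
      using inverse_power_summable[of 2, where 'a=real] by (intro summable_mult) (simp add: inverse_eq_divide)
    show "\<forall>\<^sub>F n in sequentially. emeasure M (C n) \<le> ennreal (K * (1 / real n ^ 2))"
      using Cle by (intro eventually_sequentiallyI[of 1])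
  qed (use K in auto)
  then show ?thesis
  proof (rule AE_mp, intro AE_I2 impI)
    fix \<omega> assume \<omega>: "\<omega> \<in> space M" and ev: "\<forall>\<^sub>F n in sequentially. \<omega> \<notin> C n"
    show "below ?L R \<omega>"
      unfolding below_def using ev
    proof eventually_elim
      case (elim n)
      show ?case
      proof (intro allI impI, rule ccontr)
        fix t :: real and x :: 'a assume tx: "real n \<le> t \<and> t < real n + 1 \<and> norm x \<le> R" "\<not> B t x \<omega> < speed * n - ?L n"
        obtain q :: nat where q: "\<And>t x. 0 \<le> t \<Longrightarrow> t \<le> real n \<Longrightarrow> norm x \<le> R + DIM('a) \<Longrightarrow> B t x \<omega> \<le> real q"
          using bounded_on_compact[OF \<omega>, of "real n" "R + DIM('a)"] by blast
        have "\<omega> \<in> cover n (real q) (?L n) R"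
        proof (rule cover_bad[OF \<omega>])
          fix k :: nat and y :: 'a assume "k \<le> n" "norm y \<le> R + DIM('a)"
          then have "B (real k) y \<omega> \<le> real q" by (intro q) auto
          moreover have "0 \<le> speed * k" using speed_pos by simp
          ultimately show "B (real k) y \<omega> \<le> speed * k + real q" by linarith
        qed (use tx in auto)
        then show False using elim by (auto simp: C_def)
      qed
    qed
  qed
qed

lemma AE_below_with_barrier:
  fixes \<beta> :: "nat \<Rightarrow> nat \<Rightarrow> real" and L :: "nat \<Rightarrow> real" and R :: real
  assumes R: "0 \<le> R"
    and barrier: "AE \<omega> in M. \<exists>q. \<forall>n\<ge>1. \<forall>k\<le>n. \<forall>x. norm x \<le> R + DIM('a) \<longrightarrow> B (real k) x \<omega> \<le> speed * k + \<beta> q n"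
    and \<beta>: "\<And>q n. 1 \<le> n \<Longrightarrow> 0 \<le> \<beta> q n" and L: "\<forall>\<^sub>F n in sequentially. 0 \<le> L n"
    and sum: "\<And>q. summable (\<lambda>n. exp (speed * L n) * (1 + \<beta> q n + sqrt (ln n)) * (1 + \<beta> q n + L n + sqrt (ln n))\<^sup>2 / (n * sqrt n))"
  shows "AE \<omega> in M. below L R \<omega>"
proof -
  obtain K where K: "0 < K"
    "\<And>n \<beta> L h. 0 \<le> h \<Longrightarrow>
       (\<And>v::nat. (kstep (\<beta> + real v) ^^ n) (indicator {- (L + 2 * real v + 1)..}) 0 \<le> ennreal (h * (1 + real v) ^ 3)) \<Longrightarrow>
       emeasure M (cover n \<beta> L R) \<le> ennreal (K * exp (speed * L) * h)"
    using cover_prob[OF R] by blast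
  define \<epsilon> where "\<epsilon> q n = exp (speed * L n) * (1 + \<beta> q n + sqrt (ln n)) * (1 + \<beta> q n + L n + sqrt (ln n))\<^sup>2 / (n * sqrt n)" for q n
  have Cle: "emeasure M (cover n (\<beta> q n) (L n) R) \<le> ennreal (1800 * K * \<epsilon> q n)" if n: "4 \<le> n" and Ln: "0 \<le> L n" for q n
  proof -
    let ?b = "\<beta> q n" and ?L = "L n" and ?u = "sqrt (ln n)"
    \<comment> \<open>Raising the barrier by \<open>v\<close> and the depth by
      \<open>2 * v + 1\<close> multiplies the linear factor by at most \<open>1 + v\<close> and the
      squared one by at most \<open>(3 * (1 + v))^2\<close>; the constant is
      \<open>200 * 9\<close>.\<close>
    define h where "h = 1800 * ((1 + ?b + ?u) * (1 + ?b + ?L + ?u)\<^sup>2 / (n * sqrt n))"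
    have b0: "0 \<le> ?b" using n by (intro \<beta>) auto
    have u0: "0 \<le> ?u" using n by simp
    have h0: "0 \<le> h" using b0 u0 by (simp add: h_def)
    have "emeasure M (cover n ?b ?L R) \<le> ennreal (K * exp (speed * ?L) * h)"
    proof (rule K(2)[OF h0])
      fix v :: nat
      have "(kstep (?b + real v) ^^ n) (indicator {- (?L + 2 * real v + 1)..}) 0
         \<le> ennreal (200 * (1 + (?b + real v) + ?u) * (1 + (?b + real v) + (?L + 2 * real v + 1) + ?u)\<^sup>2 / (n * sqrt n))"
        using b0 Ln n by (intro ballot) auto
      also have "\<dots> \<le> ennreal (h * (1 + real v) ^ 3)"
      proof (rule ennreal_leI)
        have 1: "1 + (?b + real v) + ?u \<le> (1 + real v) * (1 + ?b + ?u)"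
          using mult_nonneg_nonneg[of "real v" "?b + ?u"] b0 u0 by (simp add: algebra_simps)
        have 2: "1 + (?b + real v) + (?L + 2 * real v + 1) + ?u \<le> 3 * ((1 + real v) * (1 + ?b + ?L + ?u))"
          using mult_nonneg_nonneg[of "real v" "?b + ?L + ?u"] b0 u0 Ln by (simp add: algebra_simps)
        have "200 * (1 + (?b + real v) + ?u) * (1 + (?b + real v) + (?L + 2 * real v + 1) + ?u)\<^sup>2
           \<le> 200 * ((1 + real v) * (1 + ?b + ?u)) * (3 * ((1 + real v) * (1 + ?b + ?L + ?u)))\<^sup>2"
          using b0 u0 Ln by (intro mult_mono power_mono 1 2) auto
        also have "\<dots> = 1800 * ((1 + ?b + ?u) * (1 + ?b + ?L + ?u)\<^sup>2) * (1 + real v) ^ 3"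
          by algebra
        finally have "200 * (1 + (?b + real v) + ?u) * (1 + (?b + real v) + (?L + 2 * real v + 1) + ?u)\<^sup>2 / (n * sqrt n)
            \<le> 1800 * ((1 + ?b + ?u) * (1 + ?b + ?L + ?u)\<^sup>2) * (1 + real v) ^ 3 / (n * sqrt n)"
          by (rule divide_right_mono) simp
        then show "200 * (1 + (?b + real v) + ?u) * (1 + (?b + real v) + (?L + 2 * real v + 1) + ?u)\<^sup>2 / (n * sqrt n) \<le> h * (1 + real v) ^ 3"
          by (simp add: h_def mult_ac)
      qed
      finally show "(kstep (?b + real v) ^^ n) (indicator {- (?L + 2 * real v + 1)..}) 0 \<le> ennreal (h * (1 + real v) ^ 3)" .
    qed
    also have "K * exp (speed * ?L) * h = 1800 * K * \<epsilon> q n"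
      by (simp add: h_def \<epsilon>_def mult_ac)
    finally show ?thesis .
  qed
  have "AE \<omega> in M. \<forall>\<^sub>F n in sequentially. \<omega> \<notin> cover n (\<beta> q n) (L n) R" for q
  proof (rule AE_eventually_notin)
    \<comment> \<open>Absolute values give nonnegativity for every \<open>n\<close>, as
      Borel--Cantelli is phrased here; from some \<open>n\<close> on they change nothing.\<close>
    show "summable (\<lambda>n. 1800 * K * \<bar>\<epsilon> q n\<bar>)"
    proof (intro summable_mult)
      have "\<forall>\<^sub>F n in sequentially. \<bar>\<epsilon> q n\<bar> = \<epsilon> q n"
        using L eventually_ge_at_top[of 1]
        by eventually_elim (use \<beta> in \<open>auto simp: \<epsilon>_def intro!: abs_of_nonneg divide_nonneg_nonneg mult_nonneg_nonneg add_nonneg_nonneg\<close>)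
      then show "summable (\<lambda>n. \<bar>\<epsilon> q n\<bar>)"
        using sum[of q, folded \<epsilon>_def] by (subst summable_cong) auto
    qed
    show "\<forall>\<^sub>F n in sequentially. emeasure M (cover n (\<beta> q n) (L n) R) \<le> ennreal (1800 * K * \<bar>\<epsilon> q n\<bar>)"
      using L eventually_ge_at_top[of 4]
    proof eventually_elim
      case (elim n)
      then have "emeasure M (cover n (\<beta> q n) (L n) R) \<le> ennreal (1800 * K * \<epsilon> q n)" by (intro Cle)
      also have "\<dots> \<le> ennreal (1800 * K * \<bar>\<epsilon> q n\<bar>)" using K(1) by (intro ennreal_leI mult_left_mono) auto
      finally show ?case .
    qed
  qed (use K(1) in \<open>auto simp: cover_sets\<close>)
  \<comment> \<open>The height \<open>q\<close> depends on the path, so the exceptional sets of all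
    \<open>q\<close> are collected before it is chosen; there are countably many.\<close>
  then have "AE \<omega> in M. \<forall>q. \<forall>\<^sub>F n in sequentially. \<omega> \<notin> cover n (\<beta> q n) (L n) R"
    by (simp add: AE_all_countable)
  from this barrier AE_space show ?thesis
  proof eventually_elim
    case (elim \<omega>)
    then obtain q where q: "\<And>n k x. 1 \<le> n \<Longrightarrow> k \<le> n \<Longrightarrow> norm x \<le> R + DIM('a) \<Longrightarrow> B (real k) x \<omega> \<le> speed * k + \<beta> q n"
      by blast
    have "\<forall>\<^sub>F n in sequentially. \<omega> \<notin> cover n (\<beta> q n) (L n) R" using elim by blast
    then show ?case
      unfolding below_def using eventually_ge_at_top[of 1]
    proof eventually_elim
      case (elim n)
      show ?case
      proof (intro allI impI, rule ccontr)
        fix t :: real and x :: 'a assume tx: "real n \<le> t \<and> t < real n + 1 \<and> norm x \<le> R" "\<not> B t x \<omega> < speed * n - L n"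
        have "\<omega> \<in> cover n (\<beta> q n) (L n) R"
          by (rule cover_bad[OF \<open>\<omega> \<in> space M\<close> q]) (use tx elim in auto)
        then show False using elim by simp
      qed
    qed
  qed
qed

end

section \<open>The successive improvements of the barrier and their uniform consequences\<close>

context star_field
begin

lemma AE_below_log_barrier:
  assumes "0 \<le> R"
  shows "AE \<omega> in M. \<exists>q::nat. \<forall>n\<ge>1. \<forall>k\<le>n. \<forall>x. norm x \<le> R \<longrightarrow> B (real k) x \<omega> \<le> speed * k + (q + 2 / speed * ln (real n))"
  using AE_below_without_barrier[OF assms] AE_space
proof eventually_elim
  case (elim \<omega>)
  obtain q :: nat where "\<And>n k x. 1 \<le> n \<Longrightarrow> k \<le> n \<Longrightarrow> norm x \<le> R \<Longrightarrow> B (real k) x \<omega> \<le> speed * k + (q + 2 / speed * ln (real n))"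
  proof (rule below_integer_times[OF elim(2,1), where f = "\<lambda>n. 2 / speed * ln (real n)"])
    show "2 / speed * ln (real m) \<le> 2 / speed * ln (real n)" if "1 \<le> m" "m \<le> n" for m n
      using that speed_pos by (intro mult_left_mono) auto
    \<comment> \<open>The case \<open>n = 0\<close> relies on the convention
      \<open>ln 0 = 0\<close>.\<close>
    show "0 \<le> 2 / speed * ln (real n)" for n
      using speed_pos by (cases "n = 0") auto
  qed auto
  then show ?case by blast
qed

text \<open>The level with the constant 6 is eventually nonnegative, so it lies below the line of
  slope \<open>speed\<close> and only finitely many times need a correction. The input barrier is
  taken on the radius \<open>R + DIM('a)\<close>, available since the previous stage holds for every
  radius.\<close>

lemma AE_below_constant_barrier:
  assumes "0 \<le> R"
  shows "AE \<omega> in M. \<exists>q::nat. \<forall>n\<ge>1. \<forall>k\<le>n. \<forall>x. norm x \<le> R \<longrightarrow> B (real k) x \<omega> \<le> speed * k + real q"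
proof -
  have lev: "\<forall>\<^sub>F n in sequentially. 0 \<le> (ln (real n) / 2 - 6 * ln (ln (real n))) / speed"
    using eventually_level_nonneg[OF speed_pos, of 6] .
  have "AE \<omega> in M. below (\<lambda>n. (ln n / 2 - 6 * ln (ln n)) / speed) R \<omega>"
  proof (rule AE_below_with_barrier[OF assms, where \<beta> = "\<lambda>q n. real q + 2 / speed * ln (real n)"])
    show "AE \<omega> in M. \<exists>q::nat. \<forall>n\<ge>1. \<forall>k\<le>n. \<forall>x. norm x \<le> R + DIM('a) \<longrightarrow>
        B (real k) x \<omega> \<le> speed * k + (real q + 2 / speed * ln (real n))"
      by (rule AE_below_log_barrier) (use assms in simp)
    show "0 \<le> real q + 2 / speed * ln (real n)" if "1 \<le> n" for q n
      using that speed_pos by simp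
  qed (use lev summable_rough[OF speed_pos] in auto)
  then show ?thesis using AE_space
  proof eventually_elim
    case (elim \<omega>)
    obtain q :: nat where "\<And>n k x. 1 \<le> n \<Longrightarrow> k \<le> n \<Longrightarrow> norm x \<le> R \<Longrightarrow> B (real k) x \<omega> \<le> speed * k + (q + 0)"
    proof (rule below_integer_times[OF elim(2,1), where f = "\<lambda>_. 0"])
      show "\<forall>\<^sub>F n in sequentially. - ((ln (real n) / 2 - 6 * ln (ln (real n))) / speed) \<le> 0"
        using lev by eventually_elim linarith
    qed auto
    then show ?case by auto
  qed
qed

lemma AE_below_sharp:
  assumes "0 \<le> R"
  shows "AE \<omega> in M. below (\<lambda>n. (ln n / 2 - 4 * ln (ln n)) / speed) R \<omega>"
proof (rule AE_below_with_barrier[OF assms, where \<beta> = "\<lambda>q n. real q"])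
  show "AE \<omega> in M. \<exists>q::nat. \<forall>n\<ge>1. \<forall>k\<le>n. \<forall>x. norm x \<le> R + DIM('a) \<longrightarrow> B (real k) x \<omega> \<le> speed * k + real q"
    by (rule AE_below_constant_barrier) (use assms in simp)
qed (use eventually_level_nonneg[OF speed_pos, of 4] summable_sharp[OF speed_pos] in auto)

text \<open>Within a unit interval \<open>ln t\<close> exceeds \<open>ln n\<close> by at most
  \<open>ln 2\<close>, and the iterated logarithms compare in the favourable direction. The bounded
  initial window is handled by compactness; \<open>t >= exp 1\<close> makes \<open>ln (ln t)\<close>
  nonnegative there.\<close>

lemma AE_sup_finite:
  assumes "0 \<le> R"
  shows "AE \<omega> in M. \<exists>c. \<forall>t\<ge>exp 1. \<forall>x. norm x \<le> R \<longrightarrow>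
     B t x \<omega> - speed * t + ln t / (2 * speed) - 4 * ln (ln t) / speed \<le> c"
  using AE_below_sharp[OF assms] AE_space
proof eventually_elim
  case (elim \<omega>)
  let ?L = "\<lambda>n::nat. (ln n / 2 - 4 * ln (ln n)) / speed"
  obtain N0 where N0: "\<And>n t x. N0 \<le> n \<Longrightarrow> real n \<le> t \<Longrightarrow> t < real n + 1 \<Longrightarrow> norm x \<le> R \<Longrightarrow> B t x \<omega> < speed * n - ?L n"
    using elim(1) unfolding below_def eventually_sequentially by blast
  \<comment> \<open>Since 3 exceeds \<open>exp 1\<close>, the logarithm of each later
    \<open>n\<close> is greater than one, so the iterated logarithms can be compared.\<close>
  define N where "N = max N0 3"
  have N3: "3 \<le> N" "N0 \<le> N" by (auto simp: N_def)
  obtain q :: nat where q: "\<And>t x. 0 \<le> t \<Longrightarrow> t \<le> real N \<Longrightarrow> norm x \<le> R \<Longrightarrow> B t x \<omega> \<le> real q"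
    using bounded_on_compact[OF elim(2), of "real N" R] by blast
  have "B t x \<omega> - speed * t + ln t / (2 * speed) - 4 * ln (ln t) / speed \<le> real q + ln N / (2 * speed) + ln 2 / (2 * speed)"
    if t: "exp 1 \<le> t" and x: "norm x \<le> R" for t x
  proof -
    have t0: "0 < t" using t exp_gt_zero[of "1::real"] by linarith
    have lt: "1 \<le> ln t" using t t0 by (simp add: ln_ge_iff)
    have llt: "0 \<le> ln (ln t)" using lt by simp
    show ?thesis
    proof (cases "t \<le> real N")
      case True
      have "B t x \<omega> \<le> real q" using True t0 x by (intro q) auto
      moreover have "ln t / (2 * speed) \<le> ln N / (2 * speed)"
        using True t0 speed_pos by (intro divide_right_mono) auto
      moreover have "0 \<le> 4 * ln (ln t) / speed" "0 \<le> speed * t" "0 \<le> ln 2 / (2 * speed)"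
        using llt speed_pos t0 by auto
      ultimately show ?thesis by linarith
    next
      case False
      define n where "n = nat \<lfloor>t\<rfloor>"
      have n: "real n \<le> t" "t < real n + 1"
        using t0 by (auto simp: n_def)
      have nN: "N \<le> n" using False n by linarith
      have n3: "3 \<le> n" using N3 nN by simp
      have b: "B t x \<omega> < speed * n - ?L n"
        using nN N3 n x by (intro N0) auto
      have "ln t \<le> ln (2 * real n)" using n n3 t0 by (subst ln_le_cancel_iff) auto
      also have "\<dots> = ln 2 + ln n" using n3 by (simp add: ln_mult)
      finally have l1: "ln t - ln n \<le> ln 2" by simp
      have "1 < ln (real n)"
      proof -
        have "exp 1 < (3::real)" using e_less_272 by simp
        also have "\<dots> \<le> real n" using n3 by simp
        finally have "exp 1 < exp (ln (real n))" using n3 by simp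
        then show ?thesis by (simp only: exp_less_cancel_iff)
      qed
      then have l2: "ln (ln n) \<le> ln (ln t)"
        using n n3 by (subst ln_le_cancel_iff) auto
      have "speed * n \<le> speed * t" using n speed_pos by (intro mult_left_mono) auto
      then have "B t x \<omega> - speed * t + ln t / (2 * speed) - 4 * ln (ln t) / speed
         \<le> - ?L n + ln t / (2 * speed) - 4 * ln (ln t) / speed"
        using b by linarith
      also have "\<dots> = (ln t - ln n) / (2 * speed) + 4 * (ln (ln n) - ln (ln t)) / speed"
        using speed_pos by (simp add: field_simps)
      also have "\<dots> \<le> ln 2 / (2 * speed) + 0"
        using l1 l2 speed_pos by (intro add_mono divide_right_mono divide_nonpos_pos) auto
      finally have "B t x \<omega> - speed * t + ln t / (2 * speed) - 4 * ln (ln t) / speed \<le> ln 2 / (2 * speed)" by simp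
      moreover have "0 \<le> ln N / (2 * speed)" using N3 speed_pos by simp
      ultimately show ?thesis by linarith
    qed
  qed
  then show ?case by blast
qed

lemma AE_global_barrier:
  assumes "0 \<le> R"
  shows "AE \<omega> in M. \<exists>q::nat. \<forall>t\<ge>0. \<forall>x. norm x \<le> R \<longrightarrow> B t x \<omega> \<le> speed * t + q"
  using AE_below_sharp[OF assms] AE_space
proof eventually_elim
  case (elim \<omega>)
  let ?L = "\<lambda>n::nat. (ln n / 2 - 4 * ln (ln n)) / speed"
  obtain N where N: "\<And>n t x. N \<le> n \<Longrightarrow> real n \<le> t \<Longrightarrow> t < real n + 1 \<Longrightarrow> norm x \<le> R \<Longrightarrow> B t x \<omega> < speed * n - ?L n"
    "\<And>n. N \<le> n \<Longrightarrow> 0 \<le> ?L n"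
    using eventually_conj[OF elim(1)[unfolded below_def] eventually_level_nonneg[OF speed_pos, of 4]]
    unfolding eventually_sequentially by blast
  obtain q :: nat where q: "\<And>t x. 0 \<le> t \<Longrightarrow> t \<le> real N \<Longrightarrow> norm x \<le> R \<Longrightarrow> B t x \<omega> \<le> real q"
    using bounded_on_compact[OF elim(2), of "real N" R] by blast
  have "B t x \<omega> \<le> speed * t + q" if t: "0 \<le> t" and x: "norm x \<le> R" for t x
  proof (cases "t \<le> real N")
    case True
    then have "B t x \<omega> \<le> real q" using t x by (intro q)
    moreover have "0 \<le> speed * t" using t speed_pos by simp
    ultimately show ?thesis by linarith
  next
    case False
    define n where "n = nat \<lfloor>t\<rfloor>"
    have n: "real n \<le> t" "t < real n + 1"
      using t by (auto simp: n_def)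
    have "N \<le> n" using False n by linarith
    then have "B t x \<omega> < speed * n - ?L n" "0 \<le> ?L n" using N n x by blast+
    moreover have "speed * n \<le> speed * t" using n speed_pos by (intro mult_left_mono) auto
    ultimately show ?thesis by linarith
  qed
  then show ?case by blast
qed

section \<open>Measurability and probability of the global barrier event\<close>

definition sup_excess :: "real \<Rightarrow> 'w \<Rightarrow> ereal" where
  "sup_excess R \<omega> = (SUP t\<in>{0<..}. SUP x\<in>cball 0 R. ereal (B t x \<omega> - speed * t))"

text \<open>By continuity of the paths the supremum over the uncountable set of times and points
  equals the one over a countable dense subset of that same set.\<close>

lemma sup_excess_measurable: "{\<omega> \<in> space M. sup_excess R \<omega> < ereal q} \<in> sets M"
proof -
  let ?S = "{0<..} \<times> cball 0 R :: (real \<times> 'a) set"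
  let ?f = "\<lambda>\<omega> p. B (fst p) (snd p) \<omega> - speed * fst p"
  obtain D where D: "countable D" "D \<subseteq> ?S" "?S \<subseteq> closure D"
    using separable[of ?S] by blast
  have le: "sup_excess R \<omega> \<le> c" if \<omega>: "\<omega> \<in> space M" and c: "\<And>p. p \<in> D \<Longrightarrow> ereal (?f \<omega> p) \<le> c" for \<omega> c
    unfolding sup_excess_def
  proof (intro SUP_least)
    fix t :: real and x :: 'a assume "t \<in> {0<..}" "x \<in> cball 0 R"
    then have p: "(t, x) \<in> ?S" by simp
    then have "(t, x) \<in> closure D" by (rule subsetD[OF D(3)])
    then obtain s where "(\<forall>k. s k \<in> D) \<and> s \<longlonglongrightarrow> (t, x)"
      unfolding closure_sequential ..
    then have s: "\<And>k. s k \<in> D" "s \<longlonglongrightarrow> (t, x)" by simp_all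
    have sk: "s k \<in> {0..} \<times> UNIV" for k
    proof -
      have "s k \<in> {0<..} \<times> cball 0 R" using s(1) D(2) by (rule rev_subsetD)
      then show ?thesis by (auto simp: mem_Times_iff)
    qed
    have "(\<lambda>k. (\<lambda>(t, x). B t x \<omega>) (s k)) \<longlonglongrightarrow> (\<lambda>(t, x). B t x \<omega>) (t, x)"
      by (rule continuous_on_tendsto_compose[OF B_cont[OF \<omega>] s(2)]) (use p sk in auto)
    then have "(\<lambda>k. ?f \<omega> (s k)) \<longlonglongrightarrow> B t x \<omega> - speed * t"
      using tendsto_fst[OF s(2)] by (auto simp: split_def intro!: tendsto_intros)
    then have "(\<lambda>k. ereal (?f \<omega> (s k))) \<longlonglongrightarrow> ereal (B t x \<omega> - speed * t)" by simp
    then show "ereal (B t x \<omega> - speed * t) \<le> c"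
      by (rule LIMSEQ_le_const2) (intro exI allI impI c s(1))
  qed
  have ge: "ereal (?f \<omega> p) \<le> sup_excess R \<omega>" if "p \<in> D" for \<omega> p
  proof -
    have "fst p \<in> {0<..}" "snd p \<in> cball 0 R" using that D(2) by auto
    then show ?thesis unfolding sup_excess_def
      by (intro SUP_upper2[where i = "fst p"] SUP_upper) auto
  qed
  have eq: "sup_excess R \<omega> = (SUP p\<in>D. ereal (?f \<omega> p))" if "\<omega> \<in> space M" for \<omega>
    using that by (intro antisym le SUP_least ge SUP_upper)
  have [measurable]: "(\<lambda>\<omega>. SUP p\<in>D. ereal (?f \<omega> p)) \<in> borel_measurable M"
  proof (intro borel_measurable_SUP D(1))
    fix p assume "p \<in> D"
    then have "0 \<le> fst p" using D(2) by auto
    then have [measurable]: "B (fst p) (snd p) \<in> borel_measurable M" by (rule B_measurable)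
    show "(\<lambda>\<omega>. ereal (?f \<omega> p)) \<in> borel_measurable M" by measurable
  qed
  have "{\<omega> \<in> space M. sup_excess R \<omega> < ereal q} = {\<omega> \<in> space M. (SUP p\<in>D. ereal (?f \<omega> p)) < ereal q}"
    using eq by auto
  then show ?thesis by simp
qed

lemma prob_sup_excess_tendsto:
  assumes "0 \<le> R"
  shows "((\<lambda>q. prob {\<omega> \<in> space M. sup_excess R \<omega> < ereal q}) \<longlongrightarrow> 1) at_top"
proof -
  define G where "G q = {\<omega> \<in> space M. sup_excess R \<omega> < ereal q}" for q
  have Gs: "G q \<in> sets M" for q unfolding G_def by (rule sup_excess_measurable)
  have mono: "G q \<subseteq> G q'" if "q \<le> q'" for q q'
    using that unfolding G_def by (auto intro: less_le_trans)
  have "(\<lambda>n::nat. prob (G (real n))) \<longlonglongrightarrow> prob (\<Union>n. G (real n))"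
    by (intro finite_Lim_measure_incseq incseq_SucI mono) (auto simp: Gs)
  moreover have "prob (\<Union>n. G (real n)) = 1"
  proof (rule prob_eq_1[THEN iffD2])
    show "(\<Union>n. G (real n)) \<in> events" by (intro sets.countable_UN) (auto simp: Gs)
    show "AE \<omega> in M. \<omega> \<in> (\<Union>n. G (real n))"
      using AE_global_barrier[OF assms] AE_space
    proof eventually_elim
      case (elim \<omega>)
      then obtain q :: nat where q: "\<And>t x. 0 \<le> t \<Longrightarrow> norm x \<le> R \<Longrightarrow> B t x \<omega> \<le> speed * t + q" by blast
      have "sup_excess R \<omega> \<le> ereal q"
        unfolding sup_excess_def
      proof (intro SUP_least)
        fix t :: real and x :: 'a assume "t \<in> {0<..}" "x \<in> cball 0 R"
        then show "ereal (B t x \<omega> - speed * t) \<le> ereal q" using q[of t x] by simp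
      qed
      \<comment> \<open>The event asks for a strict inequality, hence the successor of
        \<open>q\<close>.\<close>
      also have "\<dots> < ereal (real (Suc q))" by simp
      finally show ?case using elim(2) unfolding G_def by blast
    qed
  qed
  ultimately have lim: "(\<lambda>n::nat. prob (G (real n))) \<longlonglongrightarrow> 1" by simp
  \<comment> \<open>Continuity from below gives the limit along the integers; monotonicity in
    \<open>q\<close> carries it over to real \<open>q\<close>, squeezed between the value at the
    integer part and 1.\<close>
  have fl: "filterlim (\<lambda>q::real. nat \<lfloor>q\<rfloor>) sequentially at_top"
    by (rule filterlim_compose[OF filterlim_nat_sequentially filterlim_floor_sequentially])
  have lim': "((\<lambda>q::real. prob (G (real (nat \<lfloor>q\<rfloor>)))) \<longlongrightarrow> 1) at_top"
    using filterlim_compose[OF lim fl] .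
  have "((\<lambda>q. prob (G q)) \<longlongrightarrow> 1) at_top"
  proof (rule tendsto_sandwich[OF _ _ lim' tendsto_const])
    show "\<forall>\<^sub>F q in at_top. prob (G (real (nat \<lfloor>q\<rfloor>))) \<le> prob (G q)"
      using eventually_ge_at_top[of 0]
    proof eventually_elim
      case (elim q)
      then have "real (nat \<lfloor>q\<rfloor>) \<le> q" by simp
      then show ?case by (intro finite_measure_mono mono Gs)
    qed
  qed simp
  then show ?thesis unfolding G_def .
qed

end

section \<open>The almost star-scale invariant field\<close>

lemma one_minus_exp_less: "0 < y \<Longrightarrow> 1 - exp (- y) < (y::real)"
  using exp_minus_greater[of y] by simp

text \<open>The integral of \<open>1 - \<eta>1 * exp (- \<eta>2 * s)\<close> over
  \<open>{0..u}\<close>, that is, the diagonal of the kernel accumulated up to \<open>u\<close>;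
  \<open>time_change\<close> inverts it on the nonnegative reals.\<close>

definition clock :: "real \<Rightarrow> real \<Rightarrow> real \<Rightarrow> real" where
  "clock \<eta>1 \<eta>2 u = u - \<eta>1 / \<eta>2 * (1 - exp (- \<eta>2 * u))"

text \<open>For \<open>\<eta>1 = 1\<close> the derivative vanishes at 0, so strictness is taken from
  \<open>1 - exp (- y) < y\<close> rather than from a positive derivative.\<close>

lemma clock_strict_mono:
  assumes \<eta>: "0 \<le> \<eta>1" "\<eta>1 \<le> 1" "0 < \<eta>2" and uv: "0 \<le> u" "u < v"
  shows "clock \<eta>1 \<eta>2 u < clock \<eta>1 \<eta>2 v"
proof -
  have e: "exp (- \<eta>2 * u) - exp (- \<eta>2 * v) = exp (- \<eta>2 * u) * (1 - exp (- (\<eta>2 * (v - u))))"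
    by (simp add: algebra_simps flip: exp_add)
  have "\<eta>1 * (exp (- \<eta>2 * u) - exp (- \<eta>2 * v)) \<le> 1 * (1 * (1 - exp (- (\<eta>2 * (v - u)))))"
    unfolding e using \<eta> uv by (intro mult_mono) auto
  also have "\<dots> < \<eta>2 * (v - u)"
    using one_minus_exp_less[of "\<eta>2 * (v - u)"] \<eta> uv by simp
  finally have "\<eta>1 * (exp (- \<eta>2 * u) - exp (- \<eta>2 * v)) / \<eta>2 < v - u"
    using \<eta> by (simp add: divide_less_eq mult.commute)
  moreover have "clock \<eta>1 \<eta>2 v - clock \<eta>1 \<eta>2 u = v - u - \<eta>1 * (exp (- \<eta>2 * u) - exp (- \<eta>2 * v)) / \<eta>2"
    using \<eta> by (simp add: clock_def field_simps)
  ultimately show ?thesis by linarith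
qed

text \<open>The intermediate value theorem gives existence and strict monotonicity gives uniqueness.
  The upper bound makes \<open>exp (time_change \<eta>1 \<eta>2 t)\<close> at most a constant
  multiple of \<open>exp t\<close>, as the Lipschitz estimate requires.\<close>

lemma time_change_clock:
  assumes \<eta>: "0 \<le> \<eta>1" "\<eta>1 \<le> 1" "0 < \<eta>2" and t: "0 \<le> t"
  shows "0 \<le> time_change \<eta>1 \<eta>2 t" "clock \<eta>1 \<eta>2 (time_change \<eta>1 \<eta>2 t) = t"
    "time_change \<eta>1 \<eta>2 t \<le> t + \<eta>1 / \<eta>2"
proof -
  have "\<exists>u\<ge>0. u \<le> t + \<eta>1 / \<eta>2 \<and> clock \<eta>1 \<eta>2 u = t"
  proof (rule IVT')
    show "clock \<eta>1 \<eta>2 0 \<le> t" using t by (simp add: clock_def)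
    have "0 \<le> \<eta>1 / \<eta>2 * exp (- \<eta>2 * (t + \<eta>1 / \<eta>2))" using \<eta> by simp
    then show "t \<le> clock \<eta>1 \<eta>2 (t + \<eta>1 / \<eta>2)"
      by (simp add: clock_def right_diff_distrib)
    show "continuous_on {0..t + \<eta>1 / \<eta>2} (clock \<eta>1 \<eta>2)"
      unfolding clock_def by (intro continuous_intros)
  qed (use \<eta> t in simp)
  then obtain u where u: "0 \<le> u" "clock \<eta>1 \<eta>2 u = t" by blast
  have "\<exists>!u. 0 \<le> u \<and> u - \<eta>1 / \<eta>2 * (1 - exp (- \<eta>2 * u)) = t"
  proof (rule ex1I[of _ u])
    fix v assume v: "0 \<le> v \<and> v - \<eta>1 / \<eta>2 * (1 - exp (- \<eta>2 * v)) = t"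
    then show "v = u"
      using clock_strict_mono[OF \<eta>, of u v] clock_strict_mono[OF \<eta>, of v u] u
      by (cases u v rule: linorder_cases) (auto simp: clock_def)
  qed (use u in \<open>simp add: clock_def\<close>)
  from theI'[OF this] show *: "0 \<le> time_change \<eta>1 \<eta>2 t" "clock \<eta>1 \<eta>2 (time_change \<eta>1 \<eta>2 t) = t"
    by (simp_all add: time_change_def clock_def)
  have "\<eta>1 / \<eta>2 * (1 - exp (- \<eta>2 * time_change \<eta>1 \<eta>2 t)) \<le> \<eta>1 / \<eta>2 * 1"
    using \<eta> by (intro mult_left_mono) auto
  then show "time_change \<eta>1 \<eta>2 t \<le> t + \<eta>1 / \<eta>2"
    using *(2) by (simp add: clock_def)
qed

text \<open>The partial derivatives are continuous and vanish off the compact support, hence are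
  bounded; the sum of their bounds over the basis controls the operator norm, and the mean value
  inequality applies.\<close>

lemma Cc_smooth_lipschitz:
  fixes f :: "'a::euclidean_space \<Rightarrow> real"
  assumes "f \<in> Cc_smooth"
  obtains \<Lambda> where "0 \<le> \<Lambda>" "\<And>x y. \<bar>f x - f y\<bar> \<le> \<Lambda> * dist x y"
proof -
  let ?D = "\<lambda>x. frechet_derivative f (at x)"
  have C1: "C_k (Suc 0) f" and cpt: "compact (fun_supp f)"
    using assms by (auto simp: Cc_smooth_def smooth_def)
  then have diff: "f differentiable at x" and cont: "b \<in> Basis \<Longrightarrow> continuous_on UNIV (\<lambda>x. ?D x b)" for x b
    by auto
  have der: "(f has_derivative ?D x) (at x)" for x
    using diff frechet_derivative_works by blast
  have zero: "?D x b = 0" if "x \<notin> fun_supp f" for x b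
  proof -
    have op: "open (- fun_supp f)" by (simp add: fun_supp_def open_Compl)
    have f0: "f y = 0" if "y \<in> - fun_supp f" for y
      using that closure_subset[of "{x. f x \<noteq> 0}"] by (auto simp: fun_supp_def)
    have "((\<lambda>_. 0) has_derivative (\<lambda>_. 0)) (at x)" by simp
    then have "(f has_derivative (\<lambda>_. 0)) (at x)"
      by (rule has_derivative_transform_within_open[OF _ op]) (use that f0 in auto)
    then have "?D x = (\<lambda>_. 0)" using der has_derivative_unique by blast
    then show ?thesis by simp
  qed
  have "\<exists>B. \<forall>x. \<bar>?D x b\<bar> \<le> B" if b: "b \<in> Basis" for b
  proof -
    have "bounded ((\<lambda>x. ?D x b) ` fun_supp f)"
      by (intro compact_imp_bounded compact_continuous_image continuous_on_subset[OF cont[OF b]] cpt) auto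
    then obtain B where B: "\<And>x. x \<in> fun_supp f \<Longrightarrow> \<bar>?D x b\<bar> \<le> B" unfolding bounded_iff by auto
    have "\<bar>?D x b\<bar> \<le> max B 0" for x
      using B[of x] zero[of x b] by (cases "x \<in> fun_supp f") auto
    then show ?thesis by blast
  qed
  then obtain B where B: "\<And>b x. b \<in> Basis \<Longrightarrow> \<bar>?D x b\<bar> \<le> B b" by metis
  define \<Lambda> where "\<Lambda> = (\<Sum>b\<in>(Basis :: 'a set). B b)"
  have \<Lambda>0: "0 \<le> \<Lambda>" unfolding \<Lambda>_def using B by (intro sum_nonneg) (meson abs_ge_zero order_trans)
  have bd: "onorm (?D x) \<le> \<Lambda>" for x
  proof (rule onorm_le)
    fix v
    interpret D: bounded_linear "?D x" using der has_derivative_bounded_linear by blast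
    have "?D x v = ?D x (\<Sum>b\<in>Basis. (v \<bullet> b) *\<^sub>R b)" by (simp add: euclidean_representation)
    also have "\<dots> = (\<Sum>b\<in>Basis. (v \<bullet> b) * ?D x b)" by (simp add: D.sum D.scaleR)
    finally have "norm (?D x v) \<le> (\<Sum>b\<in>Basis. \<bar>v \<bullet> b\<bar> * \<bar>?D x b\<bar>)"
      by (auto intro!: order_trans[OF sum_abs] simp: abs_mult)
    also have "\<dots> \<le> (\<Sum>b\<in>Basis. norm v * B b)"
      by (intro sum_mono mult_mono B Basis_le_norm) auto
    finally show "norm (?D x v) \<le> \<Lambda> * norm v" by (simp add: \<Lambda>_def sum_distrib_left mult.commute)
  qed
  have "\<bar>f x - f y\<bar> \<le> \<Lambda> * dist x y" for x y
    using differentiable_bound[of UNIV f ?D \<Lambda> x y] der bd by (simp add: dist_norm)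
  with \<Lambda>0 show ?thesis using that by blast
qed

section \<open>The truncated kernel: diagonal, initial value and Lipschitz bound\<close>

lemma star_scale_integrand_cont:
  fixes \<kappa> :: "'a::euclidean_space \<Rightarrow> real"
  assumes "continuous_on UNIV \<kappa>"
  shows "continuous_on {0..u} (\<lambda>s. (1 - \<eta>1 * exp (- \<eta>2 * s)) * \<kappa> (exp s *\<^sub>R (x - y)))"
  by (intro continuous_intros continuous_on_compose2[OF assms]) (auto intro!: continuous_intros)

text \<open>As \<open>\<kappa> 0 = 1\<close>, the integrand on the diagonal is the derivative of
  \<open>clock\<close>, and the time change is made so that the integral is
  \<open>t\<close>.\<close>

lemma star_scale_trunc_diag:
  assumes \<eta>: "0 \<le> \<eta>1" "\<eta>1 \<le> 1" "0 < \<eta>2" and t: "0 \<le> t" and \<kappa>0: "\<kappa> 0 = 1"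
  shows "star_scale_trunc \<eta>1 \<eta>2 \<kappa> t x x = t"
proof -
  let ?u = "time_change \<eta>1 \<eta>2 t"
  have "(LINT s|lborel. (1 - \<eta>1 * exp (- \<eta>2 * s)) * indicator {0..?u} s) = clock \<eta>1 \<eta>2 ?u - clock \<eta>1 \<eta>2 0"
  proof (rule integral_FTC_Icc_real)
    show "0 \<le> ?u" using time_change_clock[OF \<eta> t] by simp
    show "DERIV (clock \<eta>1 \<eta>2) s :> 1 - \<eta>1 * exp (- \<eta>2 * s)" for s
      unfolding clock_def[abs_def] using \<eta> by (auto intro!: derivative_eq_intros)
    show "isCont (\<lambda>s. 1 - \<eta>1 * exp (- \<eta>2 * s)) s" for s by (intro continuous_intros)
  qed
  then show ?thesis
    using time_change_clock[OF \<eta> t]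
    by (simp add: star_scale_trunc_def set_lebesgue_integral_def \<kappa>0 mult.commute) (simp add: clock_def)
qed

lemma star_scale_trunc_zero:
  assumes \<eta>: "0 \<le> \<eta>1" "\<eta>1 \<le> 1" "0 < \<eta>2"
  shows "star_scale_trunc \<eta>1 \<eta>2 \<kappa> 0 x y = 0"
proof -
  have "time_change \<eta>1 \<eta>2 0 = 0"
    using time_change_clock[OF \<eta> order_refl] clock_strict_mono[OF \<eta>, of 0 "time_change \<eta>1 \<eta>2 0"]
    by (cases "time_change \<eta>1 \<eta>2 0 = 0") (auto simp: clock_def)
  moreover have "(LINT s:{0::real}|lborel. f s) = (0::real)" for f
  proof -
    have "AE s in lborel. indicator {0::real} s *\<^sub>R f s = 0"
      using AE_lborel_singleton[of 0] by eventually_elim auto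
    then show ?thesis unfolding set_lebesgue_integral_def by (rule integral_eq_zero_AE)
  qed
  ultimately show ?thesis by (simp add: star_scale_trunc_def del: set_integral_mult_right)
qed

text \<open>Scaling by \<open>exp s\<close> multiplies the Lipschitz constant by
  \<open>exp s\<close>; integrated up to the time change this is at most
  \<open>exp (t + \<eta>1 / \<eta>2)\<close>.\<close>

lemma star_scale_trunc_lipschitz:
  assumes \<eta>: "0 \<le> \<eta>1" "\<eta>1 \<le> 1" "0 < \<eta>2" and t: "0 \<le> t" and cont: "continuous_on UNIV \<kappa>"
    and \<Lambda>: "0 \<le> \<Lambda>" "\<And>x y. \<bar>\<kappa> x - \<kappa> y\<bar> \<le> \<Lambda> * dist x y"
  shows "\<bar>star_scale_trunc \<eta>1 \<eta>2 \<kappa> t x y - star_scale_trunc \<eta>1 \<eta>2 \<kappa> t x' y\<bar>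
     \<le> (\<Lambda> * exp (\<eta>1 / \<eta>2)) * exp t * dist x x'"
proof -
  let ?u = "time_change \<eta>1 \<eta>2 t"
  let ?f = "\<lambda>x s. (1 - \<eta>1 * exp (- \<eta>2 * s)) * \<kappa> (exp s *\<^sub>R (x - y))"
  have u: "0 \<le> ?u" "?u \<le> t + \<eta>1 / \<eta>2" using time_change_clock[OF \<eta> t] by auto
  have int: "set_integrable lborel {0..?u} (?f x)" for x
    by (intro borel_integrable_atLeastAtMost' star_scale_integrand_cont cont)
  have int_e: "set_integrable lborel {0..?u} (\<lambda>s. \<Lambda> * dist x x' * exp s)"
    by (intro borel_integrable_atLeastAtMost' continuous_intros)
  have pw: "norm (?f x s - ?f x' s) \<le> \<Lambda> * dist x x' * exp s" if s: "s \<in> {0..?u}" for s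
  proof -
    have w: "0 \<le> 1 - \<eta>1 * exp (- \<eta>2 * s)" "1 - \<eta>1 * exp (- \<eta>2 * s) \<le> 1"
      using \<eta> s mult_le_one[of \<eta>1 "exp (- \<eta>2 * s)"] by auto
    have "norm (?f x s - ?f x' s) = (1 - \<eta>1 * exp (- \<eta>2 * s)) * \<bar>\<kappa> (exp s *\<^sub>R (x - y)) - \<kappa> (exp s *\<^sub>R (x' - y))\<bar>"
      using w by (simp add: right_diff_distrib[symmetric] abs_mult)
    also have "\<dots> \<le> 1 * (\<Lambda> * dist (exp s *\<^sub>R (x - y)) (exp s *\<^sub>R (x' - y)))"
      using w by (intro mult_mono \<Lambda>) auto
    also have "dist (exp s *\<^sub>R (x - y)) (exp s *\<^sub>R (x' - y)) = exp s * dist x x'"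
      by (simp add: dist_norm flip: scaleR_diff_right)
    finally show ?thesis by (simp add: mult_ac)
  qed
  have "\<bar>star_scale_trunc \<eta>1 \<eta>2 \<kappa> t x y - star_scale_trunc \<eta>1 \<eta>2 \<kappa> t x' y\<bar>
      = norm (LINT s:{0..?u}|lborel. ?f x s - ?f x' s)"
    by (simp only: star_scale_trunc_def set_integral_diff(2)[OF int int] real_norm_def)
  also have "\<dots> \<le> (LINT s:{0..?u}|lborel. norm (?f x s - ?f x' s))"
    by (intro set_integral_norm_bound set_integral_diff int)
  also have "\<dots> \<le> (LINT s:{0..?u}|lborel. \<Lambda> * dist x x' * exp s)"
    by (intro set_integral_mono set_integrable_norm set_integral_diff int int_e pw)
  also have "\<dots> = \<Lambda> * dist x x' * exp ?u - \<Lambda> * dist x x' * exp 0"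
  proof -
    have "(LINT s|lborel. (\<Lambda> * dist x x' * exp s) * indicator {0..?u} s) = \<Lambda> * dist x x' * exp ?u - \<Lambda> * dist x x' * exp 0"
      by (rule integral_FTC_Icc_real) (use u in \<open>auto intro!: derivative_eq_intros continuous_intros\<close>)
    then show ?thesis
      by (simp only: set_lebesgue_integral_def real_scaleR_def mult.commute[of "indicator _ _"])
  qed
  also have "\<dots> \<le> \<Lambda> * dist x x' * exp (t + \<eta>1 / \<eta>2)"
    using u \<Lambda> by (simp add: mult_left_mono le_diff_eq add_increasing2 diff_le_eq add_increasing)
  also have "\<dots> = (\<Lambda> * exp (\<eta>1 / \<eta>2)) * exp t * dist x x'"
    by (simp add: exp_add)
  finally show ?thesis .
qed

section \<open>From the martingale approximation to the abstract field\<close>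

definition gaussian_span :: "'i set \<Rightarrow> ('i \<Rightarrow> 'w \<Rightarrow> real) \<Rightarrow> ('w \<Rightarrow> real) set" where
  "gaussian_span I Z = {Y. \<exists>F c. finite F \<and> F \<subseteq> I \<and> Y = (\<lambda>\<omega>. \<Sum>i\<in>F. c i * Z i \<omega>)}"

lemma gaussian_spanI: "finite F \<Longrightarrow> F \<subseteq> I \<Longrightarrow> (\<lambda>\<omega>. \<Sum>i\<in>F. c i * Z i \<omega>) \<in> gaussian_span I Z"
  by (auto simp: gaussian_span_def)

lemma gaussian_spanE:
  assumes "Y \<in> gaussian_span I Z"
  obtains F c where "finite F" "F \<subseteq> I" "Y = (\<lambda>\<omega>. \<Sum>i\<in>F. c i * Z i \<omega>)"
  using assms by (auto simp: gaussian_span_def)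

lemma gaussian_space_span:
  assumes "centered_gaussian_process M I Z"
  shows "gaussian_space M (gaussian_span I Z)"
  unfolding gaussian_space_def
proof (intro conjI ballI allI)
  fix Y assume "Y \<in> gaussian_span I Z"
  then show "centered_gaussian_rv M Y"
    by (rule gaussian_spanE) (use assms in \<open>simp add: centered_gaussian_process_def\<close>)
next
  show "(\<lambda>_. 0) \<in> gaussian_span I Z"
    using gaussian_spanI[of "{}" I] by simp
next
  fix Y W assume YW: "Y \<in> gaussian_span I Z" "W \<in> gaussian_span I Z"
  obtain F c where F: "finite F" "F \<subseteq> I" and Y: "Y = (\<lambda>\<omega>. \<Sum>i\<in>F. c i * Z i \<omega>)"
    using YW(1) by (rule gaussian_spanE)
  obtain G d where G: "finite G" "G \<subseteq> I" and W: "W = (\<lambda>\<omega>. \<Sum>i\<in>G. d i * Z i \<omega>)"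
    using YW(2) by (rule gaussian_spanE)
  let ?e = "\<lambda>i. (if i \<in> F then c i else 0) + (if i \<in> G then d i else 0)"
  have "Y \<omega> + W \<omega> = (\<Sum>i\<in>F \<union> G. ?e i * Z i \<omega>)" for \<omega>
  proof -
    have "(\<Sum>i\<in>F. c i * Z i \<omega>) = (\<Sum>i\<in>F \<union> G. (if i \<in> F then c i else 0) * Z i \<omega>)"
      using F G by (intro sum.mono_neutral_cong_left) auto
    moreover have "(\<Sum>i\<in>G. d i * Z i \<omega>) = (\<Sum>i\<in>F \<union> G. (if i \<in> G then d i else 0) * Z i \<omega>)"
      using F G by (intro sum.mono_neutral_cong_left) auto
    ultimately show ?thesis by (simp only: Y W distrib_right sum.distrib)
  qed
  then have "(\<lambda>\<omega>. Y \<omega> + W \<omega>) = (\<lambda>\<omega>. \<Sum>i\<in>F \<union> G. ?e i * Z i \<omega>)" by (intro ext)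
  also have "\<dots> \<in> gaussian_span I Z"
    using F G by (intro gaussian_spanI) auto
  finally show "(\<lambda>\<omega>. Y \<omega> + W \<omega>) \<in> gaussian_span I Z" .
next
  fix Y a assume "Y \<in> gaussian_span I Z"
  then obtain F c where F: "finite F" "F \<subseteq> I" and Y: "Y = (\<lambda>\<omega>. \<Sum>i\<in>F. c i * Z i \<omega>)"
    by (rule gaussian_spanE)
  have "(\<lambda>\<omega>. a * Y \<omega>) = (\<lambda>\<omega>. \<Sum>i\<in>F. (a * c i) * Z i \<omega>)"
    by (simp add: Y sum_distrib_left mult.assoc)
  also have "\<dots> \<in> gaussian_span I Z" by (rule gaussian_spanI[OF F])
  finally show "(\<lambda>\<omega>. a * Y \<omega>) \<in> gaussian_span I Z" .
qed

lemma gaussian_span_base: "i \<in> I \<Longrightarrow> Z i \<in> gaussian_span I Z"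
  using gaussian_spanI[of "{i}" I "\<lambda>_. 1" Z] by simp

lemma star_field_of_martingale_approximation:
  fixes M :: "'w measure" and K :: "'a::euclidean_space \<Rightarrow> 'a \<Rightarrow> ereal" and X :: "real \<Rightarrow> 'a \<Rightarrow> 'w \<Rightarrow> real"
  assumes M: "prob_space M" and K: "almost_star_scale_part K K0 \<eta>1 \<eta>2 \<kappa>"
    and Kt: "Kt = trunc_kernel K0 \<eta>1 \<eta>2 \<kappa>" and X: "martingale_approximation M Kt X"
  obtains \<Lambda> where "star_field M (gaussian_span ({0..} \<times> UNIV) (\<lambda>(t, x). X t x)) (Xbar X)
     (star_scale_trunc \<eta>1 \<eta>2 \<kappa>) \<Lambda> (sqrt (2 * DIM('a)))"
proof -
  interpret prob_space M by (rule M)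
  have \<eta>: "0 \<le> \<eta>1" "\<eta>1 \<le> 1" "0 < \<eta>2" and \<kappa>: "seed_covariance \<kappa>"
    using K by (auto simp: almost_star_scale_part_def)
  have Cc: "\<kappa> \<in> Cc_smooth" and \<kappa>0: "\<kappa> 0 = 1"
    using \<kappa> by (auto simp: seed_covariance_def)
  have "C_k 0 \<kappa>" using Cc by (auto simp: Cc_smooth_def smooth_def)
  then have cont: "continuous_on UNIV \<kappa>" by simp
  obtain \<Lambda> where \<Lambda>: "0 \<le> \<Lambda>" "\<And>x y. \<bar>\<kappa> x - \<kappa> y\<bar> \<le> \<Lambda> * dist x y"
    using Cc_smooth_lipschitz[OF Cc] by blast
  let ?Z = "\<lambda>(t, x). X t x" and ?I = "{0..} \<times> (UNIV :: 'a set)"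
  let ?V = "gaussian_span ?I ?Z"
  have V: "gaussian_space M ?V"
    using X by (intro gaussian_space_span) (simp add: martingale_approximation_def)
  have XV: "X t x \<in> ?V" if "0 \<le> t" for t x
    using gaussian_span_base[of "(t, x)" ?I ?Z] that by simp
  have ipX: "ip (X s x) (X t y) = Kt (min s t) x y" if "0 \<le> s" "0 \<le> t" for s t x y
    using X that by (auto simp: martingale_approximation_def ip_def min.commute)
  have "star_field M ?V (Xbar X) (star_scale_trunc \<eta>1 \<eta>2 \<kappa>) (\<Lambda> * exp (\<eta>1 / \<eta>2)) (sqrt (2 * DIM('a)))"
  proof
    show "gaussian_space M ?V" by (rule V)
    show XbV: "Xbar X t x \<in> ?V" if "0 \<le> t" for t x
      unfolding Xbar_def[abs_def] using that by (intro gaussian_space_diff[OF V] XV) auto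
    show "Xbar X 0 x \<omega> = 0" for x \<omega> by (simp add: Xbar_def)
    show "ip (Xbar X s x) (Xbar X t y) = star_scale_trunc \<eta>1 \<eta>2 \<kappa> (min s t) x y" if "0 \<le> s" "0 \<le> t" for s t x y
    proof -
      have "ip (Xbar X s x) (Xbar X t y) = ip (X s x) (X t y) - ip (X 0 x) (X t y) - (ip (X s x) (X 0 y) - ip (X 0 x) (X 0 y))"
        unfolding Xbar_def[abs_def] using that
        by (simp add: ip_diff[OF V] ip_diff_right[OF V] XV gaussian_space_diff[OF V])
      \<comment> \<open>Removing the value at time 0 removes \<open>K0\<close> from the covariance,
        because the truncated star-scale kernel vanishes at time 0.\<close>
      also have "\<dots> = Kt (min s t) x y - Kt 0 x y"
        using that by (simp add: ipX min_def)
      also have "\<dots> = star_scale_trunc \<eta>1 \<eta>2 \<kappa> (min s t) x y"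
        by (simp add: Kt trunc_kernel_def star_scale_trunc_zero[OF \<eta>])
      finally show ?thesis .
    qed
    show "star_scale_trunc \<eta>1 \<eta>2 \<kappa> t x x = t" if "0 \<le> t" for t and x :: 'a
      by (rule star_scale_trunc_diag) (use \<eta> that \<kappa>0 in auto)
    show "\<bar>star_scale_trunc \<eta>1 \<eta>2 \<kappa> t x y - star_scale_trunc \<eta>1 \<eta>2 \<kappa> t x' y\<bar> \<le> \<Lambda> * exp (\<eta>1 / \<eta>2) * exp t * dist x x'"
      if "0 \<le> t" for t x x' y
      by (rule star_scale_trunc_lipschitz) (use \<eta> that cont \<Lambda> in auto)
    show "0 \<le> \<Lambda> * exp (\<eta>1 / \<eta>2)" using \<Lambda> by simp
    show "continuous_on ({0..} \<times> UNIV) (\<lambda>(t, x). Xbar X t x \<omega>)" if \<omega>: "\<omega> \<in> space M" for \<omega>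
    proof -
      have c: "continuous_on ({0..} \<times> UNIV) (\<lambda>(t, x). X t x \<omega>)"
        using X \<omega> by (simp add: martingale_approximation_def)
      have "continuous_on ({0..} \<times> UNIV) (\<lambda>p. (\<lambda>(t, x). X t x \<omega>) (0, snd p))"
        by (rule continuous_on_compose2[OF c]) (auto intro!: continuous_intros)
      then show ?thesis
        using c unfolding Xbar_def by (auto simp: split_def intro!: continuous_intros)
    qed
  qed simp
  then show ?thesis using that by blast
qed

theorem proposition2p4:
  fixes M :: "'w measure"
    and K :: "'a::euclidean_space \<Rightarrow> 'a \<Rightarrow> ereal"
    and K0 :: "'a \<Rightarrow> 'a \<Rightarrow> real"
    and Kt :: "real \<Rightarrow> 'a \<Rightarrow> 'a \<Rightarrow> real"
    and \<eta>1 \<eta>2 R :: real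
    and \<kappa> \<theta> :: "'a \<Rightarrow> real"
    and X Xe :: "real \<Rightarrow> 'a \<Rightarrow> 'w \<Rightarrow> real"
  assumes "prob_space M"
    and "almost_star_scale_part K K0 \<eta>1 \<eta>2 \<kappa>"
    and "Kt = trunc_kernel K0 \<eta>1 \<eta>2 \<kappa>"
    and "martingale_approximation M Kt X"
    and "mollifier \<theta>"
    and "mollified_field M X \<theta> Xe"
    and "R > 0"
  shows
    "(AE \<omega> in M.
        (SUP t\<in>{exp 1..}. SUP x\<in>cball 0 R.
           ereal (Xbar X t x \<omega> - sqrt (2 * DIM('a)) * t + ln t / (2 * sqrt (2 * DIM('a)))
             - 4 * ln (ln t) / sqrt (2 * DIM('a)))) < \<infinity>)
     \<and> ((\<lambda>q. measure M (global_barrier_event M X q R)) \<longlongrightarrow> 1) at_top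
     \<and> (AE \<omega> in M. \<exists>q0::nat. \<forall>q\<ge>real q0.
           (\<forall>\<alpha>\<in>{0<..sqrt (2 * DIM('a))}. \<forall>t\<ge>0. \<forall>E\<in>sets borel. E \<subseteq> cball 0 R \<longrightarrow>
              chaos_t_barrier M Kt X \<alpha> q t \<omega> E = chaos_t Kt X \<alpha> t \<omega> E)
           \<and> (\<forall>\<epsilon>\<in>{0<..1}. \<forall>E\<in>sets borel. E \<subseteq> cball 0 R \<longrightarrow>
              chaos_eps_barrier M X Xe q \<epsilon> \<omega> E = chaos_eps M Xe \<epsilon> \<omega> E))"
proof -
  obtain \<Lambda> where "star_field M (gaussian_span ({0..} \<times> UNIV) (\<lambda>(t, x). X t x)) (Xbar X)
     (star_scale_trunc \<eta>1 \<eta>2 \<kappa>) \<Lambda> (sqrt (2 * DIM('a)))"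
    using star_field_of_martingale_approximation[OF assms(1-4)] by blast
  then interpret star_field M "gaussian_span ({0..} \<times> UNIV) (\<lambda>(t, x). X t x)" "Xbar X"
    "star_scale_trunc \<eta>1 \<eta>2 \<kappa>" \<Lambda> "sqrt (2 * DIM('a))" .
  let ?g = "sqrt (2 * DIM('a))"
  have R: "0 \<le> R" using assms(7) by simp
  have "AE \<omega> in M. (SUP t\<in>{exp 1..}. SUP x\<in>cball 0 R.
           ereal (Xbar X t x \<omega> - ?g * t + ln t / (2 * ?g) - 4 * ln (ln t) / ?g)) < \<infinity>"
    using AE_sup_finite[OF R]
  proof eventually_elim
    case (elim \<omega>)
    then obtain c where c: "\<And>t x. exp 1 \<le> t \<Longrightarrow> norm x \<le> R \<Longrightarrow>
       Xbar X t x \<omega> - ?g * t + ln t / (2 * ?g) - 4 * ln (ln t) / ?g \<le> c" by blast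
    have "(SUP t\<in>{exp 1..}. SUP x\<in>cball 0 R.
           ereal (Xbar X t x \<omega> - ?g * t + ln t / (2 * ?g) - 4 * ln (ln t) / ?g)) \<le> ereal c"
      by (intro SUP_least, subst ereal_less_eq, rule c) auto
    also have "\<dots> < \<infinity>" by simp
    finally show ?case .
  qed
  moreover have "((\<lambda>q. measure M (global_barrier_event M X q R)) \<longlongrightarrow> 1) at_top"
    using prob_sup_excess_tendsto[OF R] unfolding sup_excess_def global_barrier_event_def .
  moreover have "AE \<omega> in M. \<exists>q0::nat. \<forall>q\<ge>real q0.
           (\<forall>\<alpha>\<in>{0<..?g}. \<forall>t\<ge>0. \<forall>E\<in>sets borel. E \<subseteq> cball 0 R \<longrightarrow>
              chaos_t_barrier M Kt X \<alpha> q t \<omega> E = chaos_t Kt X \<alpha> t \<omega> E)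
           \<and> (\<forall>\<epsilon>\<in>{0<..1}. \<forall>E\<in>sets borel. E \<subseteq> cball 0 R \<longrightarrow>
              chaos_eps_barrier M X Xe q \<epsilon> \<omega> E = chaos_eps M Xe \<epsilon> \<omega> E)"
    using AE_global_barrier[OF R] AE_space
  proof eventually_elim
    case (elim \<omega>)
    then obtain q1 :: nat where q1: "\<And>t x. 0 \<le> t \<Longrightarrow> norm x \<le> R \<Longrightarrow> Xbar X t x \<omega> \<le> ?g * t + q1" by blast
    \<comment> \<open>\<open>Suc\<close> turns the weak bound into the strict one of the event. One
      null set serves all parameters: off it every indicator with \<open>x\<close> in the ball
      equals one, so the integrands agree pointwise.\<close>
    have mem: "\<omega> \<in> barrier_event M X q t x" if "real (Suc q1) \<le> q" "x \<in> cball 0 R" for q t x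
      unfolding barrier_event_def using elim(2) q1 that by fastforce
    show ?case
    proof (intro exI[of _ "Suc q1"] allI impI conjI ballI)
      fix q \<alpha> t :: real and E :: "'a set" assume "real (Suc q1) \<le> q" "E \<subseteq> cball 0 R"
      then show "chaos_t_barrier M Kt X \<alpha> q t \<omega> E = chaos_t Kt X \<alpha> t \<omega> E"
        unfolding chaos_t_barrier_def chaos_t_def
        by (intro nn_integral_cong) (auto simp: indicator_def intro: mem)
    next
      fix q \<epsilon> :: real and E :: "'a set" assume "real (Suc q1) \<le> q" "E \<subseteq> cball 0 R"
      then show "chaos_eps_barrier M X Xe q \<epsilon> \<omega> E = chaos_eps M Xe \<epsilon> \<omega> E"
        unfolding chaos_eps_barrier_def chaos_eps_def
        by (intro nn_integral_cong) (auto simp: indicator_def intro: mem)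
    qed
  qed
  ultimately show ?thesis by blast
qed

end
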